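(* Let $(\mathfrak{g},\Omega)$ be a magnetic structure on a manifold $S$ with $\Omega=-d\omega$ for some one-form $\omega$ on $S$, and let $c>0$. A curve $\gamma:[a,b]\to S$ is a magnetic geodesic of energy $c$ if and only if it is a pregeodesic of the pre-Randers metric $$F_c(v)=\sqrt{\mathfrak{g}(v,v)}+\frac1{\sqrt{2c}}\,\omega(v),\qquad v\in TS,$$ parametrized with $\mathfrak{g}(\dot\gamma,\dot\gamma)=2c$.
   Context: A magnetic structure on $S$ is a pair $(\mathfrak{g},\Omega)$ with $\mathfrak{g}$ a Riemannian metric and $\Omega$ an exact $2$-form on $S$. A magnetic geodesic is a curve $\gamma$ satisfying $\frac{D\dot\gamma}{dt}=Y_\gamma(\dot\gamma)$, where $D/dt$ is the covariant derivative along $\gamma$ associated with $\mathfrak{g}$ and $Y_p:T_pS\to T_pS$ is determined by $\Omega_p(u,v)=\mathfrak{g}(Y_p(u),v)$ for all $u,v\in T_pS$. Then $\mathfrak{g}(\dot\gamma,\dot\gamma)$ is constant and $\frac12\mathfrak{g}(\dot\gamma,\dot\gamma)$ is the energy of $\gamma$. A pregeodesic of $F_c$ is a critical point of $\ell_{F_c}(\gamma)=\int F_c(\dot\gamma)\,ds$ among piecewise smooth curves with the same endpoints. *)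

theory Defs
  imports "HOL-Analysis.Analysis"
begin

section \<open>Smooth maps between open subsets of Euclidean spaces\<close>

primrec Ck_on :: "nat \<Rightarrow> 'x::euclidean_space set \<Rightarrow> ('x \<Rightarrow> 'y::real_normed_vector) \<Rightarrow> bool" where
  "Ck_on 0 X f \<longleftrightarrow> continuous_on X f"
| "Ck_on (Suc k) X f \<longleftrightarrow>
     (\<forall>x\<in>X. f differentiable (at x)) \<and> (\<forall>v. Ck_on k X (\<lambda>x. frechet_derivative f (at x) v))"

definition smooth_on :: "'x::euclidean_space set \<Rightarrow> ('x \<Rightarrow> 'y::real_normed_vector) \<Rightarrow> bool" where
  "smooth_on X f \<longleftrightarrow> open X \<and> (\<forall>k. Ck_on k X f)"


section \<open>Manifolds and tangent vectors\<close>

text \<open>A chart is a pair of its domain and its coordinate map; the values of the coordinate map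
  outside the domain are irrelevant. The underlying set of the manifold is the whole type.\<close>

type_synonym ('a, 'n) chart = "'a set \<times> ('a \<Rightarrow> real ^ 'n)"

abbreviation chart_inv :: "('a, 'n) chart \<Rightarrow> real ^ 'n \<Rightarrow> 'a" where
  "chart_inv \<phi> \<equiv> inv_into (fst \<phi>) (snd \<phi>)"

abbreviation chart_image :: "('a, 'n) chart \<Rightarrow> (real ^ 'n) set" where
  "chart_image \<phi> \<equiv> snd \<phi> ` fst \<phi>"

definition smooth_manifold ::
    "('a::{t2_space, second_countable_topology}, 'n::finite) chart set \<Rightarrow> bool" where
  "smooth_manifold A \<longleftrightarrow>
     (\<Union>\<phi>\<in>A. fst \<phi>) = UNIV \<and>
     (\<forall>\<phi>\<in>A. open (fst \<phi>) \<and> open (chart_image \<phi>) \<and>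
            homeomorphism (fst \<phi>) (chart_image \<phi>) (snd \<phi>) (chart_inv \<phi>)) \<and>
     (\<forall>\<phi>\<in>A. \<forall>\<psi>\<in>A. smooth_on (snd \<phi> ` (fst \<phi> \<inter> fst \<psi>)) (snd \<psi> \<circ> chart_inv \<phi>))"

definition charts_at :: "('a, 'n) chart set \<Rightarrow> 'a \<Rightarrow> ('a, 'n) chart set" where
  "charts_at A p = {\<phi>\<in>A. p \<in> fst \<phi>}"

text \<open>A tangent vector at \<open>p\<close> assigns to each chart at \<open>p\<close> its vector of components in that chart, the
  components in two charts being related by the differential of the transition map. To charts not
  containing \<open>p\<close> it assigns \<open>0\<close>, so that equality of tangent vectors is equality of functions.
  The vector space operations are pointwise.\<close>

type_synonym ('a, 'n) tvec = "('a, 'n) chart \<Rightarrow> real ^ 'n"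

definition transition_deriv ::
    "('a, 'n::finite) chart \<Rightarrow> ('a, 'n) chart \<Rightarrow> 'a \<Rightarrow> real ^ 'n \<Rightarrow> real ^ 'n" where
  "transition_deriv \<phi> \<psi> p = frechet_derivative (snd \<psi> \<circ> chart_inv \<phi>) (at (snd \<phi> p))"

definition tangent_space :: "('a, 'n::finite) chart set \<Rightarrow> 'a \<Rightarrow> ('a, 'n) tvec set" where
  "tangent_space A p =
     {v. (\<forall>\<phi>\<in>charts_at A p. \<forall>\<psi>\<in>charts_at A p. v \<psi> = transition_deriv \<phi> \<psi> p (v \<phi>)) \<and>
         (\<forall>\<phi>. \<phi> \<notin> charts_at A p \<longrightarrow> v \<phi> = 0)}"

definition tvec_comb :: "real \<Rightarrow> ('a, 'n::finite) tvec \<Rightarrow> real \<Rightarrow> ('a, 'n) tvec \<Rightarrow> ('a, 'n) tvec" where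
  "tvec_comb r u s v = (\<lambda>\<phi>. r *\<^sub>R u \<phi> + s *\<^sub>R v \<phi>)"

text \<open>The tangent vector at \<open>p\<close> with components \<open>w\<close> in the chart \<open>\<phi>\<close> at \<open>p\<close>.\<close>

definition tvec_of :: "('a, 'n::finite) chart set \<Rightarrow> ('a, 'n) chart \<Rightarrow> 'a \<Rightarrow> real ^ 'n \<Rightarrow> ('a, 'n) tvec" where
  "tvec_of A \<phi> p w = (\<lambda>\<psi>. if \<psi> \<in> charts_at A p then transition_deriv \<phi> \<psi> p w else 0)"


section \<open>Tensor fields\<close>

text \<open>The values of tensor fields on arguments that are not tangent vectors at the base point
  are irrelevant.\<close>

type_synonym ('a, 'n) covector_field = "'a \<Rightarrow> ('a, 'n) tvec \<Rightarrow> real"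
type_synonym ('a, 'n) bilinear_field = "'a \<Rightarrow> ('a, 'n) tvec \<Rightarrow> ('a, 'n) tvec \<Rightarrow> real"

text \<open>Coordinate expressions in a chart, evaluated at the point with coordinates \<open>x\<close>.\<close>

definition coord1 :: "('a, 'n::finite) chart set \<Rightarrow> ('a, 'n) chart \<Rightarrow> ('a, 'n) covector_field
    \<Rightarrow> real ^ 'n \<Rightarrow> real ^ 'n \<Rightarrow> real" where
  "coord1 A \<phi> \<omega> x u = (let p = chart_inv \<phi> x in \<omega> p (tvec_of A \<phi> p u))"

definition coord2 :: "('a, 'n::finite) chart set \<Rightarrow> ('a, 'n) chart \<Rightarrow> ('a, 'n) bilinear_field
    \<Rightarrow> real ^ 'n \<Rightarrow> real ^ 'n \<Rightarrow> real ^ 'n \<Rightarrow> real" where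
  "coord2 A \<phi> B x u v = (let p = chart_inv \<phi> x in B p (tvec_of A \<phi> p u) (tvec_of A \<phi> p v))"

definition one_form :: "('a, 'n::finite) chart set \<Rightarrow> ('a, 'n) covector_field \<Rightarrow> bool" where
  "one_form A \<omega> \<longleftrightarrow>
     (\<forall>p. \<forall>u\<in>tangent_space A p. \<forall>v\<in>tangent_space A p. \<forall>r s.
        \<omega> p (tvec_comb r u s v) = r * \<omega> p u + s * \<omega> p v) \<and>
     (\<forall>\<phi>\<in>A. \<forall>u. smooth_on (chart_image \<phi>) (\<lambda>x. coord1 A \<phi> \<omega> x u))"

definition smooth_bilinear_field ::
    "('a, 'n::finite) chart set \<Rightarrow> ('a, 'n) bilinear_field \<Rightarrow> bool" where
  "smooth_bilinear_field A B \<longleftrightarrow>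
     (\<forall>p. \<forall>u\<in>tangent_space A p. \<forall>v\<in>tangent_space A p. \<forall>w\<in>tangent_space A p. \<forall>r s.
        B p (tvec_comb r u s v) w = r * B p u w + s * B p v w \<and>
        B p w (tvec_comb r u s v) = r * B p w u + s * B p w v) \<and>
     (\<forall>\<phi>\<in>A. \<forall>u v. smooth_on (chart_image \<phi>) (\<lambda>x. coord2 A \<phi> B x u v))"

definition riemannian_metric :: "('a, 'n::finite) chart set \<Rightarrow> ('a, 'n) bilinear_field \<Rightarrow> bool" where
  "riemannian_metric A g \<longleftrightarrow>
     smooth_bilinear_field A g \<and>
     (\<forall>p. \<forall>u\<in>tangent_space A p. \<forall>v\<in>tangent_space A p. g p u v = g p v u) \<and>
     (\<forall>p. \<forall>u\<in>tangent_space A p. u \<noteq> (\<lambda>\<phi>. 0) \<longrightarrow> g p u u > 0)"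

definition two_form :: "('a, 'n::finite) chart set \<Rightarrow> ('a, 'n) bilinear_field \<Rightarrow> bool" where
  "two_form A \<Omega> \<longleftrightarrow>
     smooth_bilinear_field A \<Omega> \<and>
     (\<forall>p. \<forall>u\<in>tangent_space A p. \<forall>v\<in>tangent_space A p. \<Omega> p u v = - \<Omega> p v u)"

text \<open>\<open>\<Theta> = d\<theta>\<close>, where \<open>d\<theta>(u,v) = u(\<theta>(v)) - v(\<theta>(u)) - \<theta>([u,v])\<close>, that is,
  \<open>(d\<theta>)\<^sub>i\<^sub>j = \<partial>\<^sub>i\<theta>\<^sub>j - \<partial>\<^sub>j\<theta>\<^sub>i\<close> in every chart: the vectors are extended with constant components in
  the chart, so the bracket vanishes. The right-hand side does not depend on the chart.\<close>

definition has_exterior_derivative ::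
    "('a, 'n::finite) chart set \<Rightarrow> ('a, 'n) covector_field \<Rightarrow> ('a, 'n) bilinear_field \<Rightarrow> bool" where
  "has_exterior_derivative A \<theta> \<Theta> \<longleftrightarrow>
     (\<forall>p. \<forall>u\<in>tangent_space A p. \<forall>v\<in>tangent_space A p. \<forall>\<phi>\<in>charts_at A p.
        \<Theta> p u v =
          frechet_derivative (\<lambda>x. coord1 A \<phi> \<theta> x (v \<phi>)) (at (snd \<phi> p)) (u \<phi>)
        - frechet_derivative (\<lambda>x. coord1 A \<phi> \<theta> x (u \<phi>)) (at (snd \<phi> p)) (v \<phi>))"

definition exact_two_form :: "('a, 'n::finite) chart set \<Rightarrow> ('a, 'n) bilinear_field \<Rightarrow> bool" where
  "exact_two_form A \<Omega> \<longleftrightarrow>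
     two_form A \<Omega> \<and> (\<exists>\<theta>. one_form A \<theta> \<and> has_exterior_derivative A \<theta> \<Omega>)"

definition magnetic_structure ::
    "('a, 'n::finite) chart set \<Rightarrow> ('a, 'n) bilinear_field \<Rightarrow> ('a, 'n) bilinear_field \<Rightarrow> bool" where
  "magnetic_structure A g \<Omega> \<longleftrightarrow> riemannian_metric A g \<and> exact_two_form A \<Omega>"


section \<open>Curves\<close>

text \<open>Smoothness of a map into the manifold on an arbitrary set \<open>X\<close>: near each point of \<open>X\<close> the
  coordinate expression extends to a smooth map on an open set.\<close>

definition smooth_map_on ::
    "('a, 'n::finite) chart set \<Rightarrow> 'x::euclidean_space set \<Rightarrow> ('x \<Rightarrow> 'a) \<Rightarrow> bool" where
  "smooth_map_on A X h \<longleftrightarrow>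
     (\<forall>x\<in>X. \<exists>\<phi>\<in>A. \<exists>W f. x \<in> W \<and> smooth_on W f \<and>
        (\<forall>y\<in>X \<inter> W. h y \<in> fst \<phi> \<and> snd \<phi> (h y) = f y))"

definition partition_of :: "real \<Rightarrow> real \<Rightarrow> nat \<Rightarrow> (nat \<Rightarrow> real) \<Rightarrow> bool" where
  "partition_of a b k \<tau> \<longleftrightarrow> \<tau> 0 = a \<and> \<tau> k = b \<and> (\<forall>i<k. \<tau> i < \<tau> (Suc i))"

text \<open>Since smoothness is required on the closed pieces, continuity on \<open>{a..b}\<close> is included.\<close>

definition piecewise_smooth ::
    "('a, 'n::finite) chart set \<Rightarrow> real \<Rightarrow> real \<Rightarrow> (real \<Rightarrow> 'a) \<Rightarrow> bool" where
  "piecewise_smooth A a b \<gamma> \<longleftrightarrow>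
     (\<exists>k \<tau>. partition_of a b k \<tau> \<and> (\<forall>i<k. smooth_map_on A {\<tau> i..\<tau> (Suc i)} \<gamma>))"

text \<open>The velocity of a curve on \<open>{a..b}\<close> (one-sided at the endpoints). At a corner the value is
  unspecified.\<close>

definition velocity ::
    "('a, 'n::finite) chart set \<Rightarrow> real \<Rightarrow> real \<Rightarrow> (real \<Rightarrow> 'a) \<Rightarrow> real \<Rightarrow> ('a, 'n) tvec" where
  "velocity A a b \<gamma> t = (\<lambda>\<phi>. if \<phi> \<in> charts_at A (\<gamma> t)
      then vector_derivative (snd \<phi> \<circ> \<gamma>) (at t within {a..b}) else 0)"

definition has_velocity_at ::
    "('a, 'n::finite) chart set \<Rightarrow> real \<Rightarrow> real \<Rightarrow> (real \<Rightarrow> 'a) \<Rightarrow> real \<Rightarrow> bool" where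
  "has_velocity_at A a b \<gamma> t \<longleftrightarrow>
     (\<forall>\<phi>\<in>charts_at A (\<gamma> t). (snd \<phi> \<circ> \<gamma>) differentiable (at t within {a..b}))"


section \<open>Magnetic geodesics\<close>

definition metric_matrix :: "('a, 'n::finite) chart set \<Rightarrow> ('a, 'n) bilinear_field
    \<Rightarrow> ('a, 'n) chart \<Rightarrow> real ^ 'n \<Rightarrow> real ^ 'n ^ 'n" where
  "metric_matrix A g \<phi> x = (\<chi> i j. coord2 A \<phi> g x (axis i 1) (axis j 1))"

text \<open>\<open>\<partial>\<^sub>l g\<^sub>i\<^sub>j\<close>\<close>

definition metric_partial :: "('a, 'n::finite) chart set \<Rightarrow> ('a, 'n) bilinear_field
    \<Rightarrow> ('a, 'n) chart \<Rightarrow> real ^ 'n \<Rightarrow> 'n \<Rightarrow> 'n \<Rightarrow> 'n \<Rightarrow> real" where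
  "metric_partial A g \<phi> x l i j =
     frechet_derivative (\<lambda>y. metric_matrix A g \<phi> y $ i $ j) (at x) (axis l 1)"

text \<open>The Christoffel symbols \<open>\<Gamma>\<^sup>k\<^sub>i\<^sub>j\<close> of the Levi-Civita connection.\<close>

definition christoffel :: "('a, 'n::finite) chart set \<Rightarrow> ('a, 'n) bilinear_field
    \<Rightarrow> ('a, 'n) chart \<Rightarrow> real ^ 'n \<Rightarrow> 'n \<Rightarrow> 'n \<Rightarrow> 'n \<Rightarrow> real" where
  "christoffel A g \<phi> x k i j =
     (\<Sum>l\<in>UNIV. matrix_inv (metric_matrix A g \<phi> x) $ k $ l *
        (metric_partial A g \<phi> x i j l + metric_partial A g \<phi> x j i l
           - metric_partial A g \<phi> x l i j)) / 2"

text \<open>The covariant derivative of a vector field \<open>V\<close> along the curve \<open>\<gamma>\<close>: in every chart its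
  components are \<open>(V\<^sup>k)' + \<Gamma>\<^sup>k\<^sub>i\<^sub>j (\<gamma>\<^sup>i)' V\<^sup>j\<close>.\<close>

definition covariant_derivative :: "('a, 'n::finite) chart set \<Rightarrow> ('a, 'n) bilinear_field
    \<Rightarrow> real \<Rightarrow> real \<Rightarrow> (real \<Rightarrow> 'a) \<Rightarrow> (real \<Rightarrow> ('a, 'n) tvec) \<Rightarrow> real \<Rightarrow> ('a, 'n) tvec" where
  "covariant_derivative A g a b \<gamma> V t = (\<lambda>\<phi>. if \<phi> \<in> charts_at A (\<gamma> t)
      then vector_derivative (\<lambda>s. V s \<phi>) (at t within {a..b})
         + (\<chi> k. \<Sum>i\<in>UNIV. \<Sum>j\<in>UNIV.
              christoffel A g \<phi> (snd \<phi> (\<gamma> t)) k i j * velocity A a b \<gamma> t \<phi> $ i * V t \<phi> $ j)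
      else 0)"

definition lorentz_force :: "('a, 'n::finite) chart set \<Rightarrow> ('a, 'n) bilinear_field
    \<Rightarrow> ('a, 'n) bilinear_field \<Rightarrow> 'a \<Rightarrow> ('a, 'n) tvec \<Rightarrow> ('a, 'n) tvec" where
  "lorentz_force A g \<Omega> p u =
     (THE w. w \<in> tangent_space A p \<and> (\<forall>v\<in>tangent_space A p. \<Omega> p u v = g p w v))"

definition magnetic_geodesic :: "('a, 'n::finite) chart set \<Rightarrow> ('a, 'n) bilinear_field
    \<Rightarrow> ('a, 'n) bilinear_field \<Rightarrow> real \<Rightarrow> real \<Rightarrow> (real \<Rightarrow> 'a) \<Rightarrow> bool" where
  "magnetic_geodesic A g \<Omega> a b \<gamma> \<longleftrightarrow>
     smooth_map_on A {a..b} \<gamma> \<and>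
     (\<forall>t\<in>{a..b}. covariant_derivative A g a b \<gamma> (velocity A a b \<gamma>) t
                  = lorentz_force A g \<Omega> (\<gamma> t) (velocity A a b \<gamma> t))"

definition has_energy :: "('a, 'n::finite) chart set \<Rightarrow> ('a, 'n) bilinear_field
    \<Rightarrow> real \<Rightarrow> real \<Rightarrow> (real \<Rightarrow> 'a) \<Rightarrow> real \<Rightarrow> bool" where
  "has_energy A g a b \<gamma> c \<longleftrightarrow>
     (\<forall>t\<in>{a..b}. g (\<gamma> t) (velocity A a b \<gamma> t) (velocity A a b \<gamma> t) / 2 = c)"


section \<open>Pregeodesics\<close>

definition curve_length :: "('a, 'n::finite) chart set \<Rightarrow> ('a \<Rightarrow> ('a, 'n) tvec \<Rightarrow> real)
    \<Rightarrow> real \<Rightarrow> real \<Rightarrow> (real \<Rightarrow> 'a) \<Rightarrow> real" where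
  "curve_length A F a b \<gamma> = integral {a..b} (\<lambda>t. F (\<gamma> t) (velocity A a b \<gamma> t))"

text \<open>Piecewise smooth variations of \<open>\<gamma>\<close> with fixed endpoints, with variation parameter in
  \<open>{-\<epsilon><..<\<epsilon>}\<close>. The piece condition implies joint continuity on \<open>{-\<epsilon><..<\<epsilon>} \<times> {a..b}\<close>.\<close>

definition proper_variation :: "('a, 'n::finite) chart set \<Rightarrow> real \<Rightarrow> real \<Rightarrow> (real \<Rightarrow> 'a)
    \<Rightarrow> real \<Rightarrow> (real \<Rightarrow> real \<Rightarrow> 'a) \<Rightarrow> bool" where
  "proper_variation A a b \<gamma> \<epsilon> H \<longleftrightarrow>
     \<epsilon> > 0 \<and>
     (\<exists>k \<tau>. partition_of a b k \<tau> \<and>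
        (\<forall>i<k. smooth_map_on A ({-\<epsilon><..<\<epsilon>} \<times> {\<tau> i..\<tau> (Suc i)}) (\<lambda>(s, t). H s t))) \<and>
     (\<forall>t\<in>{a..b}. H 0 t = \<gamma> t) \<and>
     (\<forall>s\<in>{-\<epsilon><..<\<epsilon>}. H s a = \<gamma> a \<and> H s b = \<gamma> b)"

definition pregeodesic :: "('a, 'n::finite) chart set \<Rightarrow> ('a \<Rightarrow> ('a, 'n) tvec \<Rightarrow> real)
    \<Rightarrow> real \<Rightarrow> real \<Rightarrow> (real \<Rightarrow> 'a) \<Rightarrow> bool" where
  "pregeodesic A F a b \<gamma> \<longleftrightarrow>
     piecewise_smooth A a b \<gamma> \<and>
     (\<forall>\<epsilon> H. proper_variation A a b \<gamma> \<epsilon> H \<longrightarrow>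
        ((\<lambda>s. curve_length A F a b (H s)) has_real_derivative 0) (at 0))"

definition pre_randers :: "('a, 'n) bilinear_field \<Rightarrow> ('a, 'n) covector_field
    \<Rightarrow> 'a \<Rightarrow> ('a, 'n) tvec \<Rightarrow> real" where
  "pre_randers g \<beta> p v = sqrt (g p v v) + \<beta> p v"

text \<open>The condition \<open>g(\<gamma>',\<gamma>') = e\<close> wherever the velocity exists; for piecewise smooth curves that is
  all but finitely many parameters.\<close>

definition squared_speed :: "('a, 'n::finite) chart set \<Rightarrow> ('a, 'n) bilinear_field
    \<Rightarrow> real \<Rightarrow> real \<Rightarrow> (real \<Rightarrow> 'a) \<Rightarrow> real \<Rightarrow> bool" where
  "squared_speed A g a b \<gamma> e \<longleftrightarrow>
     (\<forall>t\<in>{a..b}. has_velocity_at A a b \<gamma> t \<longrightarrow>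
        g (\<gamma> t) (velocity A a b \<gamma> t) (velocity A a b \<gamma> t) = e)"

end

theory Submission
  imports Defs
begin

text \<open>Write \<open>\<gamma>'\<close> for the velocity of \<open>\<gamma>\<close> and let \<open>W\<close> be the variation field of a variation of \<open>\<gamma>\<close> with
  fixed endpoints. As long as \<open>g(\<gamma>',\<gamma>') = 2c\<close>, differentiating the square root in
  \<open>F\<^sub>c = \<surd>g + \<omega>/\<surd>(2c)\<close> costs the constant factor \<open>1/(2\<surd>(2c))\<close>. The first variation of the length
  of \<open>F\<^sub>c\<close> is therefore \<open>1/\<surd>(2c)\<close> times that of the action of the quadratic Lagrangian
  \<open>g(v,v)/2 + \<omega>(v)\<close>. Integration by parts turns the latter, on an interval where everything is
  smooth, into the difference of the momenta \<open>g(\<gamma>',W) + \<omega>(W)\<close> at the two ends minus the integral of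
  the Euler-Lagrange form \<open>E(W)\<close> (lemma \<open>first_variation\<close>). By the formula for the Christoffel
  symbols and by \<open>\<Omega> = -d\<omega>\<close>, this form is \<open>E(w) = g(D\<gamma>'/dt - Y\<gamma>', w)\<close>
  (lemma \<open>euler_lagrange_geometric\<close>), so that it vanishes exactly along magnetic geodesics.

  If \<open>\<gamma>\<close> is a magnetic geodesic of energy \<open>c\<close>, the integrals of \<open>E\<close> vanish. The momentum does not
  depend on the chart and \<open>\<gamma>'\<close> is continuous, so the boundary terms of consecutive intervals cancel;
  those at the endpoints vanish because the endpoints are fixed.

  Conversely, let \<open>\<gamma>\<close> be a piecewise smooth pregeodesic of the given speed. Variations supported
  inside a smooth piece and inside a chart show that \<open>E = 0\<close> there
  (lemma \<open>pregeodesic_euler_lagrange\<close>). Given this, variations supported around one point \<open>t\<^sub>0\<close> show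
  that the momenta on the two sides agree. Their difference is
  \<open>g(\<gamma>'(t\<^sub>0-) - \<gamma>'(t\<^sub>0+), w)\<close>, hence there is no corner (lemma \<open>pregeodesic_no_corner\<close>). Finally,
  the equation \<open>E = 0\<close> determines the second derivative as a smooth function of position and velocity.
  A \<open>C\<^sup>1\<close> junction of two solutions is thus a \<open>C\<^sup>2\<close> solution, and then it is smooth
  (lemma \<open>glue_extremals\<close>); so \<open>\<gamma>\<close> is smooth and satisfies the equation everywhere.\<close>

section \<open>Calculus of smooth maps\<close>

lemma Ck_on_subset: "Ck_on k X f \<Longrightarrow> Y \<subseteq> X \<Longrightarrow> Ck_on k Y f"
  by (induction k arbitrary: f) (auto intro: continuous_on_subset)

lemma frechet_derivative_cong_open:
  assumes "open X" "x \<in> X" "\<And>y. y \<in> X \<Longrightarrow> f y = g y"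
  shows "frechet_derivative f (at x) = frechet_derivative g (at x)"
proof -
  have "\<And>D. (f has_derivative D) (at x) \<longleftrightarrow> (g has_derivative D) (at x)"
    using assms has_derivative_transform_within_open by metis
  then show ?thesis by (simp add: frechet_derivative_def)
qed

lemma Ck_on_cong:
  assumes "open X" "\<And>x. x \<in> X \<Longrightarrow> f x = g x"
  shows "Ck_on k X f \<longleftrightarrow> Ck_on k X g"
  using assms(2)
proof (induction k arbitrary: f g)
  case 0
  then show ?case by (simp cong: continuous_on_cong)
next
  case (Suc k)
  have d: "f differentiable (at x) \<longleftrightarrow> g differentiable (at x)" if "x \<in> X" for x
    unfolding differentiable_def using that Suc.prems assms(1) has_derivative_transform_within_open by metis
  have "Ck_on k X (\<lambda>x. frechet_derivative f (at x) v) \<longleftrightarrow> Ck_on k X (\<lambda>x. frechet_derivative g (at x) v)" for v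
    by (rule Suc.IH) (metis Suc.prems assms(1) frechet_derivative_cong_open)
  with d show ?case by auto
qed

lemma Ck_on_SucI:
  assumes "open X" "\<And>x. x \<in> X \<Longrightarrow> (f has_derivative D x) (at x)" "\<And>v. Ck_on k X (\<lambda>x. D x v)"
  shows "Ck_on (Suc k) X f"
proof -
  have "frechet_derivative f (at x) = D x" if "x \<in> X" for x
    using assms(2) that frechet_derivative_at by metis
  then have "Ck_on k X (\<lambda>x. frechet_derivative f (at x) v)" for v
    using Ck_on_cong[OF assms(1), of "\<lambda>x. frechet_derivative f (at x) v" "\<lambda>x. D x v"] assms(3) by auto
  then show ?thesis using assms(2) by (auto simp: differentiable_def)
qed

lemma Ck_on_SucE:
  assumes "Ck_on (Suc k) X f"
  shows "\<And>x. x \<in> X \<Longrightarrow> (f has_derivative frechet_derivative f (at x)) (at x)"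
    "\<And>v. Ck_on k X (\<lambda>x. frechet_derivative f (at x) v)"
  using assms by (auto simp: frechet_derivative_works)

lemma Ck_on_Suc_imp: "Ck_on (Suc k) X f \<Longrightarrow> Ck_on k X f"
proof (induction k arbitrary: f)
  case 0
  then show ?case
    by (auto intro!: continuous_at_imp_continuous_on differentiable_imp_continuous_within)
next
  case (Suc k)
  then show ?case by auto
qed

lemma Ck_on_const: "Ck_on k X (\<lambda>x. c)"
  by (induction k arbitrary: c) (auto)

lemma Ck_on_bounded_linear:
  assumes "open X" "bounded_linear L" "Ck_on k X f"
  shows "Ck_on k X (\<lambda>x. L (f x))"
  using assms(3)
proof (induction k arbitrary: f)
  case 0
  then show ?case using assms(2) by (simp add: bounded_linear.continuous_on)
next
  case (Suc k)
  show ?case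
    by (rule Ck_on_SucI[OF assms(1), where D = "\<lambda>x v. L (frechet_derivative f (at x) v)"])
      (auto intro!: bounded_linear.has_derivative[OF assms(2)] Ck_on_SucE[OF Suc.prems] Suc.IH)
qed

lemma Ck_on_add:
  assumes "open X" "Ck_on k X f" "Ck_on k X g"
  shows "Ck_on k X (\<lambda>x. f x + g x)"
  using assms(2,3)
proof (induction k arbitrary: f g)
  case 0
  then show ?case by (simp add: continuous_on_add)
next
  case (Suc k)
  show ?case
    by (rule Ck_on_SucI[OF assms(1), where D = "\<lambda>x v. frechet_derivative f (at x) v + frechet_derivative g (at x) v"])
      (auto intro!: derivative_intros Ck_on_SucE[OF Suc.prems(1)] Ck_on_SucE[OF Suc.prems(2)] Suc.IH)
qed

lemma Ck_on_bounded_bilinear: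
  assumes "open X" "bounded_bilinear P" "Ck_on k X f" "Ck_on k X g"
  shows "Ck_on k X (\<lambda>x. P (f x) (g x))"
  using assms(3,4)
proof (induction k arbitrary: f g)
  case 0
  then show ?case using bounded_bilinear.continuous_on[OF assms(2)] by simp
next
  case (Suc k)
  show ?case
    by (rule Ck_on_SucI[OF assms(1),
          where D = "\<lambda>x v. P (f x) (frechet_derivative g (at x) v) + P (frechet_derivative f (at x) v) (g x)"])
      (auto intro!: bounded_bilinear.FDERIV[OF assms(2)] Ck_on_add[OF assms(1)]
        Ck_on_SucE[OF Suc.prems(1)] Ck_on_SucE[OF Suc.prems(2)] Suc.IH
        Ck_on_Suc_imp[OF Suc.prems(1)] Ck_on_Suc_imp[OF Suc.prems(2)])
qed

lemma Ck_on_sum: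
  assumes "open X" "\<And>i. i \<in> I \<Longrightarrow> Ck_on k X (f i)"
  shows "Ck_on k X (\<lambda>x. \<Sum>i\<in>I. f i x)"
  using assms(2)
  by (induction I rule: infinite_finite_induct) (auto intro: Ck_on_const Ck_on_add[OF assms(1)])

lemma Ck_on_inverse:
  fixes f :: "'x::euclidean_space \<Rightarrow> real"
  assumes "open X" "Ck_on k X f" "\<And>x. x \<in> X \<Longrightarrow> f x \<noteq> 0"
  shows "Ck_on k X (\<lambda>x. inverse (f x))"
  using assms(2)
proof (induction k)
  case 0
  then show ?case using assms(3) by (auto intro: continuous_on_inverse)
next
  case (Suc k)
  have m: "Ck_on k X (\<lambda>x. u x * w x)" if "Ck_on k X u" "Ck_on k X w" for u w :: "'x \<Rightarrow> real"
    using Ck_on_bounded_bilinear[OF assms(1) bounded_bilinear_mult that] .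
  show ?case
  proof (rule Ck_on_SucI[OF assms(1)])
    show "((\<lambda>x. inverse (f x)) has_derivative
        (\<lambda>v. - (inverse (f x) * frechet_derivative f (at x) v * inverse (f x)))) (at x)" if "x \<in> X" for x
      using Deriv.has_derivative_inverse[OF assms(3)[OF that] Ck_on_SucE(1)[OF Suc.prems that]] .
    show "Ck_on k X (\<lambda>x. - (inverse (f x) * frechet_derivative f (at x) v * inverse (f x)))" for v
      by (intro Ck_on_bounded_linear[OF assms(1) bounded_linear_minus[OF bounded_linear_ident]]
          m Suc.IH Ck_on_SucE(2)[OF Suc.prems] Ck_on_Suc_imp[OF Suc.prems])
  qed
qed

text \<open>The derivatives in \<open>Ck_on\<close> are taken in constant directions, whereas the chain rule differentiates
  the outer map in the moving direction \<open>Df(x)v\<close>. Expanding that direction in the basis gives a sum of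
  products to which the induction hypothesis applies.\<close>

lemma Ck_on_compose:
  fixes f :: "'x::euclidean_space \<Rightarrow> 'y::euclidean_space" and h :: "'y \<Rightarrow> 'z::real_normed_vector"
  assumes "open X" "open Y" "Ck_on k Y h" "Ck_on k X f" "\<And>x. x \<in> X \<Longrightarrow> f x \<in> Y"
  shows "Ck_on k X (\<lambda>x. h (f x))"
  using assms(3,4)
proof (induction k arbitrary: h)
  case 0
  then show ?case using assms(5) by (auto intro: continuous_on_compose2)
next
  case (Suc k)
  let ?D = "\<lambda>x v. \<Sum>b\<in>Basis. (frechet_derivative f (at x) v \<bullet> b) *\<^sub>R frechet_derivative h (at (f x)) b"
  have "((\<lambda>x. h (f x)) has_derivative ?D x) (at x)" if "x \<in> X" for x
  proof -
    have h: "(h has_derivative frechet_derivative h (at (f x))) (at (f x))"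
      using Ck_on_SucE[OF Suc.prems(1)] assms(5) that by blast
    then interpret H: bounded_linear "frechet_derivative h (at (f x))"
      by (rule has_derivative_bounded_linear)
    have "frechet_derivative h (at (f x)) (\<Sum>b\<in>Basis. (u \<bullet> b) *\<^sub>R b) =
        (\<Sum>b\<in>Basis. (u \<bullet> b) *\<^sub>R frechet_derivative h (at (f x)) b)" for u
      unfolding H.sum H.scaleR ..
    then have *: "frechet_derivative h (at (f x)) u = (\<Sum>b\<in>Basis. (u \<bullet> b) *\<^sub>R frechet_derivative h (at (f x)) b)" for u
      unfolding euclidean_representation .
    show ?thesis
      by (rule has_derivative_eq_rhs[OF has_derivative_compose[OF Ck_on_SucE(1)[OF Suc.prems(2) that] h]])
        (rule ext, rule *)
  qed
  then show ?case
  proof (rule Ck_on_SucI[OF assms(1)])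
    fix v
    show "Ck_on k X (\<lambda>x. ?D x v)"
    proof (intro Ck_on_sum[OF assms(1)] Ck_on_bounded_bilinear[OF assms(1) bounded_bilinear_scaleR])
      fix b :: 'y
      show "Ck_on k X (\<lambda>x. frechet_derivative f (at x) v \<bullet> b)"
        by (rule Ck_on_bounded_linear[OF assms(1) bounded_linear_inner_left Ck_on_SucE(2)[OF Suc.prems(2)]])
      show "Ck_on k X (\<lambda>x. frechet_derivative h (at (f x)) b)"
        by (rule Suc.IH[OF Ck_on_SucE(2)[OF Suc.prems(1)] Ck_on_Suc_imp[OF Suc.prems(2)]])
    qed
  qed
qed

lemma smooth_on_open: "smooth_on X f \<Longrightarrow> open X"
  by (simp add: smooth_on_def)

lemma smooth_on_subset: "smooth_on X f \<Longrightarrow> open Y \<Longrightarrow> Y \<subseteq> X \<Longrightarrow> smooth_on Y f"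
  unfolding smooth_on_def using Ck_on_subset by blast

lemma smooth_on_cong: "smooth_on X f \<Longrightarrow> (\<And>x. x \<in> X \<Longrightarrow> f x = g x) \<Longrightarrow> smooth_on X g"
  unfolding smooth_on_def using Ck_on_cong by blast

lemma smooth_on_has_derivative:
  "smooth_on X f \<Longrightarrow> x \<in> X \<Longrightarrow> (f has_derivative frechet_derivative f (at x)) (at x)"
  unfolding smooth_on_def using Ck_on_SucE(1) by blast

lemma smooth_on_frechet: "smooth_on X f \<Longrightarrow> smooth_on X (\<lambda>x. frechet_derivative f (at x) v)"
  unfolding smooth_on_def using Ck_on_SucE(2) by blast

lemma smooth_on_continuous: "smooth_on X f \<Longrightarrow> continuous_on X f"
  unfolding smooth_on_def by (metis Ck_on.simps(1))

lemma smooth_on_const: "open X \<Longrightarrow> smooth_on X (\<lambda>x. c)"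
  by (simp add: smooth_on_def Ck_on_const)

lemma smooth_on_add: "smooth_on X f \<Longrightarrow> smooth_on X g \<Longrightarrow> smooth_on X (\<lambda>x. f x + g x)"
  by (simp add: smooth_on_def Ck_on_add)

lemma smooth_on_bounded_linear:
  "bounded_linear L \<Longrightarrow> smooth_on X f \<Longrightarrow> smooth_on X (\<lambda>x. L (f x))"
  by (simp add: smooth_on_def Ck_on_bounded_linear)

lemma smooth_on_scaleR:
  "smooth_on X f \<Longrightarrow> smooth_on X g \<Longrightarrow> smooth_on X (\<lambda>x. f x *\<^sub>R g x)"
  by (simp add: smooth_on_def Ck_on_bounded_bilinear[OF _ bounded_bilinear_scaleR])

lemma smooth_on_mult:
  fixes f :: "'x::euclidean_space \<Rightarrow> real"
  shows "smooth_on X f \<Longrightarrow> smooth_on X g \<Longrightarrow> smooth_on X (\<lambda>x. f x * g x)"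
  by (simp add: smooth_on_def Ck_on_bounded_bilinear[OF _ bounded_bilinear_mult])

lemma smooth_on_minus: "smooth_on X f \<Longrightarrow> smooth_on X (\<lambda>x. - f x)"
  by (rule smooth_on_bounded_linear[OF bounded_linear_minus[OF bounded_linear_ident]])

lemma smooth_on_diff: "smooth_on X f \<Longrightarrow> smooth_on X g \<Longrightarrow> smooth_on X (\<lambda>x. f x - g x)"
  using smooth_on_add[OF _ smooth_on_minus, of X f g] by simp

lemma smooth_on_sum:
  "open X \<Longrightarrow> (\<And>i. i \<in> I \<Longrightarrow> smooth_on X (f i)) \<Longrightarrow> smooth_on X (\<lambda>x. \<Sum>i\<in>I. f i x)"
  by (simp add: smooth_on_def Ck_on_sum)

lemma smooth_on_prod:
  fixes f :: "'i \<Rightarrow> 'x::euclidean_space \<Rightarrow> real"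
  assumes "open X" "\<And>i. i \<in> I \<Longrightarrow> smooth_on X (f i)"
  shows "smooth_on X (\<lambda>x. \<Prod>i\<in>I. f i x)"
  using assms(2)
  by (induction I rule: infinite_finite_induct)
    (auto intro: smooth_on_const[OF assms(1)] smooth_on_mult)

lemma smooth_on_divide:
  fixes f :: "'x::euclidean_space \<Rightarrow> real"
  assumes "smooth_on X f" "smooth_on X g" "\<And>x. x \<in> X \<Longrightarrow> g x \<noteq> 0"
  shows "smooth_on X (\<lambda>x. f x / g x)"
proof -
  have "smooth_on X (\<lambda>x. inverse (g x))"
    using assms by (simp add: smooth_on_def Ck_on_inverse)
  from smooth_on_mult[OF assms(1) this] show ?thesis by (simp add: divide_inverse)
qed

lemma smooth_on_compose:
  fixes f :: "'x::euclidean_space \<Rightarrow> 'y::euclidean_space"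
  shows "smooth_on Y h \<Longrightarrow> smooth_on X f \<Longrightarrow> (\<And>x. x \<in> X \<Longrightarrow> f x \<in> Y) \<Longrightarrow> smooth_on X (\<lambda>x. h (f x))"
  unfolding smooth_on_def by (intro conjI allI) (auto intro: Ck_on_compose[where Y = Y and h = h and f = f])

lemma smooth_on_ident: "open X \<Longrightarrow> smooth_on X (\<lambda>x. x)"
proof -
  have "Ck_on k X (\<lambda>x. x)" if "open X" for k and X :: "'a set"
    by (induction k) (auto intro!: Ck_on_SucI[OF that, where D = "\<lambda>x v. v"] simp: Ck_on_const simp del: Ck_on.simps(2))
  then show "open X \<Longrightarrow> smooth_on X (\<lambda>x. x)" by (simp add: smooth_on_def)
qed

lemma smooth_on_linear_map: "open X \<Longrightarrow> bounded_linear L \<Longrightarrow> smooth_on X (\<lambda>x. L x)"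
  by (rule smooth_on_bounded_linear[OF _ smooth_on_ident])

lemma Ck_on_Pair:
  assumes "open X" "Ck_on k X f" "Ck_on k X g"
  shows "Ck_on k X (\<lambda>x. (f x, g x))"
proof -
  have "bounded_linear (\<lambda>u. (u, 0))" "bounded_linear (\<lambda>u. (0, u))"
    by (auto intro: bounded_linear_Pair bounded_linear_zero bounded_linear_ident)
  from Ck_on_bounded_linear[OF assms(1) this(1) assms(2)] Ck_on_bounded_linear[OF assms(1) this(2) assms(3)]
  have "Ck_on k X (\<lambda>x. (f x, 0) + (0, g x))"
    by (rule Ck_on_add[OF assms(1)])
  then show ?thesis by simp
qed

lemma smooth_on_Pair: "smooth_on X f \<Longrightarrow> smooth_on X g \<Longrightarrow> smooth_on X (\<lambda>x. (f x, g x))"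
  by (simp add: smooth_on_def Ck_on_Pair)

lemma smooth_on_vec:
  fixes f :: "'x::euclidean_space \<Rightarrow> 'n::finite \<Rightarrow> real"
  assumes "open X" "\<And>i. smooth_on X (\<lambda>x. f x i)"
  shows "smooth_on X (\<lambda>x. \<chi> i. f x i)"
proof -
  have "smooth_on X (\<lambda>x. \<Sum>i\<in>UNIV. f x i *\<^sub>R axis i (1::real))"
    using assms by (intro smooth_on_sum smooth_on_scaleR smooth_on_const) auto
  moreover have "(\<Sum>i\<in>UNIV. f x i *\<^sub>R axis i (1::real)) = (\<chi> i. f x i)" for x
    by (simp add: vec_eq_iff axis_def if_distrib[of "\<lambda>u. _ * u"] sum.delta cong: if_cong)
  ultimately show ?thesis by simp
qed

lemma smooth_on_det:
  fixes M :: "'x::euclidean_space \<Rightarrow> real ^ 'n ^ 'n"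
  assumes "open X" "\<And>i j. smooth_on X (\<lambda>x. M x $ i $ j)"
  shows "smooth_on X (\<lambda>x. det (M x))"
  unfolding det_def using assms by (intro smooth_on_sum smooth_on_mult smooth_on_prod smooth_on_const) auto

lemma matrix_inv_inverse:
  fixes M :: "real ^ 'n ^ 'n"
  assumes "invertible M"
  shows "M ** matrix_inv M = mat 1" "matrix_inv M ** M = mat 1"
  using assms someI_ex[of "\<lambda>B. M ** B = mat 1 \<and> B ** M = mat 1"]
  unfolding invertible_def matrix_inv_def by auto

text \<open>By Cramer's rule the entries of the inverse are quotients of determinants, which are polynomials in
  the entries.\<close>

lemma smooth_on_matrix_inv:
  fixes M :: "'x::euclidean_space \<Rightarrow> real ^ 'n ^ 'n"
  assumes "open X" "\<And>i j. smooth_on X (\<lambda>x. M x $ i $ j)" "\<And>x. x \<in> X \<Longrightarrow> invertible (M x)"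
  shows "smooth_on X (\<lambda>x. matrix_inv (M x) $ k $ l)"
proof -
  let ?C = "\<lambda>x. det ((\<chi> i j. if j = k then axis l 1 $ i else M x $ i $ j) :: real^'n^'n)"
  have "smooth_on X (\<lambda>x. ?C x / det (M x))"
  proof (intro smooth_on_divide smooth_on_det assms)
    show "smooth_on X (\<lambda>x. (\<chi> i j. if j = k then axis l 1 $ i else M x $ i $ j) $ i $ j)" for i j
      using assms(1,2) by (cases "j = k") (simp_all add: smooth_on_const)
  qed (use assms(3) invertible_det_nz in auto)
  moreover have "?C x / det (M x) = matrix_inv (M x) $ k $ l" if "x \<in> X" for x
  proof -
    have inv: "M x ** matrix_inv (M x) = mat 1"
      using assms(3)[OF that] by (rule matrix_inv_inverse)
    have "M x *v (matrix_inv (M x) *v axis l 1) = axis l 1"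
      by (simp add: matrix_vector_mul_assoc inv)
    then have "matrix_inv (M x) *v axis l 1 = (\<chi> k. det (\<chi> i j. if j = k then axis l 1 $ i else M x $ i $ j) / det (M x))"
      using cramer[of "M x"] assms(3)[OF that] invertible_det_nz by blast
    then have "(matrix_inv (M x) *v axis l 1) $ k = ?C x / det (M x)" by simp
    then show ?thesis by (simp add: matrix_vector_mul_component matrix_vector_mult_basis column_def)
  qed
  ultimately show ?thesis by (rule smooth_on_cong)
qed

text \<open>Bootstrapping: if the solution \<open>y\<close> and its velocity \<open>v\<close> are \<open>C\<^sup>k\<close>, then so are the right-hand sides of
  \<open>y' = v\<close> and \<open>v' = \<Phi>(y, v)\<close>, whence \<open>y\<close> and \<open>v\<close> are \<open>C\<^sup>k\<^sup>+\<^sup>1\<close>.\<close>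

lemma smooth_on_second_order_ode:
  fixes y v :: "real \<Rightarrow> 'e::euclidean_space"
  assumes T: "open T" and Z: "smooth_on Z \<Phi>" and yZ: "\<And>t. t \<in> T \<Longrightarrow> (y t, v t) \<in> Z"
    and y: "\<And>t. t \<in> T \<Longrightarrow> (y has_vector_derivative v t) (at t)"
    and v: "\<And>t. t \<in> T \<Longrightarrow> (v has_vector_derivative \<Phi> (y t, v t)) (at t)"
  shows "smooth_on T y"
proof -
  have "Ck_on k T y \<and> Ck_on k T v" for k
  proof (induction k)
    case 0
    show ?case
      using y v by (auto intro!: continuous_at_imp_continuous_on has_vector_derivative_continuous)
  next
    case (Suc k)
    have "Ck_on k T (\<lambda>t. (y t, v t))"
      using Suc Ck_on_Pair[OF T] by blast
    then have "Ck_on k T (\<lambda>t. \<Phi> (y t, v t))"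
      using Ck_on_compose[OF T smooth_on_open[OF Z], of k \<Phi> "\<lambda>t. (y t, v t)"] Z yZ by (auto simp: smooth_on_def)
    then have \<Phi>': "Ck_on k T (\<lambda>t. h *\<^sub>R \<Phi> (y t, v t))" for h
      by (rule Ck_on_bounded_linear[OF T bounded_linear_scaleR_right])
    have v': "Ck_on k T (\<lambda>t. h *\<^sub>R v t)" for h
      by (rule Ck_on_bounded_linear[OF T bounded_linear_scaleR_right]) (use Suc in simp)
    have "Ck_on (Suc k) T v"
      by (rule Ck_on_SucI[OF T v[unfolded has_vector_derivative_def] \<Phi>'])
    moreover have "Ck_on (Suc k) T y"
      by (rule Ck_on_SucI[OF T y[unfolded has_vector_derivative_def] v'])
    ultimately show ?case by blast
  qed
  then show ?thesis using T by (simp add: smooth_on_def)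
qed


section \<open>Smooth maps of two real variables\<close>

lemma open_rectangle:
  fixes W :: "(real \<times> real) set"
  assumes "open W" "(s0, t0) \<in> W"
  obtains r where "r > 0" "{s0-r..s0+r} \<times> {t0-r..t0+r} \<subseteq> W"
proof -
  obtain e where e: "e > 0" "ball (s0, t0) e \<subseteq> W"
    using assms open_contains_ball by blast
  have "(s, t) \<in> W" if "s \<in> {s0-e/3..s0+e/3}" "t \<in> {t0-e/3..t0+e/3}" for s t
  proof -
    have "dist (s0, t0) (s, t) \<le> \<bar>s0 - s\<bar> + \<bar>t0 - t\<bar>"
      unfolding dist_Pair_Pair dist_real_def by (metis power2_abs sqrt_sum_squares_le_sum_abs abs_abs)
    also have "\<dots> < e" using that e(1) by auto
    finally show ?thesis using e(2) by auto
  qed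
  then have "{s0-e/3..s0+e/3} \<times> {t0-e/3..t0+e/3} \<subseteq> W" by fast
  then show ?thesis using that[of "e/3"] e(1) by simp
qed

definition partial_s :: "(real \<times> real \<Rightarrow> 'e::real_normed_vector) \<Rightarrow> real \<times> real \<Rightarrow> 'e" where
  "partial_s x z = frechet_derivative x (at z) (1, 0)"

definition partial_t :: "(real \<times> real \<Rightarrow> 'e::real_normed_vector) \<Rightarrow> real \<times> real \<Rightarrow> 'e" where
  "partial_t x z = frechet_derivative x (at z) (0, 1)"

lemma smooth_on_partial_s: "smooth_on W x \<Longrightarrow> smooth_on W (partial_s x)"
  unfolding partial_s_def by (rule smooth_on_frechet)

lemma smooth_on_partial_t: "smooth_on W x \<Longrightarrow> smooth_on W (partial_t x)"
  unfolding partial_t_def by (rule smooth_on_frechet)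

lemma has_partial_s:
  assumes "smooth_on W x" "(s, t) \<in> W"
  shows "((\<lambda>s. x (s, t)) has_vector_derivative partial_s x (s, t)) (at s)"
proof -
  have "((\<lambda>s. (s, t)) has_derivative (\<lambda>h. (h, 0))) (at s)"
    by (auto intro!: derivative_eq_intros)
  from has_derivative_compose[OF this smooth_on_has_derivative[OF assms]]
  have 1: "((\<lambda>s. x (s, t)) has_derivative (\<lambda>h. frechet_derivative x (at (s, t)) (h, 0))) (at s)" .
  interpret L: bounded_linear "frechet_derivative x (at (s, t))"
    by (rule has_derivative_bounded_linear[OF smooth_on_has_derivative[OF assms]])
  have "frechet_derivative x (at (s, t)) (h, 0) = h *\<^sub>R partial_s x (s, t)" for h
    using L.scaleR[of h "(1, 0)"] by (simp add: partial_s_def)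
  with 1 show ?thesis by (simp add: has_vector_derivative_def)
qed

lemma has_partial_t:
  assumes "smooth_on W x" "(s, t) \<in> W"
  shows "((\<lambda>t. x (s, t)) has_vector_derivative partial_t x (s, t)) (at t)"
proof -
  have "((\<lambda>t. (s, t)) has_derivative (\<lambda>h. (0, h))) (at t)"
    by (auto intro!: derivative_eq_intros)
  from has_derivative_compose[OF this smooth_on_has_derivative[OF assms]]
  have 1: "((\<lambda>t. x (s, t)) has_derivative (\<lambda>h. frechet_derivative x (at (s, t)) (0, h))) (at t)" .
  interpret L: bounded_linear "frechet_derivative x (at (s, t))"
    by (rule has_derivative_bounded_linear[OF smooth_on_has_derivative[OF assms]])
  have "frechet_derivative x (at (s, t)) (0, h) = h *\<^sub>R partial_t x (s, t)" for h
    using L.scaleR[of h "(0, 1)"] by (simp add: partial_t_def)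
  with 1 show ?thesis by (simp add: has_vector_derivative_def)
qed

lemma continuous_on_section:
  fixes f :: "real \<times> real \<Rightarrow> 'e::real_normed_vector"
  assumes "continuous_on W f" "\<And>t. t \<in> T \<Longrightarrow> (s, t) \<in> W"
  shows "continuous_on T (\<lambda>t. f (s, t))"
  by (rule continuous_on_compose2[OF assms(1)]) (use assms(2) in \<open>auto intro!: continuous_intros\<close>)

text \<open>Differentiating \<open>x(s,t) = x(s,c) + \<integral>\<^sub>c\<^sup>t \<partial>\<^sub>tx(s,\<tau>) d\<tau>\<close> in \<open>s\<close> under the integral sign and then in \<open>t\<close>
  by the fundamental theorem exchanges the order of the two derivatives.\<close>

lemma mixed_partials:
  fixes x :: "real \<times> real \<Rightarrow> 'e::euclidean_space"
  assumes x: "smooth_on W x" and z: "(s0, t0) \<in> W"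
  shows "partial_s (partial_t x) (s0, t0) = partial_t (partial_s x) (s0, t0)"
proof -
  obtain r where r: "r > 0" "{s0-r..s0+r} \<times> {t0-r..t0+r} \<subseteq> W"
    using open_rectangle[OF smooth_on_open[OF x] z] .
  define c where "c = t0 - r"
  have inW: "(s, t) \<in> W" if "s \<in> {s0-r..s0+r}" "t \<in> {c..t0+r}" for s t
    using r that by (auto simp: c_def)
  note xt = smooth_on_partial_t[OF x] and xs = smooth_on_partial_s[OF x]
  note xst = smooth_on_partial_s[OF xt]
  have cont: "continuous_on {c..t0+r} (\<lambda>t. partial_t x (s, t))" if "s \<in> {s0-r..s0+r}" for s
    using smooth_on_continuous[OF xt] by (rule continuous_on_section) (use inW that in auto)
  have eq: "partial_s x (s0, t) = partial_s x (s0, c) + integral {c..t} (\<lambda>\<tau>. partial_s (partial_t x) (s0, \<tau>))"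
    if t: "t \<in> {c..t0+r}" for t
  proof -
    let ?S = "{s0-r..s0+r}"
    have ftc: "x (s, t) = x (s, c) + integral {c..t} (\<lambda>\<tau>. partial_t x (s, \<tau>))" if "s \<in> ?S" for s
    proof -
      have "((\<lambda>\<tau>. partial_t x (s, \<tau>)) has_integral x (s, t) - x (s, c)) {c..t}"
        using t that inW by (intro fundamental_theorem_of_calculus)
          (auto intro!: has_vector_derivative_at_within has_partial_t[OF x])
      then show ?thesis by (simp add: integral_unique)
    qed
    have "((\<lambda>s. integral (cbox c t) (\<lambda>\<tau>. partial_t x (s, \<tau>))) has_vector_derivative
        integral (cbox c t) (\<lambda>\<tau>. partial_s (partial_t x) (s0, \<tau>))) (at s0 within ?S)"
    proof (rule leibniz_rule_vector_derivative)
      show "((\<lambda>s. partial_t x (s, \<tau>)) has_vector_derivative partial_s (partial_t x) (s, \<tau>)) (at s within ?S)"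
        if "s \<in> ?S" "\<tau> \<in> cbox c t" for s \<tau>
        using that t inW by (auto intro!: has_vector_derivative_at_within has_partial_s[OF xt])
      show "(\<lambda>\<tau>. partial_t x (s, \<tau>)) integrable_on cbox c t" if "s \<in> ?S" for s
        using t by (auto intro!: integrable_continuous_real continuous_on_subset[OF cont[OF that]])
      show "continuous_on (?S \<times> cbox c t) (\<lambda>(s, \<tau>). partial_s (partial_t x) (s, \<tau>))"
        using t inW by (auto intro!: continuous_on_subset[OF smooth_on_continuous[OF xst]] simp: case_prod_beta)
    qed (use r(1) in auto)
    then have "((\<lambda>s. x (s, c) + integral {c..t} (\<lambda>\<tau>. partial_t x (s, \<tau>))) has_vector_derivative
        partial_s x (s0, c) + integral {c..t} (\<lambda>\<tau>. partial_s (partial_t x) (s0, \<tau>))) (at s0 within ?S)"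
      using inW[of s0 c] r(1) by (intro has_vector_derivative_add has_vector_derivative_at_within[OF has_partial_s[OF x]])
        (auto simp: c_def)
    then have D: "((\<lambda>s. x (s, t)) has_vector_derivative
        partial_s x (s0, c) + integral {c..t} (\<lambda>\<tau>. partial_s (partial_t x) (s0, \<tau>))) (at s0 within ?S)"
    proof (rule has_vector_derivative_transform[rotated 2])
      show "s0 \<in> ?S" using r(1) by simp
    qed (rule ftc)
    have "((\<lambda>s. x (s, t)) has_vector_derivative partial_s x (s0, t)) (at s0 within ?S)"
      by (rule has_vector_derivative_at_within[OF has_partial_s[OF x inW]]) (use r(1) t in auto)
    from this D show ?thesis
      by (rule vector_derivative_unique_within_closed_interval[where a = "s0 - r" and b = "s0 + r", rotated 2, unfolded cbox_interval])
        (use r in auto)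
  qed
  have "continuous_on {c..t0+r} (\<lambda>t. partial_s (partial_t x) (s0, t))"
    using smooth_on_continuous[OF xst] by (rule continuous_on_section) (use inW r(1) in auto)
  then have "((\<lambda>t. integral {c..t} (\<lambda>\<tau>. partial_s (partial_t x) (s0, \<tau>))) has_vector_derivative
      partial_s (partial_t x) (s0, t0)) (at t0 within {c..t0+r})"
    by (rule integral_has_vector_derivative) (use r(1) in \<open>auto simp: c_def\<close>)
  then have "((\<lambda>t. partial_s x (s0, c) + integral {c..t} (\<lambda>\<tau>. partial_s (partial_t x) (s0, \<tau>))) has_vector_derivative
      0 + partial_s (partial_t x) (s0, t0)) (at t0 within {c..t0+r})"
    by (intro has_vector_derivative_add has_vector_derivative_const)
  then have D: "((\<lambda>t. partial_s x (s0, t)) has_vector_derivative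
      partial_s (partial_t x) (s0, t0)) (at t0 within {c..t0+r})"
    unfolding add_0_left
  proof (rule has_vector_derivative_transform[rotated 2])
    show "t0 \<in> {c..t0+r}" using r(1) by (simp add: c_def)
  qed (rule eq)
  have "((\<lambda>t. partial_s x (s0, t)) has_vector_derivative
      partial_t (partial_s x) (s0, t0)) (at t0 within {c..t0+r})"
    by (rule has_vector_derivative_at_within[OF has_partial_t[OF xs z]])
  from D this show ?thesis
    by (rule vector_derivative_unique_within_closed_interval[where a = c and b = "t0 + r", rotated 2, unfolded cbox_interval])
      (use r(1) in \<open>auto simp: c_def\<close>)
qed

section \<open>Piecewise properties of intervals\<close>

text \<open>Partitions of \<open>[a,b]\<close> into intervals with the property \<open>Q\<close>, built up by appending intervals on the
  right. Joining and restricting partitions becomes an induction without index arithmetic; the link to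
  \<open>partition_of\<close> is \<open>piecewise_iff_partition\<close>.\<close>

inductive piecewise :: "(real \<Rightarrow> real \<Rightarrow> bool) \<Rightarrow> real \<Rightarrow> real \<Rightarrow> bool" for Q where
  empty: "piecewise Q a a"
| snoc: "piecewise Q a b \<Longrightarrow> b < c \<Longrightarrow> Q b c \<Longrightarrow> piecewise Q a c"

lemma piecewise_le: "piecewise Q a b \<Longrightarrow> a \<le> b"
  by (induction rule: piecewise.induct) auto

lemma piecewise_single: "a \<le> b \<Longrightarrow> (a < b \<Longrightarrow> Q a b) \<Longrightarrow> piecewise Q a b"
  by (metis piecewise.empty piecewise.snoc less_eq_real_def)

lemma piecewise_append: "piecewise Q b c \<Longrightarrow> piecewise Q a b \<Longrightarrow> piecewise Q a c"
  by (induction rule: piecewise.induct) (auto intro: piecewise.snoc)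

lemma piecewise_mono: "piecewise Q a b \<Longrightarrow> (\<And>c d. a \<le> c \<Longrightarrow> d \<le> b \<Longrightarrow> c < d \<Longrightarrow> Q c d \<Longrightarrow> R c d) \<Longrightarrow> piecewise R a b"
proof (induction rule: piecewise.induct)
  case (snoc a b c)
  show ?case
  proof (rule piecewise.snoc)
    show "piecewise R a b" using snoc by (intro snoc.IH) auto
    show "R b c" using snoc piecewise_le by auto
  qed (use snoc in auto)
qed (rule piecewise.empty)

lemma piecewise_iff_partition:
  "piecewise Q a b \<longleftrightarrow> (\<exists>k \<tau>. partition_of a b k \<tau> \<and> (\<forall>i<k. Q (\<tau> i) (\<tau> (Suc i))))"
proof
  assume "piecewise Q a b"
  then show "\<exists>k \<tau>. partition_of a b k \<tau> \<and> (\<forall>i<k. Q (\<tau> i) (\<tau> (Suc i)))"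
  proof (induction rule: piecewise.induct)
    case (empty a)
    show ?case by (rule exI[of _ 0], rule exI[of _ "\<lambda>i. a"]) (simp add: partition_of_def)
  next
    case (snoc a b c)
    then obtain k \<tau> where *: "partition_of a b k \<tau>" "\<forall>i<k. Q (\<tau> i) (\<tau> (Suc i))" by blast
    show ?case
      by (rule exI[of _ "Suc k"], rule exI[of _ "\<tau>(Suc k := c)"])
        (use * snoc in \<open>auto simp: partition_of_def less_Suc_eq\<close>)
  qed
next
  assume "\<exists>k \<tau>. partition_of a b k \<tau> \<and> (\<forall>i<k. Q (\<tau> i) (\<tau> (Suc i)))"
  then obtain k \<tau> where *: "partition_of a b k \<tau>" "\<forall>i<k. Q (\<tau> i) (\<tau> (Suc i))" by blast
  have "j \<le> k \<Longrightarrow> piecewise Q (\<tau> 0) (\<tau> j)" for j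
    by (induction j) (use * in \<open>auto intro: piecewise.empty piecewise.snoc simp: partition_of_def\<close>)
  from this[of k] * show "piecewise Q a b" by (simp add: partition_of_def)
qed

lemma piecewise_upto:
  assumes "piecewise Q a b" "\<And>c d c' d'. Q c d \<Longrightarrow> c \<le> c' \<Longrightarrow> c' < d' \<Longrightarrow> d' \<le> d \<Longrightarrow> Q c' d'"
    and "a \<le> d" "d \<le> b"
  shows "piecewise Q a d"
  using assms(1,3,4)
proof (induction arbitrary: d rule: piecewise.induct)
  case (empty a)
  then show ?case by (metis piecewise.empty order_antisym)
next
  case (snoc a b c)
  show ?case
  proof (cases "d \<le> b")
    case True
    then show ?thesis using snoc by blast
  next
    case False
    then show ?thesis using snoc assms(2)[of b c b d] by (auto intro: piecewise.snoc[of Q a b])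
  qed
qed

lemma piecewise_from:
  assumes "piecewise Q a b" "\<And>c d c' d'. Q c d \<Longrightarrow> c \<le> c' \<Longrightarrow> c' < d' \<Longrightarrow> d' \<le> d \<Longrightarrow> Q c' d'"
    and "a \<le> e" "e \<le> b"
  shows "piecewise Q e b"
  using assms(1,3,4)
proof (induction rule: piecewise.induct)
  case (empty a)
  then show ?case by (metis piecewise.empty order_antisym)
next
  case (snoc a b c)
  show ?case
  proof (cases "e \<le> b")
    case True
    then show ?thesis using snoc by (auto intro: piecewise.snoc[of Q e b])
  next
    case False
    then show ?thesis using snoc assms(2)[of b c e c] by (auto intro: piecewise_single)
  qed
qed

text \<open>Every point has an interval with the property on each side of it, whether or not it is a point of the
  partition. This makes it unnecessary to distinguish corners from interior points of the pieces.\<close>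

lemma piecewise_left_piece:
  assumes "piecewise Q a b" "\<And>c d c' d'. Q c d \<Longrightarrow> c \<le> c' \<Longrightarrow> c' < d' \<Longrightarrow> d' \<le> d \<Longrightarrow> Q c' d'"
    and "a < t" "t \<le> b"
  obtains l where "a \<le> l" "l < t" "Q l t"
proof -
  have "piecewise Q a t" using piecewise_upto[OF assms(1,2)] assms(3,4) by auto
  then show ?thesis using assms(3) that by cases (auto dest: piecewise_le)
qed

lemma piecewise_right_piece:
  assumes "piecewise Q a b" "\<And>c d c' d'. Q c d \<Longrightarrow> c \<le> c' \<Longrightarrow> c' < d' \<Longrightarrow> d' \<le> d \<Longrightarrow> Q c' d'"
    and "a \<le> t" "t < b"
  obtains r where "t < r" "r \<le> b" "Q t r"
proof -
  have "piecewise Q t b" using piecewise_from[OF assms(1,2)] assms(3,4) by auto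
  moreover have "piecewise Q u b \<Longrightarrow> u < b \<Longrightarrow> \<exists>r. u < r \<and> r \<le> b \<and> Q u r" for u
  proof (induction rule: piecewise.induct)
    case (snoc a b c)
    then show ?case by (cases "a < b") (use piecewise_le in force)+
  qed simp
  ultimately show ?thesis using assms(4) that by blast
qed

section \<open>The Lagrangian in a coordinate domain\<close>

definition dot :: "(real \<Rightarrow> 'e::real_normed_vector) \<Rightarrow> real \<Rightarrow> 'e" where
  "dot y t = frechet_derivative y (at t) 1"

lemma smooth_on_dot: "smooth_on T y \<Longrightarrow> smooth_on T (dot y)"
  unfolding dot_def by (rule smooth_on_frechet)

lemma has_dot:
  assumes "smooth_on T y" "t \<in> T"
  shows "(y has_vector_derivative dot y t) (at t)"
proof -
  interpret L: bounded_linear "frechet_derivative y (at t)"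
    by (rule has_derivative_bounded_linear[OF smooth_on_has_derivative[OF assms]])
  have "frechet_derivative y (at t) h = h *\<^sub>R dot y t" for h
    using L.scaleR[of h 1] by (simp add: dot_def)
  then have "frechet_derivative y (at t) = (\<lambda>h. h *\<^sub>R dot y t)" ..
  with smooth_on_has_derivative[OF assms] show ?thesis by (simp add: has_vector_derivative_def)
qed

lemma dot_eqI: "smooth_on T y \<Longrightarrow> t \<in> T \<Longrightarrow> (y has_vector_derivative v) (at t) \<Longrightarrow> dot y t = v"
  using has_dot vector_derivative_unique_at by blast

lemma linear_euclidean_expand:
  fixes L :: "'e::euclidean_space \<Rightarrow> real"
  assumes "linear L"
  shows "L u = (\<Sum>b\<in>Basis. (u \<bullet> b) * L b)"
proof -
  have "L (\<Sum>b\<in>Basis. (u \<bullet> b) *\<^sub>R b) = (\<Sum>b\<in>Basis. (u \<bullet> b) * L b)"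
    by (simp only: linear_sum[OF assms] linear_cmul[OF assms] real_scaleR_def)
  then show ?thesis unfolding euclidean_representation .
qed

lemma bilinear_euclidean_expand:
  fixes B :: "'e::euclidean_space \<Rightarrow> 'e \<Rightarrow> real"
  assumes "bilinear B"
  shows "B u v = (\<Sum>i\<in>Basis. \<Sum>j\<in>Basis. (u \<bullet> i) * (v \<bullet> j) * B i j)"
proof -
  have "linear (\<lambda>u. B u v)" "\<And>i. linear (B i)" using assms by (auto simp: bilinear_def)
  then have "B u v = (\<Sum>i\<in>Basis. (u \<bullet> i) * (\<Sum>j\<in>Basis. (v \<bullet> j) * B i j))"
    using linear_euclidean_expand[of "\<lambda>u. B u v" u] linear_euclidean_expand[of "B _" v] by simp
  then show ?thesis by (simp add: sum_distrib_left mult.assoc)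
qed

text \<open>The Lagrangian \<open>G\<^sub>x(v,v)/2 + \<theta>\<^sub>x(v)\<close> on an open subset of a Euclidean space: what a metric and a
  one-form look like in a chart.\<close>

locale coordinate_lagrangian =
  fixes U :: "'e::euclidean_space set"
    and G :: "'e \<Rightarrow> 'e \<Rightarrow> 'e \<Rightarrow> real"
    and \<theta> :: "'e \<Rightarrow> 'e \<Rightarrow> real"
  assumes open_U: "open U"
    and bilinear_G: "x \<in> U \<Longrightarrow> bilinear (G x)"
    and sym_G: "x \<in> U \<Longrightarrow> G x u v = G x v u"
    and pos_G: "x \<in> U \<Longrightarrow> u \<noteq> 0 \<Longrightarrow> G x u u > 0"
    and linear_\<theta>: "x \<in> U \<Longrightarrow> linear (\<theta> x)"
    and smooth_G: "smooth_on U (\<lambda>x. G x u v)"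
    and smooth_\<theta>: "smooth_on U (\<lambda>x. \<theta> x u)"
begin

definition DG :: "'e \<Rightarrow> 'e \<Rightarrow> 'e \<Rightarrow> 'e \<Rightarrow> real" where
  "DG x h u v = frechet_derivative (\<lambda>x. G x u v) (at x) h"

definition D\<theta> :: "'e \<Rightarrow> 'e \<Rightarrow> 'e \<Rightarrow> real" where
  "D\<theta> x h u = frechet_derivative (\<lambda>x. \<theta> x u) (at x) h"

text \<open>The form \<open>d/dt \<partial>L/\<partial>v - \<partial>L/\<partial>x\<close> of the Lagrangian \<open>L = G(v,v)/2 + \<theta>(v)\<close> at a curve with position
  \<open>x\<close>, velocity \<open>v\<close> and second derivative \<open>a\<close>, applied to the vector \<open>w\<close>.\<close>

definition euler_lagrange :: "'e \<Rightarrow> 'e \<Rightarrow> 'e \<Rightarrow> 'e \<Rightarrow> real" where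
  "euler_lagrange x v a w = DG x v v w + G x a w - DG x w v v / 2 + D\<theta> x v w - D\<theta> x w v"

lemma G_expand: "x \<in> U \<Longrightarrow> G x u v = (\<Sum>i\<in>Basis. \<Sum>j\<in>Basis. (u \<bullet> i) * (v \<bullet> j) * G x i j)"
  by (rule bilinear_euclidean_expand[OF bilinear_G])

lemma \<theta>_expand: "x \<in> U \<Longrightarrow> \<theta> x u = (\<Sum>b\<in>Basis. (u \<bullet> b) * \<theta> x b)"
  by (rule linear_euclidean_expand[OF linear_\<theta>])

lemma G_has_derivative: "x \<in> U \<Longrightarrow> ((\<lambda>x. G x u v) has_derivative (\<lambda>h. DG x h u v)) (at x)"
  unfolding DG_def by (rule smooth_on_has_derivative[OF smooth_G])

lemma \<theta>_has_derivative: "x \<in> U \<Longrightarrow> ((\<lambda>x. \<theta> x u) has_derivative (\<lambda>h. D\<theta> x h u)) (at x)"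
  unfolding D\<theta>_def by (rule smooth_on_has_derivative[OF smooth_\<theta>])

lemma DG_expand:
  assumes "x \<in> U"
  shows "DG x h u v = (\<Sum>i\<in>Basis. \<Sum>j\<in>Basis. (u \<bullet> i) * (v \<bullet> j) * DG x h i j)"
proof -
  have "((\<lambda>x. \<Sum>i\<in>Basis. \<Sum>j\<in>Basis. (u \<bullet> i) * (v \<bullet> j) * G x i j) has_derivative
      (\<lambda>h. \<Sum>i\<in>Basis. \<Sum>j\<in>Basis. (u \<bullet> i) * (v \<bullet> j) * DG x h i j)) (at x)"
    by (intro has_derivative_sum has_derivative_mult_right G_has_derivative assms)
  then have "((\<lambda>x. G x u v) has_derivative (\<lambda>h. \<Sum>i\<in>Basis. \<Sum>j\<in>Basis. (u \<bullet> i) * (v \<bullet> j) * DG x h i j)) (at x)"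
    by (rule has_derivative_transform_within_open[OF _ open_U assms]) (rule G_expand[symmetric])
  from has_derivative_unique[OF G_has_derivative[OF assms] this] show ?thesis by metis
qed

lemma D\<theta>_expand:
  assumes "x \<in> U"
  shows "D\<theta> x h u = (\<Sum>b\<in>Basis. (u \<bullet> b) * D\<theta> x h b)"
proof -
  have "((\<lambda>x. \<Sum>b\<in>Basis. (u \<bullet> b) * \<theta> x b) has_derivative (\<lambda>h. \<Sum>b\<in>Basis. (u \<bullet> b) * D\<theta> x h b)) (at x)"
    by (intro has_derivative_sum has_derivative_mult_right \<theta>_has_derivative assms)
  then have "((\<lambda>x. \<theta> x u) has_derivative (\<lambda>h. \<Sum>b\<in>Basis. (u \<bullet> b) * D\<theta> x h b)) (at x)"
    by (rule has_derivative_transform_within_open[OF _ open_U assms]) (rule \<theta>_expand[symmetric])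
  from has_derivative_unique[OF \<theta>_has_derivative[OF assms] this] show ?thesis by metis
qed

lemma G_along_has_derivative:
  fixes X V Y :: "real \<Rightarrow> 'e"
  assumes T: "open T" "t \<in> T" "\<And>t. t \<in> T \<Longrightarrow> X t \<in> U"
    and X: "(X has_vector_derivative X') (at t)" and V: "(V has_vector_derivative V') (at t)"
    and Y: "(Y has_vector_derivative Y') (at t)"
  shows "((\<lambda>t. G (X t) (V t) (Y t)) has_vector_derivative
    DG (X t) X' (V t) (Y t) + G (X t) V' (Y t) + G (X t) (V t) Y') (at t)"
proof -
  have x: "X t \<in> U" using T by blast
  interpret L: bounded_linear "\<lambda>h. DG (X t) h i j" for i j
    by (rule has_derivative_bounded_linear[OF G_has_derivative[OF x]])
  have g: "((\<lambda>t. G (X t) i j) has_vector_derivative DG (X t) X' i j) (at t)" for i j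
    using has_derivative_compose[OF X[unfolded has_vector_derivative_def] G_has_derivative[OF x]]
    by (simp add: has_vector_derivative_def L.scaleR)
  have b: "((\<lambda>t. Z t \<bullet> i) has_vector_derivative Z' \<bullet> i) (at t)" if "(Z has_vector_derivative Z') (at t)" for Z Z' i
    using bounded_linear.has_vector_derivative[OF bounded_linear_inner_left that] .
  have "((\<lambda>t. \<Sum>i\<in>Basis. \<Sum>j\<in>Basis. ((V t \<bullet> i) * (Y t \<bullet> j)) * G (X t) i j) has_vector_derivative
     (\<Sum>i\<in>Basis. \<Sum>j\<in>Basis. (V t \<bullet> i) * (Y t \<bullet> j) * DG (X t) X' i j
        + ((V t \<bullet> i) * (Y' \<bullet> j) + (V' \<bullet> i) * (Y t \<bullet> j)) * G (X t) i j)) (at t)"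
    by (intro has_vector_derivative_sum has_vector_derivative_mult b[OF V] b[OF Y] g)
  moreover have "(\<Sum>i\<in>Basis. \<Sum>j\<in>Basis. (V t \<bullet> i) * (Y t \<bullet> j) * DG (X t) X' i j
        + ((V t \<bullet> i) * (Y' \<bullet> j) + (V' \<bullet> i) * (Y t \<bullet> j)) * G (X t) i j)
      = DG (X t) X' (V t) (Y t) + G (X t) V' (Y t) + G (X t) (V t) Y'"
    unfolding DG_expand[OF x, of X' "V t"] G_expand[OF x, of V'] G_expand[OF x, of "V t"]
    by (simp add: sum.distrib algebra_simps)
  ultimately show ?thesis
    using has_vector_derivative_transform_within_open[OF _ T(1,2), where g = "\<lambda>t. G (X t) (V t) (Y t)", OF _ G_expand[symmetric, OF T(3)]]
    by simp
qed

lemma \<theta>_along_has_derivative: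
  fixes X V :: "real \<Rightarrow> 'e"
  assumes T: "open T" "t \<in> T" "\<And>t. t \<in> T \<Longrightarrow> X t \<in> U"
    and X: "(X has_vector_derivative X') (at t)" and V: "(V has_vector_derivative V') (at t)"
  shows "((\<lambda>t. \<theta> (X t) (V t)) has_vector_derivative D\<theta> (X t) X' (V t) + \<theta> (X t) V') (at t)"
proof -
  have x: "X t \<in> U" using T by blast
  interpret L: bounded_linear "\<lambda>h. D\<theta> (X t) h i" for i
    by (rule has_derivative_bounded_linear[OF \<theta>_has_derivative[OF x]])
  have g: "((\<lambda>t. \<theta> (X t) i) has_vector_derivative D\<theta> (X t) X' i) (at t)" for i
    using has_derivative_compose[OF X[unfolded has_vector_derivative_def] \<theta>_has_derivative[OF x]]
    by (simp add: has_vector_derivative_def L.scaleR)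
  have b: "((\<lambda>t. V t \<bullet> i) has_vector_derivative V' \<bullet> i) (at t)" for i
    using bounded_linear.has_vector_derivative[OF bounded_linear_inner_left V] .
  have "((\<lambda>t. \<Sum>i\<in>Basis. (V t \<bullet> i) * \<theta> (X t) i) has_vector_derivative
     (\<Sum>i\<in>Basis. (V t \<bullet> i) * D\<theta> (X t) X' i + (V' \<bullet> i) * \<theta> (X t) i)) (at t)"
    by (intro has_vector_derivative_sum has_vector_derivative_mult b g)
  moreover have "(\<Sum>i\<in>Basis. (V t \<bullet> i) * D\<theta> (X t) X' i + (V' \<bullet> i) * \<theta> (X t) i)
      = D\<theta> (X t) X' (V t) + \<theta> (X t) V'"
    unfolding D\<theta>_expand[OF x, of X' "V t"] \<theta>_expand[OF x, of V'] by (simp add: sum.distrib)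
  ultimately show ?thesis
    using has_vector_derivative_transform_within_open[OF _ T(1,2), where g = "\<lambda>t. \<theta> (X t) (V t)", OF _ \<theta>_expand[symmetric, OF T(3)]]
    by simp
qed

lemma smooth_on_G_along:
  assumes "smooth_on T X" "smooth_on T V" "smooth_on T Y" "\<And>z. z \<in> T \<Longrightarrow> X z \<in> U"
  shows "smooth_on T (\<lambda>z. G (X z) (V z) (Y z))"
proof -
  have "smooth_on T (\<lambda>z. \<Sum>i\<in>Basis. \<Sum>j\<in>Basis. (V z \<bullet> i) * (Y z \<bullet> j) * G (X z) i j)"
    by (intro smooth_on_sum smooth_on_open[OF assms(1)] smooth_on_mult smooth_on_compose[OF smooth_G assms(1,4)]
       smooth_on_bounded_linear[OF bounded_linear_inner_left] assms)
  then show ?thesis by (rule smooth_on_cong) (rule G_expand[symmetric], rule assms)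
qed

lemma smooth_on_\<theta>_along:
  assumes "smooth_on T X" "smooth_on T V" "\<And>z. z \<in> T \<Longrightarrow> X z \<in> U"
  shows "smooth_on T (\<lambda>z. \<theta> (X z) (V z))"
proof -
  have "smooth_on T (\<lambda>z. \<Sum>i\<in>Basis. (V z \<bullet> i) * \<theta> (X z) i)"
    by (intro smooth_on_sum smooth_on_open[OF assms(1)] smooth_on_mult smooth_on_compose[OF smooth_\<theta> assms(1,3)]
       smooth_on_bounded_linear[OF bounded_linear_inner_left] assms)
  then show ?thesis by (rule smooth_on_cong) (rule \<theta>_expand[symmetric], rule assms)
qed

lemma smooth_on_DG_along:
  assumes "smooth_on T X" "smooth_on T V" "smooth_on T Y" "\<And>z. z \<in> T \<Longrightarrow> X z \<in> U"
  shows "smooth_on T (\<lambda>z. DG (X z) w (V z) (Y z))"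
proof -
  have D: "smooth_on U (\<lambda>x. DG x w u v)" for u v
    unfolding DG_def by (rule smooth_on_frechet[OF smooth_G])
  have "smooth_on T (\<lambda>z. \<Sum>i\<in>Basis. \<Sum>j\<in>Basis. (V z \<bullet> i) * (Y z \<bullet> j) * DG (X z) w i j)"
    by (intro smooth_on_sum smooth_on_open[OF assms(1)] smooth_on_mult smooth_on_compose[OF D assms(1,4)]
       smooth_on_bounded_linear[OF bounded_linear_inner_left] assms)
  then show ?thesis by (rule smooth_on_cong) (rule DG_expand[symmetric], rule assms)
qed

lemma smooth_on_D\<theta>_along:
  assumes "smooth_on T X" "smooth_on T V" "\<And>z. z \<in> T \<Longrightarrow> X z \<in> U"
  shows "smooth_on T (\<lambda>z. D\<theta> (X z) w (V z))"
proof -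
  have D: "smooth_on U (\<lambda>x. D\<theta> x w u)" for u
    unfolding D\<theta>_def by (rule smooth_on_frechet[OF smooth_\<theta>])
  have "smooth_on T (\<lambda>z. \<Sum>i\<in>Basis. (V z \<bullet> i) * D\<theta> (X z) w i)"
    by (intro smooth_on_sum smooth_on_open[OF assms(1)] smooth_on_mult smooth_on_compose[OF D assms(1,3)]
       smooth_on_bounded_linear[OF bounded_linear_inner_left] assms)
  then show ?thesis by (rule smooth_on_cong) (rule D\<theta>_expand[symmetric], rule assms)
qed

text \<open>The terms of the Euler-Lagrange form in which the metric or the one-form is differentiated along the
  curve are together the derivative of the momentum \<open>p\<close>, a smooth function; in the remaining terms the
  direction of differentiation is the fixed vector \<open>w\<close>.\<close>

lemma euler_lagrange_along_continuous:
  fixes y :: "real \<Rightarrow> 'e"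
  assumes y: "smooth_on T y" and U: "\<And>t. t \<in> T \<Longrightarrow> y t \<in> U"
  shows "continuous_on T (\<lambda>t. euler_lagrange (y t) (dot y t) (dot (dot y) t) w)"
proof -
  note y' = smooth_on_dot[OF y]
  note o = smooth_on_open[OF y]
  define p where "p t = G (y t) (dot y t) w + \<theta> (y t) w" for t
  have p: "smooth_on T p"
    unfolding p_def by (intro smooth_on_add smooth_on_G_along smooth_on_\<theta>_along y y' U smooth_on_const o)
  have "euler_lagrange (y t) (dot y t) (dot (dot y) t) w =
      dot p t - DG (y t) w (dot y t) (dot y t) / 2 - D\<theta> (y t) w (dot y t)" if t: "t \<in> T" for t
  proof -
    have "(p has_vector_derivative (DG (y t) (dot y t) (dot y t) w + G (y t) (dot (dot y) t) w + G (y t) (dot y t) 0)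
        + (D\<theta> (y t) (dot y t) w + \<theta> (y t) 0)) (at t)"
      unfolding p_def
      by (intro has_vector_derivative_add G_along_has_derivative[OF o t U] \<theta>_along_has_derivative[OF o t U]
          has_dot[OF y t] has_dot[OF y' t] has_vector_derivative_const)
    from dot_eqI[OF p t this] show ?thesis
      using linear_0[OF linear_\<theta>[OF U[OF t]]] bilinear_rzero[OF bilinear_G[OF U[OF t]]]
      by (simp add: euler_lagrange_def)
  qed
  moreover have "continuous_on T (\<lambda>t. dot p t - DG (y t) w (dot y t) (dot y t) / 2 - D\<theta> (y t) w (dot y t))"
    by (intro continuous_intros smooth_on_continuous smooth_on_dot p smooth_on_DG_along smooth_on_D\<theta>_along y y' U) auto
  ultimately show ?thesis by (simp cong: continuous_on_cong)
qed

lemma G_nondegenerate: "x \<in> U \<Longrightarrow> (\<And>w. G x u w = 0) \<Longrightarrow> u = 0"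
  using pos_G[of x u] by fastforce

text \<open>Differentiation under the integral sign gives the integrand \<open>\<kappa>(\<partial>\<^sub>sq/2 + \<partial>\<^sub>sr)\<close> at \<open>s = 0\<close>, where
  \<open>q = G(x\<^sub>t,x\<^sub>t)\<close> and \<open>r = \<theta>(x\<^sub>t)\<close>; the speed condition serves to replace \<open>\<surd>q\<close> by the constant
  \<open>\<surd>e\<close>. Since the mixed partial derivatives of \<open>x\<close> agree, this integrand is \<open>\<kappa>\<close> times the
  \<open>t\<close>-derivative of the momentum \<open>p = G(x\<^sub>t,x\<^sub>s) + \<theta>(x\<^sub>s)\<close> minus the Euler-Lagrange form.\<close>

lemma first_variation:
  fixes x :: "real \<times> real \<Rightarrow> 'e"
  assumes x: "smooth_on W x" and U: "\<And>z. z \<in> W \<Longrightarrow> x z \<in> U"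
    and cd: "c \<le> d" "\<And>t. t \<in> {c..d} \<Longrightarrow> (0, t) \<in> W"
    and e: "e > 0" "\<And>t. t \<in> {c..d} \<Longrightarrow> G (x (0, t)) (partial_t x (0, t)) (partial_t x (0, t)) = e"
  defines "\<kappa> \<equiv> 1 / sqrt e"
  defines "P \<equiv> \<lambda>t. G (x (0, t)) (partial_t x (0, t)) (partial_s x (0, t)) + \<theta> (x (0, t)) (partial_s x (0, t))"
  defines "L \<equiv> \<lambda>z. sqrt (G (x z) (partial_t x z) (partial_t x z)) + \<kappa> * \<theta> (x z) (partial_t x z)"
  obtains \<delta> where "\<delta> > 0" "{-\<delta>..\<delta>} \<times> {c..d} \<subseteq> W"
    "\<And>s. s \<in> {-\<delta>..\<delta>} \<Longrightarrow> continuous_on {c..d} (\<lambda>t. L (s, t))"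
    "((\<lambda>s. integral {c..d} (\<lambda>t. L (s, t))) has_real_derivative
      \<kappa> * (P d - P c - integral {c..d} (\<lambda>t. euler_lagrange (x (0, t)) (partial_t x (0, t))
             (partial_t (partial_t x) (0, t)) (partial_s x (0, t))))) (at 0)"
proof -
  note xs = smooth_on_partial_s[OF x] and xt = smooth_on_partial_t[OF x]
  note o = smooth_on_open[OF x]
  define q where "q z = G (x z) (partial_t x z) (partial_t x z)" for z
  define r where "r z = \<theta> (x z) (partial_t x z)" for z
  define p where "p z = G (x z) (partial_t x z) (partial_s x z) + \<theta> (x z) (partial_s x z)" for z
  have q: "smooth_on W q" unfolding q_def by (intro smooth_on_G_along x xt U)
  have r: "smooth_on W r" unfolding r_def by (intro smooth_on_\<theta>_along x xt U)
  have p: "smooth_on W p" unfolding p_def by (intro smooth_on_add smooth_on_G_along smooth_on_\<theta>_along x xt xs U)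
  \<comment> \<open>The square root is differentiable only where the speed is positive, which holds near \<open>s = 0\<close> by compactness.\<close>
  define W' where "W' = W \<inter> q -` {0<..}"
  have W': "open W'" unfolding W'_def
    by (rule continuous_open_preimage[OF smooth_on_continuous[OF q] o]) simp
  have "compact ({0} \<times> {c..d})" by (intro compact_Times) auto
  moreover have "{0} \<times> {c..d} \<subseteq> W'" using cd(2) e by (auto simp: W'_def q_def)
  ultimately obtain \<epsilon> where \<epsilon>: "\<epsilon> > 0" "(\<Union>z\<in>{0} \<times> {c..d}. ball z \<epsilon>) \<subseteq> W'"
    using compact_subset_open_imp_ball_epsilon_subset[OF _ W'] by blast
  define \<delta> where "\<delta> = \<epsilon> / 2"
  have \<delta>: "\<delta> > 0" using \<epsilon> by (simp add: \<delta>_def)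
  have inW': "(s, t) \<in> W'" if "s \<in> {-\<delta>..\<delta>}" "t \<in> {c..d}" for s t
  proof -
    have "dist (0, t) (s, t) < \<epsilon>" using that(1) \<epsilon>(1) by (auto simp: dist_Pair_Pair \<delta>_def)
    then show ?thesis using \<epsilon>(2) that(2) by fastforce
  qed
  have inW: "(s, t) \<in> W" "q (s, t) > 0" if "s \<in> {-\<delta>..\<delta>}" "t \<in> {c..d}" for s t
    using inW'[OF that] by (auto simp: W'_def)
  have Lqr: "L z = sqrt (q z) + \<kappa> * r z" for z by (simp add: L_def q_def r_def)
  define L' where "L' z = partial_s q z / (2 * sqrt (q z)) + \<kappa> * partial_s r z" for z
  have sub: "{-\<delta>..\<delta>} \<times> {c..d} \<subseteq> W" using inW by auto
  have cont_L: "continuous_on {c..d} (\<lambda>t. L (s, t))" if "s \<in> {-\<delta>..\<delta>}" for s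
    unfolding Lqr
    by (intro continuous_intros continuous_on_section[OF smooth_on_continuous[OF q]]
        continuous_on_section[OF smooth_on_continuous[OF r]] inW that)
  have "((\<lambda>s. integral (cbox c d) (\<lambda>t. L (s, t))) has_real_derivative integral (cbox c d) (\<lambda>t. L' (0, t)))
      (at 0 within {-\<delta>..\<delta>})"
  proof (rule leibniz_rule_field_derivative)
    show "((\<lambda>s. L (s, t)) has_real_derivative L' (s, t)) (at s within {-\<delta>..\<delta>})"
      if "s \<in> {-\<delta>..\<delta>}" "t \<in> cbox c d" for s t
    proof -
      have w: "(s, t) \<in> W" "q (s, t) > 0" using inW that by auto
      have "((\<lambda>s. q (s, t)) has_real_derivative partial_s q (s, t)) (at s)"
        "((\<lambda>s. r (s, t)) has_real_derivative partial_s r (s, t)) (at s)"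
        using has_partial_s[OF q w(1)] has_partial_s[OF r w(1)] by (simp_all add: has_real_derivative_iff_has_vector_derivative)
      then have "((\<lambda>s. L (s, t)) has_real_derivative
          inverse (sqrt (q (s, t))) / 2 * partial_s q (s, t) + \<kappa> * partial_s r (s, t)) (at s)"
        unfolding Lqr by (intro DERIV_add DERIV_chain2[where f = sqrt and g = "\<lambda>s. q (s, t)"] DERIV_real_sqrt w(2) DERIV_cmult)
      moreover have "inverse (sqrt (q (s, t))) / 2 * partial_s q (s, t) + \<kappa> * partial_s r (s, t) = L' (s, t)"
        using w(2) by (simp add: L'_def field_simps)
      ultimately show ?thesis by (metis has_field_derivative_at_within)
    qed
    show "(\<lambda>t. L (s, t)) integrable_on cbox c d" if "s \<in> {-\<delta>..\<delta>}" for s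
      using integrable_continuous_real[OF cont_L[OF that]] by simp
    have "continuous_on ({-\<delta>..\<delta>} \<times> {c..d}) L'"
      unfolding L'_def
    proof (intro continuous_intros continuous_on_subset[OF smooth_on_continuous[OF q] sub]
        continuous_on_subset[OF smooth_on_continuous[OF smooth_on_partial_s[OF q]] sub]
        continuous_on_subset[OF smooth_on_continuous[OF smooth_on_partial_s[OF r]] sub] ballI)
      show "2 * sqrt (q z) \<noteq> 0" if "z \<in> {-\<delta>..\<delta>} \<times> {c..d}" for z
        using that inW(2)[of "fst z" "snd z"] by auto
    qed
    then show "continuous_on ({-\<delta>..\<delta>} \<times> cbox c d) (\<lambda>(s, t). L' (s, t))" by simp
  qed (use \<delta> in auto)
  moreover have "at 0 within {-\<delta>..\<delta>} = at (0::real)"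
    using \<delta> by (intro at_within_interior) auto
  ultimately have D: "((\<lambda>s. integral {c..d} (\<lambda>t. L (s, t))) has_real_derivative integral {c..d} (\<lambda>t. L' (0, t))) (at 0)"
    by simp
  have 0: "0 \<in> {-\<delta>..\<delta>}" using \<delta> by simp
  have key: "euler_lagrange (x (0, t)) (partial_t x (0, t)) (partial_t (partial_t x) (0, t)) (partial_s x (0, t))
      = partial_t p (0, t) - (1/2 * partial_s q (0, t) + partial_s r (0, t))" if t: "t \<in> {c..d}" for t
  proof -
    have w: "(0, t) \<in> W" using cd t by blast
    have os: "open {s. (s, t) \<in> W}" "0 \<in> {s. (s, t) \<in> W}"
      using open_vimage[OF o, of "\<lambda>s. (s, t)"] w by (auto simp: vimage_def continuous_on_Pair)
    have ot: "open {t. (0, t) \<in> W}" "t \<in> {t. (0, t) \<in> W}"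
      using open_vimage[OF o, of "\<lambda>t. (0, t)"] w by (auto simp: vimage_def continuous_on_Pair)
    have xin: "x (0, t) \<in> U" using U w by blast
    have q': "partial_s q (0, t) = DG (x (0, t)) (partial_s x (0, t)) (partial_t x (0, t)) (partial_t x (0, t))
       + G (x (0, t)) (partial_s (partial_t x) (0, t)) (partial_t x (0, t))
       + G (x (0, t)) (partial_t x (0, t)) (partial_s (partial_t x) (0, t))"
      by (rule vector_derivative_unique_at[OF has_partial_s[OF q w]], unfold q_def,
          rule G_along_has_derivative[OF os])
        (auto intro: U has_partial_s[OF x w] has_partial_s[OF xt w])
    have r': "partial_s r (0, t) = D\<theta> (x (0, t)) (partial_s x (0, t)) (partial_t x (0, t))
       + \<theta> (x (0, t)) (partial_s (partial_t x) (0, t))"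
      by (rule vector_derivative_unique_at[OF has_partial_s[OF r w]], unfold r_def,
          rule \<theta>_along_has_derivative[OF os])
        (auto intro: U has_partial_s[OF x w] has_partial_s[OF xt w])
    have p': "partial_t p (0, t) = (DG (x (0, t)) (partial_t x (0, t)) (partial_t x (0, t)) (partial_s x (0, t))
       + G (x (0, t)) (partial_t (partial_t x) (0, t)) (partial_s x (0, t))
       + G (x (0, t)) (partial_t x (0, t)) (partial_t (partial_s x) (0, t)))
       + (D\<theta> (x (0, t)) (partial_t x (0, t)) (partial_s x (0, t)) + \<theta> (x (0, t)) (partial_t (partial_s x) (0, t)))"
      by (rule vector_derivative_unique_at[OF has_partial_t[OF p w]], unfold p_def,
          rule has_vector_derivative_add[OF G_along_has_derivative[OF ot] \<theta>_along_has_derivative[OF ot]])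
        (auto intro: U has_partial_t[OF x w] has_partial_t[OF xt w] has_partial_t[OF xs w])
    show ?thesis
      unfolding euler_lagrange_def p' q' r' mixed_partials[OF x w]
      using sym_G[OF xin, of "partial_t (partial_s x) (0, t)" "partial_t x (0, t)"] by (simp add: field_simps)
  qed
  have L'0: "L' (0, t) = \<kappa> * (1/2 * partial_s q (0, t) + partial_s r (0, t))" if "t \<in> {c..d}" for t
    using e that by (simp add: L'_def \<kappa>_def q_def field_simps)
  have int1: "(\<lambda>t. 1/2 * partial_s q (0, t) + partial_s r (0, t)) integrable_on {c..d}"
    by (intro integrable_continuous_real continuous_intros
        continuous_on_section[OF smooth_on_continuous[OF smooth_on_partial_s[OF q]]]
        continuous_on_section[OF smooth_on_continuous[OF smooth_on_partial_s[OF r]]] cd(2))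
  have int2: "((\<lambda>t. partial_t p (0, t)) has_integral P d - P c) {c..d}"
  proof -
    have "((\<lambda>t. p (0, t)) has_vector_derivative partial_t p (0, t)) (at t within {c..d})" if "t \<in> {c..d}" for t
      by (rule has_vector_derivative_at_within[OF has_partial_t[OF p cd(2)[OF that]]])
    from fundamental_theorem_of_calculus[OF cd(1) this] show ?thesis by (simp add: P_def p_def)
  qed
  have "integral {c..d} (\<lambda>t. euler_lagrange (x (0, t)) (partial_t x (0, t)) (partial_t (partial_t x) (0, t)) (partial_s x (0, t)))
      = integral {c..d} (\<lambda>t. partial_t p (0, t) - (1/2 * partial_s q (0, t) + partial_s r (0, t)))"
    by (rule integral_cong) (rule key)
  also have "\<dots> = (P d - P c) - integral {c..d} (\<lambda>t. 1/2 * partial_s q (0, t) + partial_s r (0, t))"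
    using int2 int1 by (subst integral_diff) (auto simp: has_integral_iff)
  finally have "integral {c..d} (\<lambda>t. 1/2 * partial_s q (0, t) + partial_s r (0, t)) = P d - P c -
     integral {c..d} (\<lambda>t. euler_lagrange (x (0, t)) (partial_t x (0, t)) (partial_t (partial_t x) (0, t)) (partial_s x (0, t)))"
    by simp
  moreover have "integral {c..d} (\<lambda>t. L' (0, t)) = \<kappa> * integral {c..d} (\<lambda>t. 1/2 * partial_s q (0, t) + partial_s r (0, t))"
    unfolding integral_mult_right[symmetric] by (rule integral_cong) (rule L'0)
  ultimately show ?thesis using that[OF \<delta> sub cont_L] D by simp
qed

end

section \<open>The Euler-Lagrange equation as a second order differential equation\<close>

lemma has_vector_derivative_glue:
  fixes f1 f2 :: "real \<Rightarrow> 'e::real_normed_vector"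
  assumes "t \<le> t0 \<Longrightarrow> (f1 has_vector_derivative D1 t) (at t)" "t \<ge> t0 \<Longrightarrow> (f2 has_vector_derivative D2 t) (at t)"
    and eq: "f1 t0 = f2 t0" "D1 t0 = D2 t0"
  shows "((\<lambda>t. if t \<le> t0 then f1 t else f2 t) has_vector_derivative (if t \<le> t0 then D1 t else D2 t)) (at t)"
proof -
  have "((\<lambda>t. if t \<in> {..t0} then f1 t else f2 t) has_vector_derivative (if t \<in> {..t0} then D1 t else D2 t))
      (at t within UNIV)"
    by (rule has_vector_derivative_If_within_closures[where T = "{t0<..}"])
      (use assms in \<open>auto intro: has_vector_derivative_at_within\<close>)
  then show ?thesis by simp
qed

lemma linear_vec_expand:
  fixes L :: "real ^ 'n \<Rightarrow> real"
  assumes "linear L"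
  shows "L u = (\<Sum>i\<in>UNIV. u $ i * L (axis i 1))"
proof -
  have "L (\<Sum>i\<in>UNIV. u $ i *\<^sub>R axis i 1) = (\<Sum>i\<in>UNIV. u $ i * L (axis i 1))"
    by (simp only: linear_sum[OF assms] linear_cmul[OF assms] real_scaleR_def)
  then show ?thesis using basis_expansion[of u] by (simp add: scalar_mult_eq_scaleR)
qed

context coordinate_lagrangian
begin

lemma linear_G_right: "x \<in> U \<Longrightarrow> linear (G x u)"
  using bilinear_G by (auto simp: bilinear_def)

lemma linear_G_left: "x \<in> U \<Longrightarrow> linear (\<lambda>u. G x u v)"
  using bilinear_G by (auto simp: bilinear_def)

lemma linear_DG_direction: "x \<in> U \<Longrightarrow> linear (\<lambda>h. DG x h u v)"
  using has_derivative_bounded_linear[OF G_has_derivative] bounded_linear.linear by blast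

lemma linear_D\<theta>_direction: "x \<in> U \<Longrightarrow> linear (\<lambda>h. D\<theta> x h u)"
  using has_derivative_bounded_linear[OF \<theta>_has_derivative] bounded_linear.linear by blast

lemma linear_DG_left:
  assumes "x \<in> U"
  shows "linear (\<lambda>u. DG x h u v)"
proof (rule linearI)
  fix u u' r
  note E = DG_expand[OF assms, of h _ v]
  show "DG x h (u + u') v = DG x h u v + DG x h u' v"
    unfolding E[of "u + u'"] E[of u] E[of u'] by (simp add: inner_add_left distrib_right sum.distrib)
  show "DG x h (r *\<^sub>R u) v = r *\<^sub>R DG x h u v"
    unfolding E[of "r *\<^sub>R u"] E[of u] by (simp add: sum_distrib_left mult.assoc)
qed

lemma DG_symmetric: "x \<in> U \<Longrightarrow> DG x h u v = DG x h v u"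
  unfolding DG_def using frechet_derivative_cong_open[OF open_U, of x "\<lambda>x. G x u v" "\<lambda>x. G x v u"] sym_G by simp

lemma linear_DG_right: "x \<in> U \<Longrightarrow> linear (DG x h u)"
  using linear_DG_left[of x h u] DG_symmetric[of x h u] by presburger

lemma linear_D\<theta>_right:
  assumes "x \<in> U"
  shows "linear (D\<theta> x h)"
proof (rule linearI)
  fix u u' r
  note E = D\<theta>_expand[OF assms, of h]
  show "D\<theta> x h (u + u') = D\<theta> x h u + D\<theta> x h u'"
    unfolding E[of "u + u'"] E[of u] E[of u'] by (simp add: inner_add_left distrib_right sum.distrib)
  show "D\<theta> x h (r *\<^sub>R u) = r *\<^sub>R D\<theta> x h u"
    unfolding E[of "r *\<^sub>R u"] E[of u] by (simp add: sum_distrib_left mult.assoc)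
qed

lemma linear_euler_lagrange:
  assumes "x \<in> U"
  shows "linear (euler_lagrange x v a)"
proof -
  have "linear (\<lambda>w. DG x v v w + G x a w - DG x w v v / 2 + D\<theta> x v w - D\<theta> x w v)"
    by (rule linearI)
      (simp_all add: linear_add[OF linear_DG_right[OF assms]] linear_cmul[OF linear_DG_right[OF assms]]
        linear_add[OF linear_G_right[OF assms]] linear_cmul[OF linear_G_right[OF assms]]
        linear_add[OF linear_DG_direction[OF assms]] linear_cmul[OF linear_DG_direction[OF assms]]
        linear_add[OF linear_D\<theta>_right[OF assms]] linear_cmul[OF linear_D\<theta>_right[OF assms]]
        linear_add[OF linear_D\<theta>_direction[OF assms]] linear_cmul[OF linear_D\<theta>_direction[OF assms]] field_simps)
  then show ?thesis by (simp add: euler_lagrange_def[abs_def])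
qed

end

locale coordinate_lagrangian_vec = coordinate_lagrangian U G \<theta>
  for U :: "(real ^ 'n::finite) set" and G \<theta>
begin

definition gram :: "real ^ 'n \<Rightarrow> real ^ 'n ^ 'n" where
  "gram x = (\<chi> i j. G x (axis i 1) (axis j 1))"

lemma G_gram:
  assumes "x \<in> U"
  shows "G x w u = (\<Sum>m\<in>UNIV. w $ m * (gram x *v u) $ m)"
  by (subst linear_vec_expand[OF linear_G_left[OF assms]], subst linear_vec_expand[OF linear_G_right[OF assms]])
    (simp add: gram_def matrix_vector_mult_def mult.commute)

lemma invertible_gram:
  assumes "x \<in> U"
  shows "invertible (gram x)"
proof -
  have "u = 0" if "gram x *v u = 0" for u
    using pos_G[OF assms, of u] G_gram[OF assms, of u u] that by auto
  then show ?thesis by (simp add: invertible_left_inverse matrix_left_invertible_ker)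
qed

lemma gram_times_inverse: "x \<in> U \<Longrightarrow> gram x *v (matrix_inv (gram x) *v u) = u"
  by (simp add: matrix_vector_mul_assoc matrix_inv_inverse invertible_gram)

text \<open>The Euler-Lagrange equation is affine in the second derivative, with the invertible matrix \<open>gram x\<close>
  as its linear part. This is its solution.\<close>

definition acceleration :: "real ^ 'n \<Rightarrow> real ^ 'n \<Rightarrow> real ^ 'n" where
  "acceleration x v = matrix_inv (gram x) *v (\<chi> m. - euler_lagrange x v 0 (axis m 1))"

lemma euler_lagrange_acceleration:
  assumes "x \<in> U"
  shows "(\<forall>w. euler_lagrange x v a w = 0) \<longleftrightarrow> a = acceleration x v"
proof -
  have EL: "euler_lagrange x v a w = G x a w + euler_lagrange x v 0 w" for w
    using linear_0[OF linear_G_left[OF assms]] by (simp add: euler_lagrange_def)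
  have "G x (acceleration x v) w = - euler_lagrange x v 0 w" for w
  proof -
    have "G x (acceleration x v) w = (\<Sum>m\<in>UNIV. w $ m * - euler_lagrange x v 0 (axis m 1))"
      by (subst sym_G[OF assms]) (simp add: G_gram[OF assms] acceleration_def gram_times_inverse[OF assms])
    also have "\<dots> = - euler_lagrange x v 0 w"
      by (subst (2) linear_vec_expand[OF linear_euler_lagrange[OF assms]]) (simp add: sum_negf)
    finally show ?thesis .
  qed
  then have eq: "euler_lagrange x v a w = G x (a - acceleration x v) w" for w
    by (simp add: EL linear_diff[OF linear_G_left[OF assms]])
  show ?thesis
  proof
    assume "\<forall>w. euler_lagrange x v a w = 0"
    then have "a - acceleration x v = 0" by (intro G_nondegenerate[OF assms]) (simp add: eq)
    then show "a = acceleration x v" by simp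
  next
    assume "a = acceleration x v"
    then show "\<forall>w. euler_lagrange x v a w = 0" unfolding eq by (simp add: linear_0[OF linear_G_left[OF assms]])
  qed
qed

lemma smooth_acceleration: "smooth_on (U \<times> UNIV) (\<lambda>(x, v). acceleration x v)"
proof -
  let ?Z = "U \<times> (UNIV :: (real ^ 'n) set)"
  have o: "open ?Z" using open_U by (simp add: open_Times)
  have X: "smooth_on ?Z fst" "smooth_on ?Z snd"
    using o by (auto intro: smooth_on_linear_map bounded_linear_fst bounded_linear_snd)
  have U: "fst z \<in> U" if "z \<in> ?Z" for z using that by auto
  have snd: "smooth_on ?Z (\<lambda>z. snd z \<bullet> b)" for b
    by (rule smooth_on_bounded_linear[OF bounded_linear_inner_left X(2)])
  have dir: "L v = (\<Sum>b\<in>Basis. (v \<bullet> b) * L b)" if "linear L" for L :: "real ^ 'n \<Rightarrow> real" and v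
    by (rule linear_euclidean_expand[OF that])
  have EL: "smooth_on ?Z (\<lambda>z. euler_lagrange (fst z) (snd z) 0 w)" for w
  proof -
    have "smooth_on ?Z (\<lambda>z. (\<Sum>b\<in>Basis. (snd z \<bullet> b) * DG (fst z) b (snd z) w) - DG (fst z) w (snd z) (snd z) / 2
        + (\<Sum>b\<in>Basis. (snd z \<bullet> b) * D\<theta> (fst z) b w) - D\<theta> (fst z) w (snd z))"
      by (intro smooth_on_add smooth_on_diff smooth_on_sum o smooth_on_mult snd smooth_on_DG_along smooth_on_D\<theta>_along
          X U smooth_on_const smooth_on_divide) auto
    then show ?thesis
    proof (rule smooth_on_cong)
      fix z assume z: "z \<in> ?Z"
      note U = U[OF z]
      show "(\<Sum>b\<in>Basis. (snd z \<bullet> b) * DG (fst z) b (snd z) w) - DG (fst z) w (snd z) (snd z) / 2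
        + (\<Sum>b\<in>Basis. (snd z \<bullet> b) * D\<theta> (fst z) b w) - D\<theta> (fst z) w (snd z) = euler_lagrange (fst z) (snd z) 0 w"
        unfolding dir[OF linear_DG_direction[OF U], symmetric] dir[OF linear_D\<theta>_direction[OF U], symmetric]
          euler_lagrange_def linear_0[OF linear_G_left[OF U]] by simp
    qed
  qed
  have gram: "smooth_on U (\<lambda>x. gram x $ i $ j)" for i j
    using smooth_G by (simp add: gram_def)
  have inv: "smooth_on ?Z (\<lambda>z. matrix_inv (gram (fst z)) $ k $ l)" for k l
    by (rule smooth_on_compose[OF smooth_on_matrix_inv[OF open_U gram invertible_gram] X(1) U])
  have "smooth_on ?Z (\<lambda>z. \<chi> k. \<Sum>l\<in>UNIV. matrix_inv (gram (fst z)) $ k $ l * - euler_lagrange (fst z) (snd z) 0 (axis l 1))"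
    by (intro smooth_on_vec smooth_on_sum smooth_on_mult smooth_on_minus EL inv o)
  then show ?thesis
    by (rule smooth_on_cong) (simp add: acceleration_def matrix_vector_mult_def case_prod_beta)
qed

text \<open>Both pieces have the same acceleration at \<open>t0\<close>, since it is a function of position and velocity. The
  junction therefore solves a smooth second order equation on all of \<open>T\<close>, and solutions are smooth.\<close>

lemma glue_extremals:
  fixes y1 y2 :: "real \<Rightarrow> real ^ 'n"
  assumes y: "smooth_on T y1" "smooth_on T y2" and U: "\<And>t. t \<in> T \<Longrightarrow> y1 t \<in> U" "\<And>t. t \<in> T \<Longrightarrow> y2 t \<in> U"
    and t0: "t0 \<in> T" and eq: "y1 t0 = y2 t0" "dot y1 t0 = dot y2 t0"
    and EL1: "\<And>t w. t \<in> T \<Longrightarrow> t \<le> t0 \<Longrightarrow> euler_lagrange (y1 t) (dot y1 t) (dot (dot y1) t) w = 0"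
    and EL2: "\<And>t w. t \<in> T \<Longrightarrow> t \<ge> t0 \<Longrightarrow> euler_lagrange (y2 t) (dot y2 t) (dot (dot y2) t) w = 0"
  shows "smooth_on T (\<lambda>t. if t \<le> t0 then y1 t else y2 t)"
proof -
  have a: "dot (dot y1) t = acceleration (y1 t) (dot y1 t)" if "t \<in> T" "t \<le> t0" for t
    using euler_lagrange_acceleration[OF U(1)[OF that(1)]] EL1[OF that] by blast
  have b: "dot (dot y2) t = acceleration (y2 t) (dot y2 t)" if "t \<in> T" "t \<ge> t0" for t
    using euler_lagrange_acceleration[OF U(2)[OF that(1)]] EL2[OF that] by blast
  show ?thesis
  proof (rule smooth_on_second_order_ode[OF smooth_on_open[OF y(1)] smooth_acceleration,
        where v = "\<lambda>t. if t \<le> t0 then dot y1 t else dot y2 t"])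
    fix t assume t: "t \<in> T"
    show "(if t \<le> t0 then y1 t else y2 t, if t \<le> t0 then dot y1 t else dot y2 t) \<in> U \<times> UNIV"
      using U t by simp
    show "((\<lambda>t. if t \<le> t0 then y1 t else y2 t) has_vector_derivative (if t \<le> t0 then dot y1 t else dot y2 t)) (at t)"
      by (rule has_vector_derivative_glue[of t t0 y1 "dot y1" y2 "dot y2", OF has_dot[OF y(1) t] has_dot[OF y(2) t] eq])
    have "((\<lambda>t. if t \<le> t0 then dot y1 t else dot y2 t) has_vector_derivative
        (if t \<le> t0 then dot (dot y1) t else dot (dot y2) t)) (at t)"
      by (rule has_vector_derivative_glue[of t t0 "dot y1" "dot (dot y1)" "dot y2" "dot (dot y2)", OF has_dot[OF smooth_on_dot[OF y(1)] t] has_dot[OF smooth_on_dot[OF y(2)] t] eq(2)])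
        (simp add: a b t0 eq)
    moreover have "(if t \<le> t0 then dot (dot y1) t else dot (dot y2) t) =
        (case (if t \<le> t0 then y1 t else y2 t, if t \<le> t0 then dot y1 t else dot y2 t) of (x, v) \<Rightarrow> acceleration x v)"
      using a b t by simp
    ultimately show "((\<lambda>t. if t \<le> t0 then dot y1 t else dot y2 t) has_vector_derivative
        (case (if t \<le> t0 then y1 t else y2 t, if t \<le> t0 then dot y1 t else dot y2 t) of (x, v) \<Rightarrow> acceleration x v)) (at t)"
      by simp
  qed
qed

text \<open>The vector \<open>\<Gamma>\<^sup>k\<^sub>i\<^sub>j v\<^sup>i v\<^sup>j\<close>, with the symbols spelled out as in the definition of \<open>christoffel\<close>.\<close>

definition christoffel_term :: "real ^ 'n \<Rightarrow> real ^ 'n \<Rightarrow> real ^ 'n" where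
  "christoffel_term x v = (\<chi> k. \<Sum>i\<in>UNIV. \<Sum>j\<in>UNIV. ((\<Sum>l\<in>UNIV. matrix_inv (gram x) $ k $ l *
      (DG x (axis i 1) (axis j 1) (axis l 1) + DG x (axis j 1) (axis i 1) (axis l 1)
         - DG x (axis l 1) (axis i 1) (axis j 1))) / 2) * v $ i * v $ j)"

text \<open>Lowering the index of \<open>\<Gamma>\<^sup>k\<^sub>i\<^sub>j v\<^sup>i v\<^sup>j\<close> cancels the inverse matrix. The first two of the three partial
  derivatives of the metric contribute equally because \<open>v\<^sup>i v\<^sup>j\<close> is symmetric.\<close>

lemma G_christoffel_term:
  assumes x: "x \<in> U"
  shows "G x (christoffel_term x v) w = DG x v v w - DG x w v v / 2"
proof -
  define S where "S l = (\<Sum>i\<in>UNIV. \<Sum>j\<in>UNIV. (DG x (axis i 1) (axis j 1) (axis l 1)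
      + DG x (axis j 1) (axis i 1) (axis l 1) - DG x (axis l 1) (axis i 1) (axis j 1)) * v $ i * v $ j)" for l
  have 1: "(\<Sum>i\<in>UNIV. \<Sum>j\<in>UNIV. DG x (axis i 1) (axis j 1) u * v $ i * v $ j) = DG x v v u" for u
    by (subst (2) linear_vec_expand[OF linear_DG_direction[OF x]], subst linear_vec_expand[OF linear_DG_left[OF x]])
      (simp add: sum_distrib_left mult_ac)
  have 2: "(\<Sum>i\<in>UNIV. \<Sum>j\<in>UNIV. DG x u (axis i 1) (axis j 1) * v $ i * v $ j) = DG x u v v" for u
    by (subst (2) linear_vec_expand[OF linear_DG_left[OF x]], subst linear_vec_expand[OF linear_DG_right[OF x]])
      (simp add: sum_distrib_left mult_ac)
  have 3: "(\<Sum>i\<in>UNIV. \<Sum>j\<in>UNIV. DG x (axis j 1) (axis i 1) u * v $ i * v $ j) = DG x v v u" for u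
    by (subst sum.swap) (simp add: 1[symmetric] mult_ac)
  have S: "S l = 2 * DG x v v (axis l 1) - DG x (axis l 1) v v" for l
    unfolding S_def left_diff_distrib distrib_right sum.distrib sum_subtractf 1 2 3 by simp
  have "christoffel_term x v $ k = (matrix_inv (gram x) *v (\<chi> l. S l / 2)) $ k" for k
  proof -
    have "christoffel_term x v $ k = (\<Sum>i\<in>UNIV. \<Sum>j\<in>UNIV. \<Sum>l\<in>UNIV. matrix_inv (gram x) $ k $ l *
      (((DG x (axis i 1) (axis j 1) (axis l 1) + DG x (axis j 1) (axis i 1) (axis l 1)
         - DG x (axis l 1) (axis i 1) (axis j 1)) * v $ i * v $ j) / 2))"
      by (simp add: christoffel_term_def sum_divide_distrib sum_distrib_right sum_distrib_left mult_ac)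
    also have "\<dots> = (\<Sum>l\<in>UNIV. matrix_inv (gram x) $ k $ l * (S l / 2))"
      unfolding S_def sum_divide_distrib sum_distrib_left
      by (rule trans[OF sum.cong[OF refl sum.swap] sum.swap])
    finally show ?thesis by (simp add: matrix_vector_mult_def)
  qed
  then have "christoffel_term x v = matrix_inv (gram x) *v (\<chi> l. S l / 2)" by (simp add: vec_eq_iff)
  then have "G x (christoffel_term x v) w = (\<Sum>m\<in>UNIV. w $ m * (DG x v v (axis m 1) - DG x (axis m 1) v v / 2))"
    by (subst sym_G[OF x]) (unfold G_gram[OF x], simp add: gram_times_inverse[OF x] S diff_divide_distrib)
  also have "\<dots> = DG x v v w - DG x w v v / 2"
    by (subst (3) linear_vec_expand[OF linear_DG_right[OF x]], subst (3) linear_vec_expand[OF linear_DG_direction[OF x]])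
      (simp add: right_diff_distrib sum_subtractf sum_divide_distrib)
  finally show ?thesis .
qed

end

section \<open>Charts and tangent vectors\<close>

locale atlas =
  fixes A :: "('a::{t2_space, second_countable_topology}, 'n::finite) chart set"
  assumes manifold: "smooth_manifold A"
begin

lemma chart_exists: obtains \<phi> where "\<phi> \<in> charts_at A p"
  using manifold unfolding smooth_manifold_def charts_at_def by blast

lemma charts_atD: "\<phi> \<in> charts_at A p \<Longrightarrow> \<phi> \<in> A" "\<phi> \<in> charts_at A p \<Longrightarrow> p \<in> fst \<phi>"
  by (auto simp: charts_at_def)

lemma charts_atI: "\<phi> \<in> A \<Longrightarrow> p \<in> fst \<phi> \<Longrightarrow> \<phi> \<in> charts_at A p"
  by (auto simp: charts_at_def)

lemma open_chart_image: "\<phi> \<in> A \<Longrightarrow> open (chart_image \<phi>)"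
  using manifold unfolding smooth_manifold_def by blast

lemma chart_inv_left:
  assumes "\<phi> \<in> A" "p \<in> fst \<phi>"
  shows "chart_inv \<phi> (snd \<phi> p) = p"
proof -
  have "homeomorphism (fst \<phi>) (chart_image \<phi>) (snd \<phi>) (chart_inv \<phi>)"
    using manifold assms(1) unfolding smooth_manifold_def by blast
  then show ?thesis using assms(2) by (rule homeomorphism_apply1)
qed

lemma chart_inv_right: "x \<in> chart_image \<phi> \<Longrightarrow> snd \<phi> (chart_inv \<phi> x) = x"
  by (rule f_inv_into_f)

lemma chart_inv_in: "x \<in> chart_image \<phi> \<Longrightarrow> chart_inv \<phi> x \<in> fst \<phi>"
  by (rule inv_into_into)

lemma smooth_transition:
  "\<phi> \<in> A \<Longrightarrow> \<psi> \<in> A \<Longrightarrow> smooth_on (snd \<phi> ` (fst \<phi> \<inter> fst \<psi>)) (snd \<psi> \<circ> chart_inv \<phi>)"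
  using manifold unfolding smooth_manifold_def by blast

lemma transition_has_derivative:
  assumes "\<phi> \<in> charts_at A p" "\<psi> \<in> charts_at A p"
  shows "((snd \<psi> \<circ> chart_inv \<phi>) has_derivative transition_deriv \<phi> \<psi> p) (at (snd \<phi> p))"
  unfolding transition_deriv_def
  by (rule smooth_on_has_derivative[OF smooth_transition]) (use assms in \<open>auto simp: charts_at_def\<close>)

lemma linear_transition:
  "\<phi> \<in> charts_at A p \<Longrightarrow> \<psi> \<in> charts_at A p \<Longrightarrow> linear (transition_deriv \<phi> \<psi> p)"
  using has_derivative_linear[OF transition_has_derivative] .

lemma transition_cocycle:
  assumes "\<phi> \<in> charts_at A p" "\<psi> \<in> charts_at A p" "\<rho> \<in> charts_at A p"
  shows "transition_deriv \<psi> \<rho> p (transition_deriv \<phi> \<psi> p w) = transition_deriv \<phi> \<rho> p w"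
proof -
  let ?X = "snd \<phi> ` (fst \<phi> \<inter> fst \<psi>)"
  have p: "(snd \<psi> \<circ> chart_inv \<phi>) (snd \<phi> p) = snd \<psi> p"
    using chart_inv_left assms by (simp add: charts_at_def)
  have "((snd \<rho> \<circ> chart_inv \<psi>) has_derivative transition_deriv \<psi> \<rho> p) (at ((snd \<psi> \<circ> chart_inv \<phi>) (snd \<phi> p)))"
    unfolding p by (rule transition_has_derivative[OF assms(2,3)])
  from has_derivative_compose[OF transition_has_derivative[OF assms(1,2)] this]
  have "((\<lambda>x. (snd \<rho> \<circ> chart_inv \<psi>) ((snd \<psi> \<circ> chart_inv \<phi>) x)) has_derivative
      (\<lambda>w. transition_deriv \<psi> \<rho> p (transition_deriv \<phi> \<psi> p w))) (at (snd \<phi> p))" .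
  then have "((snd \<rho> \<circ> chart_inv \<phi>) has_derivative
      (\<lambda>w. transition_deriv \<psi> \<rho> p (transition_deriv \<phi> \<psi> p w))) (at (snd \<phi> p))"
  proof (rule has_derivative_transform_within_open)
    show "open ?X" using smooth_on_open[OF smooth_transition] assms by (auto simp: charts_at_def)
    show "snd \<phi> p \<in> ?X" using assms by (auto simp: charts_at_def)
    show "(snd \<rho> \<circ> chart_inv \<psi>) ((snd \<psi> \<circ> chart_inv \<phi>) x) = (snd \<rho> \<circ> chart_inv \<phi>) x" if "x \<in> ?X" for x
      using that chart_inv_left[OF charts_atD(1)[OF assms(1)]] chart_inv_left[OF charts_atD(1)[OF assms(2)]] by auto
  qed
  from has_derivative_unique[OF this transition_has_derivative[OF assms(1,3)]] show ?thesis by metis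
qed

lemma transition_self:
  assumes "\<phi> \<in> charts_at A p"
  shows "transition_deriv \<phi> \<phi> p w = w"
proof -
  have "((\<lambda>x. x) has_derivative (\<lambda>w. w)) (at (snd \<phi> p))" by (rule has_derivative_ident)
  then have "((snd \<phi> \<circ> chart_inv \<phi>) has_derivative (\<lambda>w. w)) (at (snd \<phi> p))"
  proof (rule has_derivative_transform_within_open)
    show "open (chart_image \<phi>)" "snd \<phi> p \<in> chart_image \<phi>"
      using assms open_chart_image by (auto simp: charts_at_def)
    show "x = (snd \<phi> \<circ> chart_inv \<phi>) x" if "x \<in> chart_image \<phi>" for x
      using chart_inv_right[OF that] by simp
  qed
  from has_derivative_unique[OF transition_has_derivative[OF assms assms] this] show ?thesis by metis
qed

lemma tvec_of_at: "\<psi> \<in> charts_at A p \<Longrightarrow> tvec_of A \<phi> p w \<psi> = transition_deriv \<phi> \<psi> p w"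
  by (simp add: tvec_of_def)

lemma tvec_of_self: "\<phi> \<in> charts_at A p \<Longrightarrow> tvec_of A \<phi> p w \<phi> = w"
  by (simp add: tvec_of_def transition_self)

lemma tvec_of_in:
  assumes "\<phi> \<in> charts_at A p"
  shows "tvec_of A \<phi> p w \<in> tangent_space A p"
  unfolding tangent_space_def mem_Collect_eq
proof (intro conjI ballI allI impI)
  fix \<psi> \<rho> assume *: "\<psi> \<in> charts_at A p" "\<rho> \<in> charts_at A p"
  show "tvec_of A \<phi> p w \<rho> = transition_deriv \<psi> \<rho> p (tvec_of A \<phi> p w \<psi>)"
    unfolding tvec_of_at[OF *(1)] tvec_of_at[OF *(2)] by (rule transition_cocycle[OF assms *, symmetric])
qed (simp add: tvec_of_def)

lemma tvec_of_components:
  assumes "\<phi> \<in> charts_at A p" "u \<in> tangent_space A p"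
  shows "tvec_of A \<phi> p (u \<phi>) = u"
proof
  fix \<psi>
  show "tvec_of A \<phi> p (u \<phi>) \<psi> = u \<psi>"
  proof (cases "\<psi> \<in> charts_at A p")
    case True
    then have "u \<psi> = transition_deriv \<phi> \<psi> p (u \<phi>)"
      using assms unfolding tangent_space_def by blast
    with True show ?thesis by (metis tvec_of_at)
  next
    case False
    then have "u \<psi> = 0" using assms(2) unfolding tangent_space_def by blast
    with False show ?thesis by (simp add: tvec_of_def)
  qed
qed

lemma tvec_comb_tvec_of:
  assumes "\<phi> \<in> charts_at A p"
  shows "tvec_comb r (tvec_of A \<phi> p u) s (tvec_of A \<phi> p v) = tvec_of A \<phi> p (r *\<^sub>R u + s *\<^sub>R v)"
  using linear_transition[OF assms] by (auto simp: tvec_comb_def tvec_of_def linear_add linear_cmul)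

section \<open>Local expressions of maps into the manifold\<close>

text \<open>The expression \<open>f\<close> of \<open>h\<close> in the chart \<open>\<phi>\<close> is defined on an open set \<open>W\<close> that may reach beyond \<open>X\<close>, so
  that at boundary points of \<open>X\<close> two-sided derivatives of \<open>f\<close> can stand for one-sided derivatives of \<open>h\<close>.
  Its values are required to stay in the image of the chart, so that tensor fields in coordinates can
  be evaluated along it on all of \<open>W\<close>.\<close>

definition local_expression ::
    "('a, 'n) chart \<Rightarrow> 'x::euclidean_space set \<Rightarrow> ('x \<Rightarrow> 'a) \<Rightarrow> 'x set \<Rightarrow> ('x \<Rightarrow> real ^ 'n) \<Rightarrow> bool" where
  "local_expression \<phi> X h W f \<longleftrightarrow> \<phi> \<in> A \<and> smooth_on W f \<and> f ` W \<subseteq> chart_image \<phi> \<and>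
     (\<forall>y\<in>X \<inter> W. h y \<in> fst \<phi> \<and> snd \<phi> (h y) = f y)"

lemma local_expressionD:
  assumes "local_expression \<phi> X h W f"
  shows "\<phi> \<in> A" "smooth_on W f" "open W" "\<And>y. y \<in> W \<Longrightarrow> f y \<in> chart_image \<phi>"
    "\<And>y. y \<in> X \<Longrightarrow> y \<in> W \<Longrightarrow> h y \<in> fst \<phi>" "\<And>y. y \<in> X \<Longrightarrow> y \<in> W \<Longrightarrow> snd \<phi> (h y) = f y"
    "\<And>y. y \<in> X \<Longrightarrow> y \<in> W \<Longrightarrow> \<phi> \<in> charts_at A (h y)"
    "\<And>y. y \<in> X \<Longrightarrow> y \<in> W \<Longrightarrow> chart_inv \<phi> (f y) = h y"
proof -
  show *: "\<phi> \<in> A" "smooth_on W f" "open W" "\<And>y. y \<in> W \<Longrightarrow> f y \<in> chart_image \<phi>"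
    "\<And>y. y \<in> X \<Longrightarrow> y \<in> W \<Longrightarrow> h y \<in> fst \<phi>" "\<And>y. y \<in> X \<Longrightarrow> y \<in> W \<Longrightarrow> snd \<phi> (h y) = f y"
    "\<And>y. y \<in> X \<Longrightarrow> y \<in> W \<Longrightarrow> \<phi> \<in> charts_at A (h y)"
    using assms by (auto simp: local_expression_def smooth_on_def charts_at_def image_subset_iff)
  show "chart_inv \<phi> (f y) = h y" if "y \<in> X" "y \<in> W" for y
    using chart_inv_left[OF *(1) *(5)[OF that]] *(6)[OF that] by simp
qed

lemma local_expression_subset:
  assumes "local_expression \<phi> X h W f" "open W'" "W' \<subseteq> W" "Y \<inter> W' \<subseteq> X"
  shows "local_expression \<phi> Y h W' f"
  using assms smooth_on_subset unfolding local_expression_def by blast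

lemma smooth_map_onI:
  assumes "\<And>x. x \<in> X \<Longrightarrow> \<exists>\<phi> W f. x \<in> W \<and> local_expression \<phi> X h W f"
  shows "smooth_map_on A X h"
  using assms unfolding smooth_map_on_def local_expression_def by blast

text \<open>Smoothness of a map provides some chart around each point; composing with the smooth transition map
  gives an expression in any prescribed chart around the image point.\<close>

lemma smooth_map_on_local_expression:
  assumes h: "smooth_map_on A X h" and x: "x \<in> X" and \<phi>: "\<phi> \<in> charts_at A (h x)"
  obtains W f where "x \<in> W" "local_expression \<phi> X h W f"
proof -
  obtain \<psi> W0 f0 where \<psi>: "\<psi> \<in> A" and W0: "x \<in> W0" "smooth_on W0 f0"
    and f0: "\<And>y. y \<in> X \<inter> W0 \<Longrightarrow> h y \<in> fst \<psi> \<and> snd \<psi> (h y) = f0 y"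
    using h x unfolding smooth_map_on_def by blast
  let ?Z = "snd \<psi> ` (fst \<psi> \<inter> fst \<phi>)"
  note T = smooth_transition[OF \<psi> charts_atD(1)[OF \<phi>]]
  define W where "W = W0 \<inter> f0 -` ?Z"
  define f where "f y = (snd \<phi> \<circ> chart_inv \<psi>) (f0 y)" for y
  have "open W" unfolding W_def
    using continuous_open_preimage[OF smooth_on_continuous smooth_on_open] W0(2) smooth_on_open[OF T] by blast
  moreover have xW: "x \<in> W" using f0[of x] x W0(1) charts_atD(2)[OF \<phi>] by (auto simp: W_def intro!: image_eqI[of _ _ "h x"])
  moreover have "smooth_on W f" unfolding f_def
    by (rule smooth_on_compose[OF T smooth_on_subset[OF W0(2) \<open>open W\<close>]]) (auto simp: W_def)
  moreover have "f ` W \<subseteq> chart_image \<phi>"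
    using chart_inv_left[OF \<psi>] by (auto simp: W_def f_def)
  moreover have "h y \<in> fst \<phi> \<and> snd \<phi> (h y) = f y" if "y \<in> X \<inter> W" for y
  proof -
    have y: "h y \<in> fst \<psi>" "snd \<psi> (h y) = f0 y" "f0 y \<in> ?Z" using f0 that by (auto simp: W_def)
    then have "chart_inv \<psi> (f0 y) = h y" using chart_inv_left[OF \<psi> y(1)] by simp
    moreover have "chart_inv \<psi> (f0 y) \<in> fst \<phi>" using y(3) chart_inv_left[OF \<psi>] by auto
    ultimately show ?thesis by (simp add: f_def)
  qed
  ultimately show ?thesis using that charts_atD(1)[OF \<phi>] unfolding local_expression_def by blast
qed

lemma smooth_map_on_local_expression_ex:
  assumes "smooth_map_on A X h" "x \<in> X"
  obtains \<phi> W f where "x \<in> W" "local_expression \<phi> X h W f" "\<phi> \<in> charts_at A (h x)"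
proof -
  obtain \<phi> where \<phi>: "\<phi> \<in> charts_at A (h x)" by (rule chart_exists)
  show ?thesis by (rule smooth_map_on_local_expression[OF assms \<phi>]) (rule that[OF _ _ \<phi>])
qed

lemma smooth_map_on_subset:
  assumes "smooth_map_on A X h" "Y \<subseteq> X"
  shows "smooth_map_on A Y h"
proof (rule smooth_map_onI)
  fix x assume x: "x \<in> Y"
  obtain \<phi> W f where *: "x \<in> W" "local_expression \<phi> X h W f"
    by (rule smooth_map_on_local_expression_ex[OF assms(1) subsetD[OF assms(2) x]])
  have "local_expression \<phi> Y h W f"
    by (rule local_expression_subset[OF *(2) local_expressionD(3)[OF *(2)]]) (use assms(2) in auto)
  with * show "\<exists>\<phi> W f. x \<in> W \<and> local_expression \<phi> Y h W f" by blast
qed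

section \<open>Velocities\<close>

lemma chart_change_has_vector_derivative:
  assumes \<phi>: "\<phi> \<in> charts_at A (h t)" and \<psi>: "\<psi> \<in> charts_at A (h t)" and t: "t \<in> S"
    and ev: "\<forall>\<^sub>F s in at t within S. h s \<in> fst \<phi>"
    and v: "((snd \<phi> \<circ> h) has_vector_derivative v) (at t within S)"
  shows "((snd \<psi> \<circ> h) has_vector_derivative transition_deriv \<phi> \<psi> (h t) v) (at t within S)"
proof -
  have D: "((snd \<psi> \<circ> chart_inv \<phi>) has_derivative transition_deriv \<phi> \<psi> (h t)) (at ((snd \<phi> \<circ> h) t))"
    using transition_has_derivative[OF \<phi> \<psi>] by simp
  have "((\<lambda>s. (snd \<psi> \<circ> chart_inv \<phi>) ((snd \<phi> \<circ> h) s)) has_derivative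
      (\<lambda>r. transition_deriv \<phi> \<psi> (h t) (r *\<^sub>R v))) (at t within S)"
    by (rule has_derivative_compose[OF v[unfolded has_vector_derivative_def] D])
  then have "((snd \<psi> \<circ> h) has_derivative (\<lambda>r. transition_deriv \<phi> \<psi> (h t) (r *\<^sub>R v))) (at t within S)"
    by (rule has_derivative_transform_eventually[OF _ eventually_mono[OF ev] _ t])
      (use \<phi> chart_inv_left[OF charts_atD(1)[OF \<phi>]] in \<open>auto simp: charts_at_def\<close>)
  then show ?thesis
    by (simp add: has_vector_derivative_def linear_cmul[OF linear_transition[OF \<phi> \<psi>]])
qed

lemma local_expression_has_vector_derivative:
  assumes le: "local_expression \<phi> S h W y" and t: "t \<in> S" "t \<in> W" and \<psi>: "\<psi> \<in> charts_at A (h t)"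
  shows "((snd \<psi> \<circ> h) has_vector_derivative transition_deriv \<phi> \<psi> (h t) (dot y t)) (at t within S)"
proof (rule chart_change_has_vector_derivative[where h = h, OF local_expressionD(7)[OF le t] \<psi> t(1)])
  have W: "\<forall>\<^sub>F s in at t within S. s \<in> S \<inter> W"
    unfolding eventually_at_topological using local_expressionD(3)[OF le] t(2) by blast
  then show "\<forall>\<^sub>F s in at t within S. h s \<in> fst \<phi>"
    by (rule eventually_mono) (use local_expressionD(5)[OF le] in auto)
  have "(y has_vector_derivative dot y t) (at t within S)"
    by (rule has_vector_derivative_at_within[OF has_dot[OF local_expressionD(2)[OF le] t(2)]])
  then show "((snd \<phi> \<circ> h) has_vector_derivative dot y t) (at t within S)"
    unfolding has_vector_derivative_def
    by (rule has_derivative_transform_eventually[OF _ eventually_mono[OF W] _ t(1)])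
      (use local_expressionD(6)[OF le] t in auto)
qed

lemma local_expression_velocity:
  assumes le: "local_expression \<phi> {a..b} h W y" and t: "t \<in> {a..b}" "t \<in> W" and ab: "a < b"
  shows "velocity A a b h t = tvec_of A \<phi> (h t) (dot y t)" "has_velocity_at A a b h t"
proof -
  have D: "((snd \<psi> \<circ> h) has_vector_derivative transition_deriv \<phi> \<psi> (h t) (dot y t)) (at t within {a..b})"
    if "\<psi> \<in> charts_at A (h t)" for \<psi>
    by (rule local_expression_has_vector_derivative[OF le t that])
  have "vector_derivative (snd \<psi> \<circ> h) (at t within {a..b}) = transition_deriv \<phi> \<psi> (h t) (dot y t)"
    if "\<psi> \<in> charts_at A (h t)" for \<psi>
    using vector_derivative_within_cbox[OF ab, of t] D[OF that] t(1) by simp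
  then show "velocity A a b h t = tvec_of A \<phi> (h t) (dot y t)"
    by (auto simp: velocity_def tvec_of_def)
  show "has_velocity_at A a b h t"
    unfolding has_velocity_at_def using D by (auto simp: has_vector_derivative_def differentiable_def)
qed

text \<open>The one-sided derivative at an end of a subinterval \<open>[c,d]\<close> is the derivative within \<open>[a,b]\<close>, as the
  latter exists.\<close>

lemma velocity_unique:
  assumes v: "velocity A a b h t = tvec_of A \<phi> (h t) v" and le: "local_expression \<phi> {c..d} h W y"
    and h: "local_expression \<psi> {a..b} h W' y'" "t \<in> W'" and t: "t \<in> {c..d}" "t \<in> W"
    and cd: "c < d" "a \<le> c" "d \<le> b"
  shows "v = dot y t"
proof -
  have tab: "t \<in> {a..b}" using t cd by auto
  have \<phi>: "\<phi> \<in> charts_at A (h t)" by (rule local_expressionD(7)[OF le t])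
  have "((snd \<phi> \<circ> h) has_vector_derivative transition_deriv \<psi> \<phi> (h t) (dot y' t)) (at t within {a..b})"
    by (rule local_expression_has_vector_derivative[OF h(1) tab h(2) \<phi>])
  then have "((snd \<phi> \<circ> h) has_vector_derivative transition_deriv \<psi> \<phi> (h t) (dot y' t)) (at t within {c..d})"
    by (rule has_vector_derivative_within_subset) (use cd in auto)
  moreover have "((snd \<phi> \<circ> h) has_vector_derivative transition_deriv \<phi> \<phi> (h t) (dot y t)) (at t within {c..d})"
    by (rule local_expression_has_vector_derivative[OF le t \<phi>])
  ultimately have "transition_deriv \<psi> \<phi> (h t) (dot y' t) = dot y t"
    using vector_derivative_unique_within_closed_interval[OF cd(1), of t] t(1) transition_self[OF \<phi>] by simp
  moreover have "velocity A a b h t = tvec_of A \<psi> (h t) (dot y' t)"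
    by (rule local_expression_velocity[OF h(1) tab h(2)]) (use cd in auto)
  ultimately show ?thesis using v tvec_of_self[OF \<phi>] tvec_of_at[OF \<phi>] by metis
qed

end

section \<open>Magnetic structures in a chart\<close>

locale magnetic_manifold = atlas A
  for A :: "('a::{t2_space, second_countable_topology}, 'n::finite) chart set" +
  fixes g \<Omega> :: "('a, 'n) bilinear_field" and \<omega> :: "('a, 'n) covector_field"
  assumes magnetic: "magnetic_structure A g \<Omega>"
    and one_form: "one_form A \<omega>"
    and exterior: "has_exterior_derivative A \<omega> (\<lambda>p u v. - \<Omega> p u v)"
begin

lemma metric: "riemannian_metric A g"
  using magnetic by (simp add: magnetic_structure_def)

lemma coord2_chart: "\<phi> \<in> charts_at A p \<Longrightarrow> coord2 A \<phi> B (snd \<phi> p) u v = B p (tvec_of A \<phi> p u) (tvec_of A \<phi> p v)"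
  by (simp add: coord2_def chart_inv_left charts_atD)

lemma coord1_chart: "\<phi> \<in> charts_at A p \<Longrightarrow> coord1 A \<phi> \<theta> (snd \<phi> p) u = \<theta> p (tvec_of A \<phi> p u)"
  by (simp add: coord1_def chart_inv_left charts_atD)

lemma bilinear_coord2:
  assumes B: "smooth_bilinear_field A B" and \<phi>: "\<phi> \<in> charts_at A p"
  shows "bilinear (\<lambda>u v. B p (tvec_of A \<phi> p u) (tvec_of A \<phi> p v))"
proof -
  have L: "B p (tvec_of A \<phi> p (r *\<^sub>R u + s *\<^sub>R v)) (tvec_of A \<phi> p w)
      = r * B p (tvec_of A \<phi> p u) (tvec_of A \<phi> p w) + s * B p (tvec_of A \<phi> p v) (tvec_of A \<phi> p w)"
    "B p (tvec_of A \<phi> p w) (tvec_of A \<phi> p (r *\<^sub>R u + s *\<^sub>R v))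
      = r * B p (tvec_of A \<phi> p w) (tvec_of A \<phi> p u) + s * B p (tvec_of A \<phi> p w) (tvec_of A \<phi> p v)" for r s u v w
    using B tvec_of_in[OF \<phi>] unfolding smooth_bilinear_field_def tvec_comb_tvec_of[OF \<phi>, symmetric] by blast+
  show ?thesis
    unfolding bilinear_def
  proof (intro conjI allI linearI)
    fix w u v :: "real ^ 'n" and r :: real
    show "B p (tvec_of A \<phi> p w) (tvec_of A \<phi> p (u + v)) = B p (tvec_of A \<phi> p w) (tvec_of A \<phi> p u) + B p (tvec_of A \<phi> p w) (tvec_of A \<phi> p v)"
      "B p (tvec_of A \<phi> p (u + v)) (tvec_of A \<phi> p w) = B p (tvec_of A \<phi> p u) (tvec_of A \<phi> p w) + B p (tvec_of A \<phi> p v) (tvec_of A \<phi> p w)"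
      using L(1)[of 1 u 1 v] L(2)[of w 1 u 1 v] by simp_all
    show "B p (tvec_of A \<phi> p w) (tvec_of A \<phi> p (r *\<^sub>R u)) = r *\<^sub>R B p (tvec_of A \<phi> p w) (tvec_of A \<phi> p u)"
      "B p (tvec_of A \<phi> p (r *\<^sub>R u)) (tvec_of A \<phi> p w) = r *\<^sub>R B p (tvec_of A \<phi> p u) (tvec_of A \<phi> p w)"
      using L(1)[of r u 0 0] L(2)[of w r u 0 0] by simp_all
  qed
qed

lemma linear_coord1:
  assumes \<phi>: "\<phi> \<in> charts_at A p"
  shows "linear (\<lambda>u. \<omega> p (tvec_of A \<phi> p u))"
proof -
  have L: "\<omega> p (tvec_of A \<phi> p (r *\<^sub>R u + s *\<^sub>R v)) = r * \<omega> p (tvec_of A \<phi> p u) + s * \<omega> p (tvec_of A \<phi> p v)" for r s u v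
    using one_form tvec_of_in[OF \<phi>] unfolding one_form_def tvec_comb_tvec_of[OF \<phi>, symmetric] by blast
  show ?thesis
  proof (rule linearI)
    fix u v :: "real ^ 'n" and r :: real
    show "\<omega> p (tvec_of A \<phi> p (u + v)) = \<omega> p (tvec_of A \<phi> p u) + \<omega> p (tvec_of A \<phi> p v)"
      using L[of 1 u 1 v] by simp
    show "\<omega> p (tvec_of A \<phi> p (r *\<^sub>R u)) = r *\<^sub>R \<omega> p (tvec_of A \<phi> p u)"
      using L[of r u 0 0] by simp
  qed
qed

lemma coordinates:
  assumes \<phi>: "\<phi> \<in> A"
  shows "coordinate_lagrangian_vec (chart_image \<phi>) (coord2 A \<phi> g) (coord1 A \<phi> \<omega>)"
proof -
  have at: "\<phi> \<in> charts_at A (chart_inv \<phi> x)" if "x \<in> chart_image \<phi>" for x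
    using \<phi> chart_inv_in[OF that] by (rule charts_atI)
  note g = metric[unfolded riemannian_metric_def]
  show ?thesis
  proof (intro coordinate_lagrangian_vec.intro coordinate_lagrangian.intro)
    show "open (chart_image \<phi>)" using \<phi> by (rule open_chart_image)
    fix x assume x: "x \<in> chart_image \<phi>"
    show "bilinear (coord2 A \<phi> g x)"
      using bilinear_coord2[OF _ at[OF x]] g unfolding coord2_def[abs_def] Let_def by blast
    show "linear (coord1 A \<phi> \<omega> x)"
      using linear_coord1[OF at[OF x]] by (simp add: coord1_def[abs_def] Let_def)
    show "coord2 A \<phi> g x u v = coord2 A \<phi> g x v u" for u v
      using g tvec_of_in[OF at[OF x]] by (simp add: coord2_def)
    show "coord2 A \<phi> g x u u > 0" if "u \<noteq> 0" for u
    proof -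
      have "tvec_of A \<phi> (chart_inv \<phi> x) u \<noteq> (\<lambda>\<psi>. 0)"
        using tvec_of_self[OF at[OF x], of u] that by auto
      then show ?thesis using g tvec_of_in[OF at[OF x]] unfolding coord2_def Let_def by blast
    qed
  next
    show "smooth_on (chart_image \<phi>) (\<lambda>x. coord2 A \<phi> g x u v)" for u v
      using g \<phi> by (simp add: smooth_bilinear_field_def)
    show "smooth_on (chart_image \<phi>) (\<lambda>x. coord1 A \<phi> \<omega> x u)" for u
      using one_form \<phi> by (simp add: one_form_def)
  qed
qed

text \<open>The Euler-Lagrange form of \<open>g(v,v)/2 + \<omega>(v)\<close> in the chart \<open>\<phi>\<close>.\<close>

abbreviation EL :: "('a, 'n) chart \<Rightarrow> real ^ 'n \<Rightarrow> real ^ 'n \<Rightarrow> real ^ 'n \<Rightarrow> real ^ 'n \<Rightarrow> real" where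
  "EL \<phi> \<equiv> coordinate_lagrangian.euler_lagrange (coord2 A \<phi> g) (coord1 A \<phi> \<omega>)"

text \<open>The definite description in \<open>lorentz_force\<close> is well defined: existence is the solution of a linear
  system with the invertible matrix of the metric, uniqueness is nondegeneracy of the metric.\<close>

lemma lorentz_force_properties:
  assumes u: "u \<in> tangent_space A p"
  shows "lorentz_force A g \<Omega> p u \<in> tangent_space A p"
    "v \<in> tangent_space A p \<Longrightarrow> \<Omega> p u v = g p (lorentz_force A g \<Omega> p u) v"
proof -
  obtain \<phi> where \<phi>: "\<phi> \<in> charts_at A p" by (rule chart_exists)
  let ?x = "snd \<phi> p"
  let ?t = "tvec_of A \<phi> p"
  have x: "?x \<in> chart_image \<phi>" using \<phi> by (auto simp: charts_at_def)
  interpret C: coordinate_lagrangian_vec "chart_image \<phi>" "coord2 A \<phi> g" "coord1 A \<phi> \<omega>"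
    by (rule coordinates[OF charts_atD(1)[OF \<phi>]])
  have "smooth_bilinear_field A \<Omega>"
    using magnetic by (simp add: magnetic_structure_def exact_two_form_def two_form_def)
  from bilinear_coord2[OF this \<phi>] have lin: "linear (\<lambda>w. \<Omega> p u (?t w))"
    unfolding bilinear_def using tvec_of_components[OF \<phi> u] by metis
  define f where "f = matrix_inv (C.gram ?x) *v (\<chi> m. \<Omega> p u (?t (axis m 1)))"
  have f: "\<Omega> p u (?t w) = g p (?t f) (?t w)" for w
  proof -
    have "g p (?t f) (?t w) = coord2 A \<phi> g ?x w f"
      using C.sym_G[OF x] by (simp add: coord2_chart[OF \<phi>])
    also have "\<dots> = (\<Sum>m\<in>UNIV. w $ m * \<Omega> p u (?t (axis m 1)))"
      unfolding C.G_gram[OF x] f_def C.gram_times_inverse[OF x] by simp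
    also have "\<dots> = \<Omega> p u (?t w)" by (rule linear_vec_expand[OF lin, symmetric])
    finally show ?thesis by simp
  qed
  have ex: "?t f \<in> tangent_space A p \<and> (\<forall>v\<in>tangent_space A p. \<Omega> p u v = g p (?t f) v)"
    using tvec_of_in[OF \<phi>] f tvec_of_components[OF \<phi>] by metis
  have "w = ?t f" if w: "w \<in> tangent_space A p \<and> (\<forall>v\<in>tangent_space A p. \<Omega> p u v = g p w v)" for w
  proof -
    have "coord2 A \<phi> g ?x (w \<phi> - f) z = 0" for z
    proof -
      have "coord2 A \<phi> g ?x (w \<phi>) z = coord2 A \<phi> g ?x f z"
        using w ex tvec_of_in[OF \<phi>] tvec_of_components[OF \<phi>, of w] by (simp add: coord2_chart[OF \<phi>])
      then show ?thesis by (simp add: linear_diff[OF C.linear_G_left[OF x]])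
    qed
    then have "w \<phi> = f" using C.G_nondegenerate[OF x, of "w \<phi> - f"] by simp
    then show ?thesis using tvec_of_components[OF \<phi>, of w] w by simp
  qed
  with ex have "lorentz_force A g \<Omega> p u \<in> tangent_space A p \<and>
      (\<forall>v\<in>tangent_space A p. \<Omega> p u v = g p (lorentz_force A g \<Omega> p u) v)"
    unfolding lorentz_force_def by (rule theI2)
  then show "lorentz_force A g \<Omega> p u \<in> tangent_space A p"
    "v \<in> tangent_space A p \<Longrightarrow> \<Omega> p u v = g p (lorentz_force A g \<Omega> p u) v" by blast+
qed

text \<open>The derivatives of the metric combine to the Christoffel term, and the antisymmetrized derivative of
  the one-form is \<open>d\<omega> = -\<Omega>\<close>, that is, minus the metric applied to the Lorentz force.\<close>

lemma euler_lagrange_geometric: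
  assumes \<phi>: "\<phi> \<in> charts_at A p"
  shows "EL \<phi> (snd \<phi> p) v a w = coord2 A \<phi> g (snd \<phi> p)
    (a + coordinate_lagrangian_vec.christoffel_term (coord2 A \<phi> g) (snd \<phi> p) v
       - lorentz_force A g \<Omega> p (tvec_of A \<phi> p v) \<phi>) w"
proof -
  let ?x = "snd \<phi> p"
  let ?t = "tvec_of A \<phi> p"
  have x: "?x \<in> chart_image \<phi>" using \<phi> by (auto simp: charts_at_def)
  interpret C: coordinate_lagrangian_vec "chart_image \<phi>" "coord2 A \<phi> g" "coord1 A \<phi> \<omega>"
    by (rule coordinates[OF charts_atD(1)[OF \<phi>]])
  note F = lorentz_force_properties[OF tvec_of_in[OF \<phi>, of v]]
  have "\<Omega> p (?t v) (?t w) = coord2 A \<phi> g ?x (lorentz_force A g \<Omega> p (?t v) \<phi>) w"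
    using F(2)[OF tvec_of_in[OF \<phi>]] tvec_of_components[OF \<phi> F(1)] by (simp add: coord2_chart[OF \<phi>])
  moreover have "- \<Omega> p (?t v) (?t w) = C.D\<theta> ?x v w - C.D\<theta> ?x w v"
    using exterior tvec_of_in[OF \<phi>] \<phi> unfolding has_exterior_derivative_def C.D\<theta>_def
    by (simp add: tvec_of_self[OF \<phi>])
  ultimately show ?thesis
    unfolding linear_diff[OF C.linear_G_left[OF x]] linear_add[OF C.linear_G_left[OF x]]
      C.G_christoffel_term[OF x] C.euler_lagrange_def by simp
qed

text \<open>The covariant derivative is given by its components in each chart, so the equation is compared with the
  Euler-Lagrange equation in one chart at a time.\<close>

lemma geodesic_equation_iff:
  assumes le: "local_expression \<phi> {a..b} \<gamma> W y" and t: "t \<in> {a..b}" "t \<in> W" and ab: "a < b"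
  shows "covariant_derivative A g a b \<gamma> (velocity A a b \<gamma>) t \<phi>
        = lorentz_force A g \<Omega> (\<gamma> t) (velocity A a b \<gamma> t) \<phi>
     \<longleftrightarrow> (\<forall>w. EL \<phi> (y t) (dot y t) (dot (dot y) t) w = 0)"
proof -
  note \<phi> = local_expressionD(7)[OF le t]
  have yt: "y t = snd \<phi> (\<gamma> t)" using local_expressionD(6)[OF le t] by simp
  have x: "y t \<in> chart_image \<phi>" by (rule local_expressionD(4)[OF le t(2)])
  interpret C: coordinate_lagrangian_vec "chart_image \<phi>" "coord2 A \<phi> g" "coord1 A \<phi> \<omega>"
    by (rule coordinates[OF charts_atD(1)[OF \<phi>]])
  have vel: "velocity A a b \<gamma> s \<phi> = dot y s" if "s \<in> {a..b}" "s \<in> W" for s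
    using local_expression_velocity(1)[OF le that ab] tvec_of_self[OF local_expressionD(7)[OF le that]] by simp
  have W: "\<forall>\<^sub>F s in at t within {a..b}. s \<in> {a..b} \<inter> W"
    unfolding eventually_at_topological using local_expressionD(3)[OF le] t(2) by blast
  have "(dot y has_vector_derivative dot (dot y) t) (at t within {a..b})"
    by (rule has_vector_derivative_at_within[OF has_dot[OF smooth_on_dot[OF local_expressionD(2)[OF le]] t(2)]])
  then have "((\<lambda>s. velocity A a b \<gamma> s \<phi>) has_vector_derivative dot (dot y) t) (at t within {a..b})"
    unfolding has_vector_derivative_def
    by (rule has_derivative_transform_eventually[OF _ eventually_mono[OF W] _ t(1)]) (use vel t in auto)
  then have acc: "vector_derivative (\<lambda>s. velocity A a b \<gamma> s \<phi>) (at t within {a..b}) = dot (dot y) t"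
    using vector_derivative_within_cbox[OF ab, of t] t(1) by simp
  have gram: "metric_matrix A g \<phi> = C.gram"
    by (rule ext) (simp add: metric_matrix_def C.gram_def)
  have "christoffel A g \<phi> (y t) k i j = (\<Sum>l\<in>UNIV. matrix_inv (C.gram (y t)) $ k $ l *
      (C.DG (y t) (axis i 1) (axis j 1) (axis l 1) + C.DG (y t) (axis j 1) (axis i 1) (axis l 1)
         - C.DG (y t) (axis l 1) (axis i 1) (axis j 1))) / 2" for k i j
    unfolding christoffel_def metric_partial_def gram C.DG_def by (simp add: C.gram_def)
  then have "(\<chi> k. \<Sum>i\<in>UNIV. \<Sum>j\<in>UNIV. christoffel A g \<phi> (y t) k i j * v $ i * v $ j) = C.christoffel_term (y t) v" for v
    by (simp only: C.christoffel_term_def)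
  then have cov: "covariant_derivative A g a b \<gamma> (velocity A a b \<gamma>) t \<phi>
      = dot (dot y) t + C.christoffel_term (y t) (dot y t)"
    unfolding covariant_derivative_def acc vel[OF t] yt[symmetric] using \<phi> by simp
  let ?F = "lorentz_force A g \<Omega> (\<gamma> t) (velocity A a b \<gamma> t) \<phi>"
  have EL: "EL \<phi> (y t) (dot y t) (dot (dot y) t) w
      = coord2 A \<phi> g (y t) (dot (dot y) t + C.christoffel_term (y t) (dot y t) - ?F) w" for w
    using euler_lagrange_geometric[OF \<phi>] local_expression_velocity(1)[OF le t ab] by (simp add: yt)
  show ?thesis
    unfolding EL cov using C.G_nondegenerate[OF x] linear_0[OF C.linear_G_left[OF x]]
    by (metis eq_iff_diff_eq_0)
qed

end

section \<open>First variation of the length\<close>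

lemma smooth_on_slice_t:
  fixes x :: "real \<times> real \<Rightarrow> 'e::euclidean_space"
  assumes x: "smooth_on W x" and T: "open T" "\<And>t. t \<in> T \<Longrightarrow> (s, t) \<in> W"
  shows "smooth_on T (\<lambda>t. x (s, t))" "t \<in> T \<Longrightarrow> dot (\<lambda>t. x (s, t)) t = partial_t x (s, t)"
proof -
  show 1: "smooth_on T (\<lambda>t. x (s, t))"
    by (rule smooth_on_compose[OF x smooth_on_Pair[OF smooth_on_const[OF T(1)] smooth_on_ident[OF T(1)]] T(2)])
  show "t \<in> T \<Longrightarrow> dot (\<lambda>t. x (s, t)) t = partial_t x (s, t)"
    using dot_eqI[OF 1 _ has_partial_t[OF x T(2)]] by blast
qed

lemma smooth_on_slice_s:
  fixes x :: "real \<times> real \<Rightarrow> 'e::euclidean_space"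
  assumes x: "smooth_on W x" and S: "open S" "\<And>s. s \<in> S \<Longrightarrow> (s, t) \<in> W"
  shows "smooth_on S (\<lambda>s. x (s, t))" "s \<in> S \<Longrightarrow> dot (\<lambda>s. x (s, t)) s = partial_s x (s, t)"
proof -
  show 1: "smooth_on S (\<lambda>s. x (s, t))"
    by (rule smooth_on_compose[OF x smooth_on_Pair[OF smooth_on_ident[OF S(1)] smooth_on_const[OF S(1)]] S(2)])
  show "s \<in> S \<Longrightarrow> dot (\<lambda>s. x (s, t)) s = partial_s x (s, t)"
    using dot_eqI[OF 1 _ has_partial_s[OF x S(2)]] by blast
qed

lemma open_slices:
  assumes "open (W :: (real \<times> real) set)"
  shows "open {t. (s, t) \<in> W}" "open {s. (s, t) \<in> W}"
  using open_vimage[OF assms, of "\<lambda>t. (s, t)"] open_vimage[OF assms, of "\<lambda>s. (s, t)"]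
  by (auto simp: vimage_def continuous_on_Pair)

text \<open>Integrability near \<open>s = 0\<close> is part of the notion because the derivatives over adjacent intervals can be
  added only if the integrals can, and the integral of a function that is not integrable has the
  default value \<open>0\<close>.\<close>

definition integral_derivative :: "(real \<Rightarrow> real \<Rightarrow> real) \<Rightarrow> real \<Rightarrow> real \<Rightarrow> real \<Rightarrow> bool" where
  "integral_derivative f c d D \<longleftrightarrow>
     (\<exists>\<delta>>0. \<forall>s\<in>{-\<delta>..\<delta>}. f s integrable_on {c..d}) \<and>
     ((\<lambda>s. integral {c..d} (f s)) has_real_derivative D) (at 0)"

lemma integral_derivative_combine:
  assumes "integral_derivative f a b D" "integral_derivative f b c E" "a \<le> b" "b \<le> c"
  shows "integral_derivative f a c (D + E)"
proof -
  obtain \<delta>1 \<delta>2 where \<delta>: "\<delta>1 > 0" "\<And>s. s \<in> {-\<delta>1..\<delta>1} \<Longrightarrow> f s integrable_on {a..b}"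
    "\<delta>2 > 0" "\<And>s. s \<in> {-\<delta>2..\<delta>2} \<Longrightarrow> f s integrable_on {b..c}"
    using assms(1,2) unfolding integral_derivative_def by blast
  define \<delta> where "\<delta> = min \<delta>1 \<delta>2"
  have "\<delta> > 0" using \<delta> by (simp add: \<delta>_def)
  have int: "f s integrable_on {a..b}" "f s integrable_on {b..c}" if "s \<in> {-\<delta>..\<delta>}" for s
    using \<delta> that by (auto simp: \<delta>_def)
  have int': "f s integrable_on {a..c}" if "s \<in> {-\<delta>..\<delta>}" for s
    using Henstock_Kurzweil_Integration.integrable_combine[OF assms(3,4) int[OF that]] .
  have "((\<lambda>s. integral {a..b} (f s) + integral {b..c} (f s)) has_real_derivative D + E) (at 0)"
    using assms(1,2) unfolding integral_derivative_def by (intro DERIV_add) auto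
  then have "((\<lambda>s. integral {a..c} (f s)) has_real_derivative D + E) (at 0)"
    by (rule has_field_derivative_transform_within_open[of _ _ _ "{-\<delta><..<\<delta>}"])
      (use \<open>\<delta> > 0\<close> Henstock_Kurzweil_Integration.integral_combine[OF assms(3,4) int'] in auto)
  with int' \<open>\<delta> > 0\<close> show ?thesis unfolding integral_derivative_def by blast
qed

lemma integral_derivative_trivial: "integral_derivative f a a 0"
  unfolding integral_derivative_def
  using integrable_on_refl[of _ a] by (auto intro!: exI[of _ 1])

lemma integral_derivative_cong:
  assumes f: "integral_derivative f c d D" and \<epsilon>: "\<epsilon> > 0"
    and eq: "\<And>s t. s \<in> {-\<epsilon><..<\<epsilon>} \<Longrightarrow> c < t \<Longrightarrow> t < d \<Longrightarrow> f s t = h s t"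
  shows "integral_derivative h c d D"
proof -
  obtain \<delta> where \<delta>: "\<delta> > 0" "\<And>s. s \<in> {-\<delta>..\<delta>} \<Longrightarrow> f s integrable_on {c..d}"
    using f unfolding integral_derivative_def by blast
  define \<delta>' where "\<delta>' = min \<delta> (\<epsilon> / 2)"
  have \<delta>': "\<delta>' > 0" "\<delta>' \<le> \<delta>" "\<delta>' < \<epsilon>" using \<delta> \<epsilon> by (auto simp: \<delta>'_def)
  have eq': "f s t = h s t" if "s \<in> {-\<epsilon><..<\<epsilon>}" "t \<in> {c..d} - {c, d}" for s t
    using that eq by auto
  have neg: "negligible {c, d}" by simp
  have "h s integrable_on {c..d}" if "s \<in> {-\<delta>'..\<delta>'}" for s
    by (rule integrable_spike[OF \<delta>(2)[of s] neg]) (use that \<delta>' eq'[of s] in auto)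
  moreover have "((\<lambda>s. integral {c..d} (h s)) has_real_derivative D) (at 0)"
  proof (rule has_field_derivative_transform_within_open[of _ _ _ "{-\<epsilon><..<\<epsilon>}"])
    show "((\<lambda>s. integral {c..d} (f s)) has_real_derivative D) (at 0)"
      using f by (simp add: integral_derivative_def)
    show "integral {c..d} (f s) = integral {c..d} (h s)" if "s \<in> {-\<epsilon><..<\<epsilon>}" for s
      by (rule integral_spike[OF neg]) (use eq'[OF that] in auto)
  qed (use \<epsilon> in auto)
  ultimately show ?thesis using \<delta>'(1) unfolding integral_derivative_def by blast
qed

lemma integral_derivative_unique:
  "integral_derivative f c d D \<Longrightarrow> ((\<lambda>s. integral {c..d} (f s)) has_real_derivative E) (at 0) \<Longrightarrow> D = E"
  unfolding integral_derivative_def using DERIV_unique by blast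

lemma (in atlas) local_expression_slice_t:
  fixes x :: "real \<times> real \<Rightarrow> real ^ 'n"
  assumes le: "local_expression \<phi> X h2 W x" and T: "open T" "\<And>t. t \<in> T \<Longrightarrow> (s, t) \<in> W"
    and h: "\<And>t. t \<in> S \<Longrightarrow> t \<in> T \<Longrightarrow> (s, t) \<in> X \<and> h2 (s, t) = h t"
  shows "local_expression \<phi> S h T (\<lambda>t. x (s, t))"
  unfolding local_expression_def
proof (intro conjI ballI)
  fix t assume t: "t \<in> S \<inter> T"
  then have "(s, t) \<in> X" "h2 (s, t) = h t" "(s, t) \<in> W" using h T(2) by auto
  then show "h t \<in> fst \<phi>" "snd \<phi> (h t) = x (s, t)"
    using local_expressionD(5)[OF le, of "(s, t)"] local_expressionD(6)[OF le, of "(s, t)"] by auto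
qed (use local_expressionD(1,4)[OF le] T(2) smooth_on_slice_t(1)[OF local_expressionD(2)[OF le] T] in auto)

lemma (in atlas) local_expression_slice_s:
  fixes x :: "real \<times> real \<Rightarrow> real ^ 'n"
  assumes le: "local_expression \<phi> X h2 W x" and T: "open T" "\<And>s. s \<in> T \<Longrightarrow> (s, t) \<in> W"
    and h: "\<And>s. s \<in> S \<Longrightarrow> s \<in> T \<Longrightarrow> (s, t) \<in> X \<and> h2 (s, t) = h s"
  shows "local_expression \<phi> S h T (\<lambda>s. x (s, t))"
  unfolding local_expression_def
proof (intro conjI ballI)
  fix s assume s: "s \<in> S \<inter> T"
  then have "(s, t) \<in> X" "h2 (s, t) = h s" "(s, t) \<in> W" using h T(2) by auto
  then show "h s \<in> fst \<phi>" "snd \<phi> (h s) = x (s, t)"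
    using local_expressionD(5)[OF le, of "(s, t)"] local_expressionD(6)[OF le, of "(s, t)"] by auto
qed (use local_expressionD(1,4)[OF le] T(2) smooth_on_slice_s(1)[OF local_expressionD(2)[OF le] T] in auto)

context magnetic_manifold
begin

definition randers :: "real \<Rightarrow> 'a \<Rightarrow> ('a, 'n) tvec \<Rightarrow> real" where
  "randers c = pre_randers g (\<lambda>p v. 1 / sqrt (2 * c) * \<omega> p v)"

definition chart_momentum :: "('a, 'n) chart \<Rightarrow> real ^ 'n \<Rightarrow> real ^ 'n \<Rightarrow> real ^ 'n \<Rightarrow> real" where
  "chart_momentum \<phi> x v w = coord2 A \<phi> g x v w + coord1 A \<phi> \<omega> x w"

lemma randers_chart:
  assumes "\<phi> \<in> charts_at A p"
  shows "randers c p (tvec_of A \<phi> p v) =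
    sqrt (coord2 A \<phi> g (snd \<phi> p) v v) + 1 / sqrt (2 * c) * coord1 A \<phi> \<omega> (snd \<phi> p) v"
  by (simp add: randers_def pre_randers_def coord2_chart[OF assms] coord1_chart[OF assms])

text \<open>The integrands of the length and of its coordinate expression agree only for \<open>u < t < v\<close>: the velocity
  within \<open>[a,b]\<close> is unspecified if the curve has a corner at \<open>u\<close> or \<open>v\<close>. Two points do not affect the
  integral.\<close>

lemma chart_first_variation:
  assumes le: "local_expression \<phi> ({-\<epsilon><..<\<epsilon>} \<times> {u..v}) (\<lambda>(s, t). H s t) W x" and \<epsilon>: "\<epsilon> > 0"
    and uv: "a \<le> u" "u \<le> v" "v \<le> b" "a < b" and W: "\<And>t. t \<in> {u..v} \<Longrightarrow> (0, t) \<in> W"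
    and c: "c > 0" and speed: "\<And>t. t \<in> {u..v} \<Longrightarrow>
      coord2 A \<phi> g (x (0, t)) (partial_t x (0, t)) (partial_t x (0, t)) = 2 * c"
  shows "integral_derivative (\<lambda>s t. randers c (H s t) (velocity A a b (H s) t)) u v
    (1 / sqrt (2 * c) * (chart_momentum \<phi> (x (0, v)) (partial_t x (0, v)) (partial_s x (0, v))
      - chart_momentum \<phi> (x (0, u)) (partial_t x (0, u)) (partial_s x (0, u))
      - integral {u..v} (\<lambda>t. EL \<phi> (x (0, t)) (partial_t x (0, t)) (partial_t (partial_t x) (0, t)) (partial_s x (0, t)))))"
    (is "integral_derivative _ _ _ ?D")
proof -
  note x = local_expressionD(2)[OF le] and o = local_expressionD(3)[OF le]
  interpret C: coordinate_lagrangian_vec "chart_image \<phi>" "coord2 A \<phi> g" "coord1 A \<phi> \<omega>"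
    by (rule coordinates[OF local_expressionD(1)[OF le]])
  define L where "L z = sqrt (coord2 A \<phi> g (x z) (partial_t x z) (partial_t x z))
      + 1 / sqrt (2 * c) * coord1 A \<phi> \<omega> (x z) (partial_t x z)" for z
  obtain \<delta> where \<delta>: "\<delta> > 0" "{-\<delta>..\<delta>} \<times> {u..v} \<subseteq> W"
    "\<And>s. s \<in> {-\<delta>..\<delta>} \<Longrightarrow> continuous_on {u..v} (\<lambda>t. L (s, t))"
    "((\<lambda>s. integral {u..v} (\<lambda>t. L (s, t))) has_real_derivative ?D) (at 0)"
    unfolding chart_momentum_def L_def
    by (rule C.first_variation[OF x local_expressionD(4)[OF le] uv(2) W, of "2 * c"]) (use c speed in auto)
  have D: "integral_derivative (\<lambda>s t. L (s, t)) u v ?D"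
    unfolding integral_derivative_def using \<delta> by (auto intro!: exI[of _ \<delta>] integrable_continuous_real)
  have L_eq: "L (s, t) = randers c (H s t) (velocity A a b (H s) t)"
    if s: "s \<in> {-min \<delta> \<epsilon><..<min \<delta> \<epsilon>}" and t: "u < t" "t < v" for s t
  proof -
    let ?T = "{t. (s, t) \<in> W} \<inter> {u<..<v}"
    have T: "open ?T" "\<And>t. t \<in> ?T \<Longrightarrow> (s, t) \<in> W" using open_slices[OF o] by auto
    have st: "(s, t) \<in> W" using \<delta>(2) s t by auto
    have X: "(s, r) \<in> {-\<epsilon><..<\<epsilon>} \<times> {u..v}" if "r \<in> ?T" for r using that s by auto
    have le': "local_expression \<phi> {a..b} (H s) ?T (\<lambda>t. x (s, t))"
      by (rule local_expression_slice_t[OF le T]) (use X in auto)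
    have vel: "velocity A a b (H s) t = tvec_of A \<phi> (H s t) (partial_t x (s, t))"
      using local_expression_velocity(1)[OF le', of t] smooth_on_slice_t(2)[OF x T, of t] st t uv by simp
    have tT: "t \<in> ?T" using st t by simp
    have "\<phi> \<in> charts_at A (H s t)" "snd \<phi> (H s t) = x (s, t)"
      using local_expressionD(6)[OF le X[OF tT] st] local_expressionD(7)[OF le X[OF tT] st] by simp_all
    then show ?thesis unfolding vel L_def by (simp add: randers_chart)
  qed
  show ?thesis
    by (rule integral_derivative_cong[OF D, of "min \<delta> \<epsilon>"]) (use \<delta>(1) \<epsilon> in simp, rule L_eq)
qed

lemma velocity_in_chart:
  assumes \<gamma>: "smooth_map_on A {a..b} \<gamma>" and le: "local_expression \<phi> {c..d} \<gamma> W y"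
    and t: "t \<in> {c..d}" "t \<in> W" and cd: "c < d" "a \<le> c" "d \<le> b"
  shows "velocity A a b \<gamma> t = tvec_of A \<phi> (\<gamma> t) (dot y t)"
proof -
  have tab: "t \<in> {a..b}" using t cd by auto
  have ab: "a < b" using cd by simp
  have \<phi>: "\<phi> \<in> charts_at A (\<gamma> t)" by (rule local_expressionD(7)[OF le t])
  obtain \<psi> W' y' where \<psi>: "t \<in> W'" "local_expression \<psi> {a..b} \<gamma> W' y'" "\<psi> \<in> charts_at A (\<gamma> t)"
    using smooth_map_on_local_expression_ex[OF \<gamma> tab] .
  have "velocity A a b \<gamma> t = tvec_of A \<psi> (\<gamma> t) (dot y' t)"
    by (rule local_expression_velocity[OF \<psi>(2) tab \<psi>(1) ab])
  then have v: "velocity A a b \<gamma> t = tvec_of A \<phi> (\<gamma> t) (velocity A a b \<gamma> t \<phi>)"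
    using tvec_of_components[OF \<phi>] tvec_of_in[OF \<psi>(3)] by simp
  with velocity_unique[OF v le \<psi>(2,1) t cd] show ?thesis by simp
qed

lemma momentum_zero:
  assumes "\<phi> \<in> charts_at A p"
  shows "g p (tvec_of A \<phi> p v) (tvec_of A \<phi> p 0) + \<omega> p (tvec_of A \<phi> p 0) = 0"
  using bilinear_rzero[OF bilinear_coord2[OF _ assms, of g]] linear_0[OF linear_coord1[OF assms]]
    metric by (simp add: riemannian_metric_def)

text \<open>The first variation formula holds on short intervals, each of which lies in one chart, and the boundary
  terms are expressed by the chart-independent momentum \<open>m\<close> of the variation field \<open>X\<close>. The formulas add
  up along each smooth piece of the variation and then over the pieces.\<close>

theorem magnetic_geodesic_imp_pregeodesic:
  assumes geo: "magnetic_geodesic A g \<Omega> a b \<gamma>" and energy: "has_energy A g a b \<gamma> c"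
    and c: "c > 0" and ab: "a < b"
  shows "pregeodesic A (randers c) a b \<gamma>"
  unfolding pregeodesic_def
proof (intro conjI allI impI)
  have \<gamma>: "smooth_map_on A {a..b} \<gamma>" using geo by (simp add: magnetic_geodesic_def)
  show "piecewise_smooth A a b \<gamma>"
  proof -
    have "piecewise (\<lambda>u v. smooth_map_on A {u..v} \<gamma>) a b"
      using \<gamma> ab by (intro piecewise_single) auto
    then show ?thesis unfolding piecewise_smooth_def piecewise_iff_partition .
  qed
  fix \<epsilon> H assume var: "proper_variation A a b \<gamma> \<epsilon> H"
  then have \<epsilon>: "\<epsilon> > 0" and H0: "\<And>t. t \<in> {a..b} \<Longrightarrow> H 0 t = \<gamma> t"
    and fixed: "\<And>s. s \<in> {-\<epsilon><..<\<epsilon>} \<Longrightarrow> H s a = \<gamma> a" "\<And>s. s \<in> {-\<epsilon><..<\<epsilon>} \<Longrightarrow> H s b = \<gamma> b"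
    and pieces: "piecewise (\<lambda>u v. smooth_map_on A ({-\<epsilon><..<\<epsilon>} \<times> {u..v}) (\<lambda>(s, t). H s t)) a b"
    unfolding proper_variation_def piecewise_iff_partition by blast+
  \<comment> \<open>The variation field is the velocity of the transversal curve; a compact interval around \<open>0\<close> inside the domain of \<open>s\<close> makes it an instance of \<open>velocity\<close>.\<close>
  define X where "X t = velocity A (-\<epsilon>/2) (\<epsilon>/2) (\<lambda>s. H s t) 0" for t
  define m where "m t = g (\<gamma> t) (velocity A a b \<gamma> t) (X t) + \<omega> (\<gamma> t) (X t)" for t
  define f where "f s t = randers c (H s t) (velocity A a b (H s) t)" for s t
  have piece: "integral_derivative f u v (1 / sqrt (2 * c) * (m v - m u))"
    if sm: "smooth_map_on A ({-\<epsilon><..<\<epsilon>} \<times> {u..v}) (\<lambda>(s, t). H s t)" and uv: "a \<le> u" "v \<le> b" "u < v" for u v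
  proof -
    \<comment> \<open>The bisection principle also considers intervals that leave \<open>[u,v]\<close>, hence the guards.\<close>
    define P where "P p q \<longleftrightarrow> (u \<le> p \<longrightarrow> q \<le> v \<longrightarrow> p \<le> q \<longrightarrow>
      integral_derivative f p q (1 / sqrt (2 * c) * (m q - m p)))" for p q
    have "u \<le> v" using uv by simp
    then have "P u v"
    proof (induction rule: Bolzano)
      case (trans p q r)
      then show ?case
        unfolding P_def using integral_derivative_combine[of f p q _ r]
        by (smt (verit, best) distrib_left)
    next
      case (local z)
      then have z: "(0, z) \<in> {-\<epsilon><..<\<epsilon>} \<times> {u..v}" using \<epsilon> by auto
      obtain \<phi> W x where zW: "(0, z) \<in> W"
        and le: "local_expression \<phi> ({-\<epsilon><..<\<epsilon>} \<times> {u..v}) (\<lambda>(s, t). H s t) W x"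
        by (rule smooth_map_on_local_expression_ex[OF sm z])
      note x = local_expressionD(2)[OF le] and o = local_expressionD(3)[OF le]
      interpret C: coordinate_lagrangian_vec "chart_image \<phi>" "coord2 A \<phi> g" "coord1 A \<phi> \<omega>"
        by (rule coordinates[OF local_expressionD(1)[OF le]])
      obtain r where r: "r > 0" "{0-r..0+r} \<times> {z-r..z+r} \<subseteq> W"
        using open_rectangle[OF o zW] .
      have "P p q" if "p \<le> z" "z \<le> q" "q - p < r" for p q
        unfolding P_def
      proof (intro impI)
        assume pq: "u \<le> p" "q \<le> v" "p \<le> q"
        have W: "(0, t) \<in> W" if "t \<in> {p..q}" for t
          using r that \<open>p \<le> z\<close> \<open>z \<le> q\<close> \<open>q - p < r\<close> by auto
        have XX: "(0, t) \<in> {-\<epsilon><..<\<epsilon>} \<times> {u..v}" if "t \<in> {p..q}" for t using that pq \<epsilon> by auto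
        let ?T = "{t. (0, t) \<in> W}" and ?y = "\<lambda>t. x (0, t)"
        have T: "open ?T" "\<And>t. t \<in> ?T \<Longrightarrow> (0, t) \<in> W" using open_slices[OF o] by auto
        have \<gamma>le: "local_expression \<phi> {u..v} \<gamma> ?T ?y"
          by (rule local_expression_slice_t[OF le T]) (use \<epsilon> uv H0 in auto)
        have at: "\<phi> \<in> charts_at A (\<gamma> t)" "snd \<phi> (\<gamma> t) = x (0, t)" "velocity A a b \<gamma> t = tvec_of A \<phi> (\<gamma> t) (partial_t x (0, t))"
          if "t \<in> {p..q}" for t
        proof -
          have t: "t \<in> {u..v}" "t \<in> ?T" using that pq W by auto
          show "\<phi> \<in> charts_at A (\<gamma> t)" "snd \<phi> (\<gamma> t) = x (0, t)"
            using local_expressionD(6,7)[OF \<gamma>le t] by auto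
          show "velocity A a b \<gamma> t = tvec_of A \<phi> (\<gamma> t) (partial_t x (0, t))"
            using velocity_in_chart[OF \<gamma> \<gamma>le t] uv smooth_on_slice_t(2)[OF x T t(2)] by simp
        qed
        have speed: "coord2 A \<phi> g (x (0, t)) (partial_t x (0, t)) (partial_t x (0, t)) = 2 * c" if "t \<in> {p..q}" for t
        proof -
          have "t \<in> {a..b}" using that pq uv by auto
          then have "g (\<gamma> t) (velocity A a b \<gamma> t) (velocity A a b \<gamma> t) = 2 * c"
            using energy by (simp add: has_energy_def field_simps)
          then show ?thesis using at[OF that] coord2_chart[OF at(1)[OF that], of g] by simp
        qed
        have mom: "chart_momentum \<phi> (x (0, t)) (partial_t x (0, t)) (partial_s x (0, t)) = m t" if t: "t \<in> {p..q}" for t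
        proof -
          let ?S = "{s. (s, t) \<in> W}"
          have S: "open ?S" "\<And>s. s \<in> ?S \<Longrightarrow> (s, t) \<in> W" using open_slices[OF o] by auto
          have "local_expression \<phi> {-\<epsilon>/2..\<epsilon>/2} (\<lambda>s. H s t) ?S (\<lambda>s. x (s, t))"
            by (rule local_expression_slice_s[OF le S]) (use \<epsilon> t pq in auto)
          from local_expression_velocity(1)[OF this, of 0] smooth_on_slice_s(2)[OF x S, of 0]
          have "X t = tvec_of A \<phi> (\<gamma> t) (partial_s x (0, t))"
            using \<epsilon> W[OF t] H0[of t] t pq uv by (simp add: X_def)
          then show ?thesis
            unfolding m_def at(3)[OF t] chart_momentum_def at(2)[OF t, symmetric] coord2_chart[OF at(1)[OF t]] coord1_chart[OF at(1)[OF t]]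
            by simp
        qed
        have EL0: "EL \<phi> (x (0, t)) (partial_t x (0, t)) (partial_t (partial_t x) (0, t)) w = 0" if "p < t" "t < q" for t w
        proof -
          let ?T' = "?T \<inter> {p<..<q}"
          have T': "open ?T'" "\<And>t. t \<in> ?T' \<Longrightarrow> (0, t) \<in> W"
            using open_Int[OF T(1) open_greaterThanLessThan] by simp_all
          have le': "local_expression \<phi> {a..b} \<gamma> ?T' ?y"
            by (rule local_expression_subset[OF \<gamma>le T'(1)]) (use pq in auto)
          have t: "t \<in> {a..b}" "t \<in> ?T'" using that pq uv W by auto
          have d1: "dot ?y s = partial_t x (0, s)" if "s \<in> ?T'" for s
            using smooth_on_slice_t(2)[OF x T'] that by blast
          have "dot (dot ?y) t = partial_t (partial_t x) (0, t)"
          proof (rule dot_eqI[OF smooth_on_dot[OF smooth_on_slice_t(1)[OF x T']] t(2)])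
            show "(dot ?y has_vector_derivative partial_t (partial_t x) (0, t)) (at t)"
              by (rule has_vector_derivative_transform_within_open[OF has_partial_t[OF smooth_on_partial_t[OF x] T'(2)[OF t(2)]] T'(1) t(2)])
                (rule d1[symmetric])
          qed
          moreover have "covariant_derivative A g a b \<gamma> (velocity A a b \<gamma>) t = lorentz_force A g \<Omega> (\<gamma> t) (velocity A a b \<gamma> t)"
            using geo t(1) by (simp add: magnetic_geodesic_def)
          ultimately show ?thesis
            using geodesic_equation_iff[OF le' t ab] d1[OF t(2)] by simp
        qed
        have "integral {p..q} (\<lambda>t. EL \<phi> (x (0, t)) (partial_t x (0, t)) (partial_t (partial_t x) (0, t)) (partial_s x (0, t)))
            = integral {p..q} (\<lambda>t. 0)"
          by (rule integral_spike[of "{p, q}"]) (use EL0 in auto)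
        moreover have le'': "local_expression \<phi> ({-\<epsilon><..<\<epsilon>} \<times> {p..q}) (\<lambda>(s, t). H s t) W x"
          by (rule local_expression_subset[OF le o]) (use pq in auto)
        ultimately show "integral_derivative f p q (1 / sqrt (2 * c) * (m q - m p))"
          using chart_first_variation[OF le'' \<epsilon> _ pq(3) _ ab W c speed] pq uv mom[of p] mom[of q]
          by (simp add: f_def[abs_def])
      qed
      then show ?case using r(1) by blast
    qed
    then show ?thesis using uv by (simp add: P_def)
  qed
  have "piecewise (\<lambda>u v. integral_derivative f u v (1 / sqrt (2 * c) * (m v - m u))) a b"
    by (rule piecewise_mono[OF pieces]) (rule piece)
  then have "integral_derivative f a b (1 / sqrt (2 * c) * (m b - m a))"
  proof (induction rule: piecewise.induct)
    case (empty a)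
    show ?case by (simp add: integral_derivative_trivial)
  next
    case (snoc a b c')
    from integral_derivative_combine[OF snoc.IH snoc(3)] show ?case
      using snoc(2) piecewise_le[OF snoc(1)] by (simp add: add_divide_distrib[symmetric])
  qed
  moreover have "m t = 0" if t: "t \<in> {a..b}" and const: "\<And>s. s \<in> {-\<epsilon><..<\<epsilon>} \<Longrightarrow> H s t = \<gamma> t" for t
  proof -
    obtain \<phi> W y where \<phi>: "t \<in> W" "local_expression \<phi> {a..b} \<gamma> W y" "\<phi> \<in> charts_at A (\<gamma> t)"
      using smooth_map_on_local_expression_ex[OF \<gamma> t] .
    have d: "smooth_on UNIV (\<lambda>s::real. snd \<phi> (\<gamma> t))" by (rule smooth_on_const) simp
    have "local_expression \<phi> {-\<epsilon>/2..\<epsilon>/2} (\<lambda>s. H s t) UNIV (\<lambda>s. snd \<phi> (\<gamma> t))"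
      unfolding local_expression_def using \<phi>(3) d const \<epsilon> by (auto simp: charts_at_def)
    from local_expression_velocity(1)[OF this, of 0] dot_eqI[OF d, of 0 0]
    have "X t = tvec_of A \<phi> (\<gamma> t) 0" using \<epsilon> const[of 0] by (simp add: X_def)
    moreover have "velocity A a b \<gamma> t = tvec_of A \<phi> (\<gamma> t) (dot y t)"
      by (rule local_expression_velocity[OF \<phi>(2) t \<phi>(1) ab])
    ultimately show ?thesis using momentum_zero[OF \<phi>(3)] by (simp add: m_def)
  qed
  ultimately show "((\<lambda>s. curve_length A (randers c) a b (H s)) has_real_derivative 0) (at 0)"
    using fixed ab by (simp add: integral_derivative_def curve_length_def f_def[abs_def])
qed

end

section \<open>Pregeodesics are magnetic geodesics\<close>

lemma open_meets_interior:
  fixes u v :: real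
  assumes "open V" "t \<in> V" "t \<in> {u..v}" "u < v"
  obtains s where "s \<in> V" "u < s" "s < v"
proof -
  have "t \<in> closure {u<..<v}" using assms by simp
  then have "V \<inter> {u<..<v} \<noteq> {}" using assms(1,2) open_Int_closure_eq_empty[OF assms(1)] by blast
  then show ?thesis using that by auto
qed

lemma open_contains_interval:
  fixes t :: real
  assumes "open V" "t \<in> V"
  obtains r where "r > 0" "{t-r..t+r} \<subseteq> V"
  using assms unfolding open_contains_cball cball_eq_atLeastAtMost by blast

lemma integral_derivative_const: "f integrable_on {u..v} \<Longrightarrow> integral_derivative (\<lambda>s. f) u v 0"
  unfolding integral_derivative_def by (auto intro!: exI[of _ 1])

lemma (in atlas) velocity_cong:
  assumes "open V" "t \<in> V" "t \<in> {a..b}" "\<And>r. r \<in> {a..b} \<Longrightarrow> r \<in> V \<Longrightarrow> h r = h' r"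
  shows "velocity A a b h t = velocity A a b h' t"
proof -
  have "vector_derivative (snd \<phi> \<circ> h) (at t within {a..b}) = vector_derivative (snd \<phi> \<circ> h') (at t within {a..b})" for \<phi> :: "('a, 'n) chart"
    by (rule vector_derivative_cong_eq) (use assms in \<open>auto simp: eventually_nhds\<close>)
  then show ?thesis unfolding velocity_def using assms(4)[OF assms(3,2)] by (intro ext) (simp only:)
qed

lemma (in atlas) smooth_map_on_constant_variation:
  assumes "smooth_map_on A {u..v} \<gamma>" "\<And>s t. t \<in> {u..v} \<Longrightarrow> H s t = \<gamma> t"
  shows "smooth_map_on A ({-\<epsilon><..<\<epsilon>} \<times> {u..v}) (\<lambda>(s, t). H s t)"
proof (rule smooth_map_onI)
  fix z assume z: "z \<in> {-\<epsilon><..<\<epsilon>} \<times> {u..v}"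
  then have t: "snd z \<in> {u..v}" by auto
  obtain \<phi> W y where \<phi>: "snd z \<in> W" "local_expression \<phi> {u..v} \<gamma> W y"
    by (rule smooth_map_on_local_expression_ex[OF assms(1) t])
  have o: "open (UNIV \<times> W)" using local_expressionD(3)[OF \<phi>(2)] by (simp add: open_Times)
  have "smooth_on (UNIV \<times> W) (\<lambda>z. y (snd z))"
    by (rule smooth_on_compose[OF local_expressionD(2)[OF \<phi>(2)] smooth_on_linear_map[OF o bounded_linear_snd]]) auto
  then have "local_expression \<phi> ({-\<epsilon><..<\<epsilon>} \<times> {u..v}) (\<lambda>(s, t). H s t) (UNIV \<times> W) (\<lambda>z. y (snd z))"
    using \<phi>(2) assms(2) unfolding local_expression_def by auto
  with \<phi>(1) show "\<exists>\<phi> W f. z \<in> W \<and> local_expression \<phi> ({-\<epsilon><..<\<epsilon>} \<times> {u..v}) (\<lambda>(s, t). H s t) W f"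
    by (intro exI[of _ \<phi>] exI[of _ "UNIV \<times> W"] exI[of _ "\<lambda>z. y (snd z)"]) (cases z, auto)
qed

context magnetic_manifold
begin

text \<open>The condition on the speed says nothing at corners. It holds there for both one-sided velocities by
  continuity, since the interior points of a smooth piece are dense in it.\<close>

lemma local_speed:
  assumes speed: "squared_speed A g a b \<gamma> e" and le: "local_expression \<phi> {u..v} \<gamma> W y"
    and t: "t \<in> {u..v}" "t \<in> W" and uv: "a \<le> u" "u < v" "v \<le> b"
  shows "coord2 A \<phi> g (y t) (dot y t) (dot y t) = e"
proof (rule ccontr)
  interpret C: coordinate_lagrangian_vec "chart_image \<phi>" "coord2 A \<phi> g" "coord1 A \<phi> \<omega>"
    by (rule coordinates[OF local_expressionD(1)[OF le]])
  note y = local_expressionD(2)[OF le] and o = local_expressionD(3)[OF le]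
  let ?q = "\<lambda>t. coord2 A \<phi> g (y t) (dot y t) (dot y t)"
  have q: "continuous_on W ?q"
    by (intro smooth_on_continuous C.smooth_on_G_along y smooth_on_dot local_expressionD(4)[OF le])
  assume neq: "?q t \<noteq> e"
  have "open (W \<inter> ?q -` (- {e}))" by (rule continuous_open_preimage[OF q o]) auto
  then obtain s where s: "s \<in> W" "?q s \<noteq> e" "u < s" "s < v"
    by (rule open_meets_interior[of _ t u v]) (use t neq uv in auto)
  have le': "local_expression \<phi> {a..b} \<gamma> (W \<inter> {u<..<v}) y"
    by (rule local_expression_subset[OF le open_Int[OF o open_greaterThanLessThan]]) auto
  have sab: "s \<in> {a..b}" "s \<in> W \<inter> {u<..<v}" using s uv by auto
  have ab: "a < b" using uv by simp
  note vel = local_expression_velocity[OF le' sab ab]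
  have "g (\<gamma> s) (velocity A a b \<gamma> s) (velocity A a b \<gamma> s) = e"
    using speed vel(2) sab(1) by (simp add: squared_speed_def)
  then have "?q s = e"
    using coord2_chart[OF local_expressionD(7)[OF le' sab], of g] local_expressionD(6)[OF le' sab] vel(1) by simp
  with s(2) show False by simp
qed

lemma randers_integrable_piece:
  assumes \<gamma>: "smooth_map_on A {u..v} \<gamma>" and uv: "a \<le> u" "u < v" "v \<le> b"
  shows "(\<lambda>t. randers c (\<gamma> t) (velocity A a b \<gamma> t)) integrable_on {u..v}" (is "?f integrable_on _")
proof -
  define P where "P p q \<longleftrightarrow> (u \<le> p \<longrightarrow> q \<le> v \<longrightarrow> p \<le> q \<longrightarrow> ?f integrable_on {p..q})" for p q
  have "u \<le> v" using uv by simp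
  then have "P u v"
  proof (induction rule: Bolzano)
    case (trans p q r)
    then show ?case
      unfolding P_def using Henstock_Kurzweil_Integration.integrable_combine[of p q r ?f] by auto
  next
    case (local z)
    then have z: "z \<in> {u..v}" by simp
    obtain \<phi> W y where zW: "z \<in> W" and le: "local_expression \<phi> {u..v} \<gamma> W y"
      by (rule smooth_map_on_local_expression_ex[OF \<gamma> z])
    note y = local_expressionD(2)[OF le] and o = local_expressionD(3)[OF le]
    interpret C: coordinate_lagrangian_vec "chart_image \<phi>" "coord2 A \<phi> g" "coord1 A \<phi> \<omega>"
      by (rule coordinates[OF local_expressionD(1)[OF le]])
    obtain r where r: "r > 0" "{z-r..z+r} \<subseteq> W" by (rule open_contains_interval[OF o zW])
    let ?k = "\<lambda>t. sqrt (coord2 A \<phi> g (y t) (dot y t) (dot y t)) + 1 / sqrt (2 * c) * coord1 A \<phi> \<omega> (y t) (dot y t)"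
    have k: "continuous_on W ?k"
      by (intro continuous_intros smooth_on_continuous C.smooth_on_G_along C.smooth_on_\<theta>_along y smooth_on_dot
          local_expressionD(4)[OF le])
    have "P p q" if "p \<le> z" "z \<le> q" "q - p < r" for p q
      unfolding P_def
    proof (intro impI)
      assume pq: "u \<le> p" "q \<le> v" "p \<le> q"
      have sub: "{p..q} \<subseteq> W" using that r by (auto simp: subset_iff)
      have "?k integrable_on {p..q}"
        by (rule integrable_continuous_real[OF continuous_on_subset[OF k sub]])
      then show "?f integrable_on {p..q}"
      proof (rule integrable_spike[of _ _ "{p, q}"])
        fix t assume "t \<in> {p..q} - {p, q}"
        then have t: "t \<in> {a..b}" "t \<in> W \<inter> {u<..<v}" using pq uv sub by auto
        have le': "local_expression \<phi> {a..b} \<gamma> (W \<inter> {u<..<v}) y"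
          by (rule local_expression_subset[OF le open_Int[OF o open_greaterThanLessThan]]) auto
        have "velocity A a b \<gamma> t = tvec_of A \<phi> (\<gamma> t) (dot y t)"
          by (rule local_expression_velocity[OF le' t]) (use uv in simp)
        then show "?f t = ?k t"
          using randers_chart[OF local_expressionD(7)[OF le' t]] local_expressionD(6)[OF le' t] by simp
      qed simp
    qed
    then show ?case using r(1) by blast
  qed
  then show ?thesis using uv by (simp add: P_def)
qed

lemma randers_integrable:
  assumes "piecewise (\<lambda>u v. smooth_map_on A {u..v} \<gamma>) a b"
  shows "(\<lambda>t. randers c (\<gamma> t) (velocity A a b \<gamma> t)) integrable_on {a..b}" (is "?f integrable_on _")
proof -
  have "piecewise (\<lambda>u v. ?f integrable_on {u..v}) a b"
    by (rule piecewise_mono[OF assms]) (rule randers_integrable_piece)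
  moreover have "piecewise (\<lambda>u v. f integrable_on {u..v}) p q \<Longrightarrow> f integrable_on {p..q}" for f :: "real \<Rightarrow> real" and p q
  proof (induction rule: piecewise.induct)
    case (empty a)
    show ?case using integrable_on_refl[of f a] by simp
  next
    case (snoc a b c)
    then show ?case
      using Henstock_Kurzweil_Integration.integrable_combine[of a b c f] piecewise_le[OF snoc(1)] by simp
  qed
  ultimately show ?thesis by blast
qed

text \<open>A variation that moves \<open>\<gamma>\<close> only over the interval from \<open>u\<close> to \<open>v\<close> is proper, and the rest of the length
  does not depend on \<open>s\<close>.\<close>

lemma localized_variation:
  assumes pieces: "piecewise (\<lambda>u v. smooth_map_on A {u..v} \<gamma>) a b"
    and preg: "pregeodesic A (randers c) a b \<gamma>" and uv: "a \<le> u" "u \<le> v" "v \<le> b" and \<epsilon>: "\<epsilon> > 0"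
    and out: "\<And>s t. \<not> (u < t \<and> t < v) \<Longrightarrow> H s t = \<gamma> t" and H0: "\<And>t. H 0 t = \<gamma> t"
    and Hpieces: "piecewise (\<lambda>p q. smooth_map_on A ({-\<epsilon><..<\<epsilon>} \<times> {p..q}) (\<lambda>(s, t). H s t)) u v"
    and D: "integral_derivative (\<lambda>s t. randers c (H s t) (velocity A a b (H s) t)) u v D"
  shows "D = 0"
proof -
  let ?f = "\<lambda>s t. randers c (H s t) (velocity A a b (H s) t)"
  let ?free = "\<lambda>t. randers c (\<gamma> t) (velocity A a b \<gamma> t)"
  let ?Q = "\<lambda>p q. smooth_map_on A ({-\<epsilon><..<\<epsilon>} \<times> {p..q}) (\<lambda>(s, t). H s t)"
  have her: "smooth_map_on A {p'..q'} \<gamma>" if "smooth_map_on A {p..q} \<gamma>" "p \<le> p'" "p' < q'" "q' \<le> q" for p q p' q'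
    using that(1) by (rule smooth_map_on_subset) (use that in auto)
  have "piecewise ?Q a u"
  proof (rule piecewise_mono[OF piecewise_upto[OF pieces her]])
    show "?Q p q" if "q \<le> u" "smooth_map_on A {p..q} \<gamma>" for p q
      by (rule smooth_map_on_constant_variation[OF that(2)]) (use out that in auto)
  qed (use uv in auto)
  moreover have "piecewise ?Q v b"
  proof (rule piecewise_mono[OF piecewise_from[OF pieces her]])
    show "?Q p q" if "v \<le> p" "smooth_map_on A {p..q} \<gamma>" for p q
      by (rule smooth_map_on_constant_variation[OF that(2)]) (use out that in auto)
  qed (use uv in auto)
  ultimately have "piecewise ?Q a b" using Hpieces piecewise_append by blast
  then have "proper_variation A a b \<gamma> \<epsilon> H"
    unfolding proper_variation_def piecewise_iff_partition using \<epsilon> H0 out uv by auto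
  then have "((\<lambda>s. integral {a..b} (?f s)) has_real_derivative 0) (at 0)"
    using preg unfolding pregeodesic_def curve_length_def by blast
  moreover have "integral_derivative ?f a b (0 + D + 0)"
  proof (intro integral_derivative_combine[OF integral_derivative_combine[OF _ D]])
    have int: "?free integrable_on {p..q}" if "a \<le> p" "q \<le> b" for p q
      using integrable_subinterval_real[OF randers_integrable[OF pieces]] that by auto
    have eq: "?free t = ?f s t" if V: "open V" "t \<in> V" "V \<subseteq> {..u} \<union> {v..}" "t \<in> {a..b}" for V s t
    proof -
      have "H s r = \<gamma> r" if "r \<in> V" for r using out that V(3) by fastforce
      then show ?thesis using velocity_cong[OF V(1,2,4), of \<gamma> "H s"] V(2) by simp
    qed
    show "integral_derivative ?f a u 0"
    proof (rule integral_derivative_cong[OF integral_derivative_const[OF int] \<epsilon>])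
      show "?free t = ?f s t" if "a < t" "t < u" for s t
        by (rule eq[of "{..<u}"]) (use that uv in auto)
    qed (use uv in auto)
    show "integral_derivative ?f v b 0"
    proof (rule integral_derivative_cong[OF integral_derivative_const[OF int] \<epsilon>])
      show "?free t = ?f s t" if "v < t" "t < b" for s t
        by (rule eq[of "{v<..}"]) (use that uv in auto)
    qed (use uv in auto)
  qed (use uv in auto)
  ultimately show ?thesis using integral_derivative_unique by fastforce
qed

text \<open>The variation that moves \<open>\<gamma>\<close> in the chart along the segments with direction \<open>\<eta>(t) w\<close>. By compactness it
  stays inside the chart for small \<open>s\<close>. Its variation field is \<open>\<eta> w\<close>, and the momentum and the
  Euler-Lagrange form are linear in it.\<close>

lemma linear_variation:
  assumes uv: "a \<le> u" "u < v" "v \<le> b" and le: "local_expression \<phi> {u..v} \<gamma> V y" and V: "{u..v} \<subseteq> V"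
    and \<eta>: "smooth_on UNIV (\<eta> :: real \<Rightarrow> real)" and c: "c > 0"
    and speed: "\<And>t. t \<in> {u..v} \<Longrightarrow> coord2 A \<phi> g (y t) (dot y t) (dot y t) = 2 * c"
    and H: "\<And>s t. t \<in> {u..v} \<Longrightarrow> H s t = chart_inv \<phi> (y t + (s * \<eta> t) *\<^sub>R w)"
  obtains \<epsilon> where "\<epsilon> > 0"
    "\<forall>\<epsilon>'\<le>\<epsilon>. smooth_map_on A ({-\<epsilon>'<..<\<epsilon>'} \<times> {u..v}) (\<lambda>(s, t). H s t)"
    "integral_derivative (\<lambda>s t. randers c (H s t) (velocity A a b (H s) t)) u v
        (1 / sqrt (2 * c) * (\<eta> v * chart_momentum \<phi> (y v) (dot y v) w - \<eta> u * chart_momentum \<phi> (y u) (dot y u) w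
          - integral {u..v} (\<lambda>t. \<eta> t * EL \<phi> (y t) (dot y t) (dot (dot y) t) w)))"
proof -
  note y = local_expressionD(2)[OF le] and oV = local_expressionD(3)[OF le]
  interpret C: coordinate_lagrangian_vec "chart_image \<phi>" "coord2 A \<phi> g" "coord1 A \<phi> \<omega>"
    by (rule coordinates[OF local_expressionD(1)[OF le]])
  define x where "x z = y (snd z) + (fst z * \<eta> (snd z)) *\<^sub>R w" for z :: "real \<times> real"
  have o: "open (UNIV \<times> V)" using oV by (simp add: open_Times)
  have "smooth_on (UNIV \<times> V) x"
    unfolding x_def
    by (intro smooth_on_add smooth_on_scaleR smooth_on_mult smooth_on_compose[OF y] smooth_on_compose[OF \<eta>]
        smooth_on_linear_map[OF o bounded_linear_snd] smooth_on_linear_map[OF o bounded_linear_fst] smooth_on_const o) auto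
  note xV = this
  define W where "W = (UNIV \<times> V) \<inter> x -` chart_image \<phi>"
  have oW: "open W"
    unfolding W_def by (rule continuous_open_preimage[OF smooth_on_continuous[OF xV] o C.open_U])
  have x: "smooth_on W x" by (rule smooth_on_subset[OF xV oW]) (simp add: W_def)
  have W0: "(0, t) \<in> W" if "t \<in> V" for t
    using that local_expressionD(4)[OF le that] by (simp add: W_def x_def)
  have "compact ({0} \<times> {u..v})" by (intro compact_Times) auto
  moreover have "{0} \<times> {u..v} \<subseteq> W" using W0 V by auto
  ultimately obtain \<epsilon> where \<epsilon>: "\<epsilon> > 0" "(\<Union>z\<in>{0} \<times> {u..v}. ball z \<epsilon>) \<subseteq> W"
    using compact_subset_open_imp_ball_epsilon_subset[OF _ oW] by blast
  have inW: "(s, t) \<in> W" if "s \<in> {-\<epsilon><..<\<epsilon>}" "t \<in> {u..v}" for s t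
  proof -
    have "dist (0, t) (s, t) < \<epsilon>" using that(1) by (auto simp: dist_Pair_Pair)
    then show ?thesis using \<epsilon>(2) that(2) by fastforce
  qed
  have pt: "partial_t x (0, t) = dot y t" if "t \<in> V" for t
    using vector_derivative_unique_at[OF has_partial_t[OF x W0[OF that]], of "dot y t"] has_dot[OF y that]
    by (simp add: x_def)
  have ptt: "partial_t (partial_t x) (0, t) = dot (dot y) t" if "t \<in> V" for t
  proof -
    have "((\<lambda>t. partial_t x (0, t)) has_vector_derivative dot (dot y) t) (at t)"
      by (rule has_vector_derivative_transform_within_open[OF has_dot[OF smooth_on_dot[OF y] that] oV that]) (simp add: pt)
    then show ?thesis
      using vector_derivative_unique_at[OF has_partial_t[OF smooth_on_partial_t[OF x] W0[OF that]]] by blast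
  qed
  have ps: "partial_s x (0, t) = \<eta> t *\<^sub>R w" if "t \<in> V" for t
  proof -
    have "((\<lambda>s. y t + (s * \<eta> t) *\<^sub>R w) has_vector_derivative \<eta> t *\<^sub>R w) (at 0)"
      by (auto intro!: derivative_eq_intros simp: has_vector_derivative_def)
    then show ?thesis
      using vector_derivative_unique_at[OF has_partial_s[OF x W0[OF that]], of "\<eta> t *\<^sub>R w"] by (simp add: x_def)
  qed
  have mom: "chart_momentum \<phi> (y t) v' (r *\<^sub>R w) = r * chart_momentum \<phi> (y t) v' w" if "t \<in> V" for t v' r
    using linear_cmul[OF C.linear_G_right] linear_cmul[OF C.linear_\<theta>] local_expressionD(4)[OF le that]
    by (simp add: chart_momentum_def distrib_left)
  have EL: "EL \<phi> (y t) v' a' (r *\<^sub>R w) = r * EL \<phi> (y t) v' a' w" if "t \<in> V" for t v' a' r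
    using linear_cmul[OF C.linear_euler_lagrange[OF local_expressionD(4)[OF le that]]] by simp
  have x0: "x (0, t) = y t" for t by (simp add: x_def)
  have xin: "x z \<in> chart_image \<phi>" if "z \<in> W" for z using that by (simp add: W_def)
  have le2: "local_expression \<phi> ({-\<epsilon>'<..<\<epsilon>'} \<times> {u..v}) (\<lambda>(s, t). H s t) W x" for \<epsilon>'
    unfolding local_expression_def
  proof (intro conjI ballI)
    fix z assume z: "z \<in> ({-\<epsilon>'<..<\<epsilon>'} \<times> {u..v}) \<inter> W"
    have "(\<lambda>(s, t). H s t) z = chart_inv \<phi> (x z)"
      using z H by (auto simp: x_def case_prod_beta)
    then show "(\<lambda>(s, t). H s t) z \<in> fst \<phi>" "snd \<phi> ((\<lambda>(s, t). H s t) z) = x z"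
      using chart_inv_in[OF xin] chart_inv_right[OF xin] z by auto
  qed (use x xin local_expressionD(1)[OF le] in auto)
  show ?thesis
  proof (rule that[OF \<epsilon>(1)], intro allI impI)
    fix \<epsilon>' assume \<epsilon>': "\<epsilon>' \<le> \<epsilon>"
    show "smooth_map_on A ({-\<epsilon>'<..<\<epsilon>'} \<times> {u..v}) (\<lambda>(s, t). H s t)"
    proof (rule smooth_map_onI)
      fix z assume "z \<in> {-\<epsilon>'<..<\<epsilon>'} \<times> {u..v}"
      then have "z \<in> W" using inW \<epsilon>' by (cases z) auto
      with le2 show "\<exists>\<phi> W f. z \<in> W \<and> local_expression \<phi> ({-\<epsilon>'<..<\<epsilon>'} \<times> {u..v}) (\<lambda>(s, t). H s t) W f" by blast
    qed
  next
    have uvV: "u \<in> V" "v \<in> V" using V uv by auto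
    have "integral {u..v} (\<lambda>t. EL \<phi> (x (0, t)) (partial_t x (0, t)) (partial_t (partial_t x) (0, t)) (partial_s x (0, t)))
       = integral {u..v} (\<lambda>t. \<eta> t * EL \<phi> (y t) (dot y t) (dot (dot y) t) w)"
      using V by (intro integral_cong) (auto simp: pt ptt ps x0 EL subset_iff)
    moreover have "integral_derivative (\<lambda>s t. randers c (H s t) (velocity A a b (H s) t)) u v
        (1 / sqrt (2 * c) * (chart_momentum \<phi> (x (0, v)) (partial_t x (0, v)) (partial_s x (0, v))
      - chart_momentum \<phi> (x (0, u)) (partial_t x (0, u)) (partial_s x (0, u))
      - integral {u..v} (\<lambda>t. EL \<phi> (x (0, t)) (partial_t x (0, t)) (partial_t (partial_t x) (0, t)) (partial_s x (0, t)))))"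
    proof (rule chart_first_variation[OF le2 \<epsilon>(1) uv(1) less_imp_le[OF uv(2)] uv(3) _ _ c])
      show "a < b" using uv by simp
      show "(0, t) \<in> W" if "t \<in> {u..v}" for t by (rule W0[OF subsetD[OF V that]])
      show "coord2 A \<phi> g (x (0, t)) (partial_t x (0, t)) (partial_t x (0, t)) = 2 * c" if "t \<in> {u..v}" for t
        unfolding x0 pt[OF subsetD[OF V that]] by (rule speed[OF that])
    qed
    ultimately show "integral_derivative (\<lambda>s t. randers c (H s t) (velocity A a b (H s) t)) u v
        (1 / sqrt (2 * c) * (\<eta> v * chart_momentum \<phi> (y v) (dot y v) w - \<eta> u * chart_momentum \<phi> (y u) (dot y u) w
          - integral {u..v} (\<lambda>t. \<eta> t * EL \<phi> (y t) (dot y t) (dot (dot y) t) w)))"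
      by (simp add: x0 pt[OF uvV(1)] pt[OF uvV(2)] ps[OF uvV(1)] ps[OF uvV(2)] mom[OF uvV(1)] mom[OF uvV(2)])
  qed
qed

text \<open>If the Euler-Lagrange form did not vanish on some vector, then after a change of sign it would be positive
  on a constant vector \<open>w'\<close> over a whole interval \<open>[u,v]\<close>. The variation along \<open>(t - u)(v - t) w'\<close> would have a
  nonzero first variation, since this field vanishes at both ends. Extended by \<open>0\<close> it has corners at \<open>u\<close>
  and \<open>v\<close>, which piecewise smooth variations may have.\<close>

lemma pregeodesic_euler_lagrange:
  assumes pieces: "piecewise (\<lambda>u v. smooth_map_on A {u..v} \<gamma>) a b"
    and preg: "pregeodesic A (randers c) a b \<gamma>" and speed: "squared_speed A g a b \<gamma> (2 * c)" and c: "c > 0"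
    and le: "local_expression \<phi> {p..q} \<gamma> W y" and pq: "a \<le> p" "p < q" "q \<le> b" and t: "t \<in> {p..q}" "t \<in> W"
  shows "EL \<phi> (y t) (dot y t) (dot (dot y) t) w = 0"
proof (rule ccontr)
  note y = local_expressionD(2)[OF le] and o = local_expressionD(3)[OF le]
  interpret C: coordinate_lagrangian_vec "chart_image \<phi>" "coord2 A \<phi> g" "coord1 A \<phi> \<omega>"
    by (rule coordinates[OF local_expressionD(1)[OF le]])
  define E where "E w r = EL \<phi> (y r) (dot y r) (dot (dot y) r) w" for w r
  have cont: "continuous_on W (E w)" for w
    unfolding E_def by (rule C.euler_lagrange_along_continuous[OF y local_expressionD(4)[OF le]])
  assume "EL \<phi> (y t) (dot y t) (dot (dot y) t) w \<noteq> 0"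
  then have neq: "t \<in> W \<inter> E w -` (- {0})" using t by (simp add: E_def)
  have "open (W \<inter> E w -` (- {0}))" by (rule continuous_open_preimage[OF cont o]) auto
  \<comment> \<open>The end points of the piece are reached by continuity: near them there is an interior point where the form does not vanish.\<close>
  then obtain t1 where t1: "t1 \<in> W \<inter> E w -` (- {0})" "p < t1" "t1 < q"
    using neq t(1) pq(2) by (rule open_meets_interior)
  define w' where "w' = sgn (E w t1) *\<^sub>R w"
  have "E w' t1 = sgn (E w t1) * E w t1"
    using linear_cmul[OF C.linear_euler_lagrange[OF local_expressionD(4)[OF le]]] t1(1) by (simp add: E_def w'_def)
  then have pos: "E w' t1 > 0" using t1(1) by (auto simp: sgn_if)
  define V where "V = (W \<inter> E w' -` {0<..}) \<inter> {p<..<q}"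
  have "open V" unfolding V_def
    by (intro open_Int continuous_open_preimage[OF cont o]) auto
  moreover have "t1 \<in> V" using t1 pos by (simp add: V_def)
  ultimately obtain \<rho> where \<rho>: "\<rho> > 0" "{t1-\<rho>..t1+\<rho>} \<subseteq> V" by (rule open_contains_interval)
  define u v where "u = t1 - \<rho>" and "v = t1 + \<rho>"
  have sub: "{u..v} \<subseteq> V" using \<rho>(2) by (simp add: u_def v_def)
  have uv: "u < t1" "t1 < v" "u < v" using \<rho>(1) by (auto simp: u_def v_def)
  have "u \<in> V" "v \<in> V" using sub uv by auto
  then have ab: "a \<le> u" "v \<le> b" "p < u" "v < q" using pq by (auto simp: V_def)
  have le': "local_expression \<phi> {u..v} \<gamma> W y"
    by (rule local_expression_subset[OF le o]) (use ab in auto)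
  have uvW: "{u..v} \<subseteq> W" using sub by (auto simp: V_def)
  define \<eta> where "\<eta> t = (t - u) * (v - t)" for t :: real
  have \<eta>: "smooth_on UNIV \<eta>"
    unfolding \<eta>_def by (intro smooth_on_mult smooth_on_diff smooth_on_ident smooth_on_const) auto
  have sp: "coord2 A \<phi> g (y t) (dot y t) (dot y t) = 2 * c" if "t \<in> {u..v}" for t
    by (rule local_speed[OF speed le' that]) (use that uvW ab uv in auto)
  define H where "H s t = (if u < t \<and> t < v then chart_inv \<phi> (y t + (s * \<eta> t) *\<^sub>R w') else \<gamma> t)" for s t
  have inv: "chart_inv \<phi> (y t) = \<gamma> t" if "t \<in> {u..v}" for t
    using local_expressionD(8)[OF le'] that uvW by auto
  have Heq: "H s t = chart_inv \<phi> (y t + (s * \<eta> t) *\<^sub>R w')" if "t \<in> {u..v}" for s t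
  proof (cases "u < t \<and> t < v")
    case False
    then have "t = u \<or> t = v" using that by auto
    then have "\<eta> t = 0" by (auto simp: \<eta>_def)
    then show ?thesis using False inv[OF that] by (simp add: H_def)
  qed (simp add: H_def)
  obtain \<epsilon> where \<epsilon>: "\<epsilon> > 0"
      "\<forall>\<epsilon>'\<le>\<epsilon>. smooth_map_on A ({-\<epsilon>'<..<\<epsilon>'} \<times> {u..v}) (\<lambda>(s, t). H s t)"
      "integral_derivative (\<lambda>s t. randers c (H s t) (velocity A a b (H s) t)) u v
        (1 / sqrt (2 * c) * (\<eta> v * chart_momentum \<phi> (y v) (dot y v) w' - \<eta> u * chart_momentum \<phi> (y u) (dot y u) w'
          - integral {u..v} (\<lambda>t. \<eta> t * EL \<phi> (y t) (dot y t) (dot (dot y) t) w')))"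
    by (rule linear_variation[OF ab(1) uv(3) ab(2) le' uvW \<eta> c sp Heq])
  have "1 / sqrt (2 * c) * (\<eta> v * chart_momentum \<phi> (y v) (dot y v) w' - \<eta> u * chart_momentum \<phi> (y u) (dot y u) w'
          - integral {u..v} (\<lambda>t. \<eta> t * EL \<phi> (y t) (dot y t) (dot (dot y) t) w')) = 0"
  proof (rule localized_variation[OF pieces preg ab(1) less_imp_le[OF uv(3)] ab(2) \<epsilon>(1)])
    show "H s t = \<gamma> t" if "\<not> (u < t \<and> t < v)" for s t
        unfolding H_def using that by (rule if_not_P)
    show "H 0 t = \<gamma> t" for t using inv[of t] by (auto simp: H_def)
    show "piecewise (\<lambda>p q. smooth_map_on A ({-\<epsilon><..<\<epsilon>} \<times> {p..q}) (\<lambda>(s, t). H s t)) u v"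
      using \<epsilon>(2)[rule_format, OF order_refl] uv by (intro piecewise_single) auto
  qed (rule \<epsilon>(3))
  then have "integral {u..v} (\<lambda>t. \<eta> t * E w' t) = 0"
    using c by (simp add: \<eta>_def E_def)
  moreover have "\<eta> t * E w' t \<ge> 0" if "t \<in> {u..v}" for t
    using that sub by (intro mult_nonneg_nonneg) (auto simp: \<eta>_def V_def)
  moreover have "continuous_on {u..v} (\<lambda>t. \<eta> t * E w' t)"
    by (intro continuous_on_mult continuous_on_subset[OF smooth_on_continuous[OF \<eta>]] continuous_on_subset[OF cont uvW]) auto
  ultimately have "\<eta> t1 * E w' t1 = 0"
    using integral_eq_0_iff[OF _ uv(3)] uv by auto
  then show False using pos uv by (simp add: \<eta>_def)
qed

text \<open>The variation along \<open>\<eta> w\<close>, where \<open>\<eta>\<close> is the piecewise linear hat function with value \<open>1\<close> at \<open>t0\<close>, has as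
  its first variation the jump of the momentum at \<open>t0\<close> applied to \<open>w\<close>, because the Euler-Lagrange form
  vanishes on both sides. The one-form contributes the same to both momenta.\<close>

lemma pregeodesic_no_corner:
  assumes pieces: "piecewise (\<lambda>u v. smooth_map_on A {u..v} \<gamma>) a b"
    and preg: "pregeodesic A (randers c) a b \<gamma>" and speed: "squared_speed A g a b \<gamma> (2 * c)" and c: "c > 0"
    and le1: "local_expression \<phi> {l..t0} \<gamma> W1 y1" and le2: "local_expression \<phi> {t0..r} \<gamma> W2 y2"
    and lr: "a \<le> l" "l < t0" "t0 < r" "r \<le> b" and t0: "t0 \<in> W1" "t0 \<in> W2"
  shows "dot y1 t0 = dot y2 t0"
proof -
  interpret C: coordinate_lagrangian_vec "chart_image \<phi>" "coord2 A \<phi> g" "coord1 A \<phi> \<omega>"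
    by (rule coordinates[OF local_expressionD(1)[OF le1]])
  have "open (W1 \<inter> W2 \<inter> {l<..<r})" using local_expressionD(3)[OF le1] local_expressionD(3)[OF le2] by auto
  moreover have "t0 \<in> W1 \<inter> W2 \<inter> {l<..<r}" using t0 lr by auto
  ultimately obtain \<rho> where \<rho>: "\<rho> > 0" "{t0-\<rho>..t0+\<rho>} \<subseteq> W1 \<inter> W2 \<inter> {l<..<r}"
    by (rule open_contains_interval)
  define u v where "u = t0 - \<rho>" and "v = t0 + \<rho>"
  have uv: "u < t0" "t0 < v" "u < v" using \<rho>(1) by (auto simp: u_def v_def)
  have sub: "{u..v} \<subseteq> W1 \<inter> W2 \<inter> {l<..<r}" using \<rho>(2) by (simp add: u_def v_def)
  have "u \<in> {l<..<r}" "v \<in> {l<..<r}" using subsetD[OF sub] uv by auto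
  then have ab: "l < u" "v < r" "a \<le> u" "v \<le> b" "t0 \<le> b" "a \<le> t0" using lr by auto
  have sub1: "{u..t0} \<subseteq> W1" and sub2: "{t0..v} \<subseteq> W2" using sub uv by (auto simp: subset_iff)
  have le1': "local_expression \<phi> {u..t0} \<gamma> W1 y1"
    by (rule local_expression_subset[OF le1 local_expressionD(3)[OF le1]]) (use ab in auto)
  have le2': "local_expression \<phi> {t0..v} \<gamma> W2 y2"
    by (rule local_expression_subset[OF le2 local_expressionD(3)[OF le2]]) (use ab in auto)
  have sp1: "coord2 A \<phi> g (y1 t) (dot y1 t) (dot y1 t) = 2 * c" if "t \<in> {u..t0}" for t
    by (rule local_speed[OF speed le1' that]) (use that sub1 ab uv in auto)
  have sp2: "coord2 A \<phi> g (y2 t) (dot y2 t) (dot y2 t) = 2 * c" if "t \<in> {t0..v}" for t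
    by (rule local_speed[OF speed le2' that]) (use that sub2 ab uv in auto)
  have EL1: "EL \<phi> (y1 t) (dot y1 t) (dot (dot y1) t) w = 0" if "t \<in> {u..t0}" for t w
    by (rule pregeodesic_euler_lagrange[OF pieces preg speed c le1']) (use that sub1 ab uv in auto)
  have EL2: "EL \<phi> (y2 t) (dot y2 t) (dot (dot y2) t) w = 0" if "t \<in> {t0..v}" for t w
    by (rule pregeodesic_euler_lagrange[OF pieces preg speed c le2']) (use that sub2 ab uv in auto)
  have t0in: "t0 \<in> {l..t0}" "t0 \<in> {t0..r}" using lr by auto
  have y0: "y1 t0 = snd \<phi> (\<gamma> t0)" "y2 t0 = snd \<phi> (\<gamma> t0)" "y1 t0 \<in> chart_image \<phi>"
    using local_expressionD(6)[OF le1 t0in(1) t0(1)] local_expressionD(6)[OF le2 t0in(2) t0(2)]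
      local_expressionD(4)[OF le1 t0(1)] by auto
  define \<eta>1 \<eta>2 where "\<eta>1 t = (t - u) / \<rho>" and "\<eta>2 t = (v - t) / \<rho>" for t :: real
  have \<eta>: "smooth_on UNIV \<eta>1" "smooth_on UNIV \<eta>2"
    unfolding \<eta>1_def \<eta>2_def using \<rho>(1)
    by (auto intro!: smooth_on_divide smooth_on_diff smooth_on_ident smooth_on_const)
  have \<eta>v: "\<eta>1 u = 0" "\<eta>1 t0 = 1" "\<eta>2 v = 0" "\<eta>2 t0 = 1"
    using \<rho>(1) by (auto simp: \<eta>1_def \<eta>2_def u_def v_def)
  have "coord2 A \<phi> g (y1 t0) (dot y1 t0 - dot y2 t0) w = 0" for w
  proof -
    define H where "H s t = (if u < t \<and> t < v then
        (if t \<le> t0 then chart_inv \<phi> (y1 t + (s * \<eta>1 t) *\<^sub>R w) else chart_inv \<phi> (y2 t + (s * \<eta>2 t) *\<^sub>R w)) else \<gamma> t)" for s t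
    have inv1: "chart_inv \<phi> (y1 t) = \<gamma> t" if "t \<in> {u..t0}" for t
      using local_expressionD(8)[OF le1'] that sub1 by auto
    have inv2: "chart_inv \<phi> (y2 t) = \<gamma> t" if "t \<in> {t0..v}" for t
      using local_expressionD(8)[OF le2'] that sub2 by auto
    have Heq1: "H s t = chart_inv \<phi> (y1 t + (s * \<eta>1 t) *\<^sub>R w)" if "t \<in> {u..t0}" for s t
    proof (cases "t = u")
      case True
      then show ?thesis using inv1[OF that] by (simp add: H_def \<eta>v)
    next
      case False
      then show ?thesis using that uv by (simp add: H_def)
    qed
    have Heq2: "H s t = chart_inv \<phi> (y2 t + (s * \<eta>2 t) *\<^sub>R w)" if t: "t \<in> {t0..v}" for s t
    proof -
      consider "t = v" | "t = t0" | "t0 < t" "t < v" using t by fastforce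
      then show ?thesis
      proof cases
        case 1
        then show ?thesis using inv2[OF t] by (simp add: H_def \<eta>v)
      next
        case 2
        then show ?thesis using uv y0 by (simp add: H_def \<eta>v)
      next
        case 3
        then show ?thesis using uv by (simp add: H_def)
      qed
    qed
    let ?f = "\<lambda>s t. randers c (H s t) (velocity A a b (H s) t)"
    let ?Q = "\<lambda>\<epsilon> p q. smooth_map_on A ({-\<epsilon><..<\<epsilon>} \<times> {p..q}) (\<lambda>(s, t). H s t)"
    have int1: "integral {u..t0} (\<lambda>t. \<eta>1 t * EL \<phi> (y1 t) (dot y1 t) (dot (dot y1) t) w) = 0"
      using EL1 by (subst integral_cong[of _ _ "\<lambda>t. 0"]) auto
    have int2: "integral {t0..v} (\<lambda>t. \<eta>2 t * EL \<phi> (y2 t) (dot y2 t) (dot (dot y2) t) w) = 0"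
      using EL2 by (subst integral_cong[of _ _ "\<lambda>t. 0"]) auto
    obtain \<epsilon>1 where \<epsilon>1: "\<epsilon>1 > 0" "\<forall>\<epsilon>'\<le>\<epsilon>1. ?Q \<epsilon>' u t0"
        "integral_derivative ?f u t0 (1 / sqrt (2 * c) * (\<eta>1 t0 * chart_momentum \<phi> (y1 t0) (dot y1 t0) w
          - \<eta>1 u * chart_momentum \<phi> (y1 u) (dot y1 u) w - integral {u..t0} (\<lambda>t. \<eta>1 t * EL \<phi> (y1 t) (dot y1 t) (dot (dot y1) t) w)))"
      by (rule linear_variation[OF ab(3) uv(1) ab(5) le1' sub1 \<eta>(1) c sp1 Heq1])
    obtain \<epsilon>2 where \<epsilon>2: "\<epsilon>2 > 0" "\<forall>\<epsilon>'\<le>\<epsilon>2. ?Q \<epsilon>' t0 v"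
        "integral_derivative ?f t0 v (1 / sqrt (2 * c) * (\<eta>2 v * chart_momentum \<phi> (y2 v) (dot y2 v) w
          - \<eta>2 t0 * chart_momentum \<phi> (y2 t0) (dot y2 t0) w - integral {t0..v} (\<lambda>t. \<eta>2 t * EL \<phi> (y2 t) (dot y2 t) (dot (dot y2) t) w)))"
      by (rule linear_variation[OF ab(6) uv(2) ab(4) le2' sub2 \<eta>(2) c sp2 Heq2])
    define \<epsilon> where "\<epsilon> = min \<epsilon>1 \<epsilon>2"
    have \<epsilon>: "\<epsilon> > 0" "\<epsilon> \<le> \<epsilon>1" "\<epsilon> \<le> \<epsilon>2" using \<epsilon>1(1) \<epsilon>2(1) by (auto simp: \<epsilon>_def)
    note V1 = \<epsilon>1(2)[rule_format, OF \<epsilon>(2)] \<epsilon>1(3)[unfolded int1 \<eta>v] and V2 = \<epsilon>2(2)[rule_format, OF \<epsilon>(3)] \<epsilon>2(3)[unfolded int2 \<eta>v]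
    have "1 / sqrt (2 * c) * (chart_momentum \<phi> (y1 t0) (dot y1 t0) w) + 1 / sqrt (2 * c) * (- chart_momentum \<phi> (y2 t0) (dot y2 t0) w) = 0"
    proof (rule localized_variation[OF pieces preg ab(3) less_imp_le[OF uv(3)] ab(4) \<epsilon>(1)])
      show "H s t = \<gamma> t" if "\<not> (u < t \<and> t < v)" for s t
        unfolding H_def using that by (rule if_not_P)
      show "H 0 t = \<gamma> t" for t using inv1[of t] inv2[of t] by (auto simp: H_def)
      show "piecewise (?Q \<epsilon>) u v"
        using V1 V2 uv by (intro piecewise_append[OF piecewise_single piecewise_single]) auto
      show "integral_derivative ?f u v (1 / sqrt (2 * c) * (chart_momentum \<phi> (y1 t0) (dot y1 t0) w)
          + 1 / sqrt (2 * c) * (- chart_momentum \<phi> (y2 t0) (dot y2 t0) w))"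
        using V1 V2 uv by (intro integral_derivative_combine) auto
    qed
    then have "1 / sqrt (2 * c) * (chart_momentum \<phi> (y1 t0) (dot y1 t0) w - chart_momentum \<phi> (y2 t0) (dot y2 t0) w) = 0"
      by (simp add: right_diff_distrib)
    then have "chart_momentum \<phi> (y1 t0) (dot y1 t0) w = chart_momentum \<phi> (y2 t0) (dot y2 t0) w" using c by simp
    then show ?thesis
      using linear_diff[OF C.linear_G_left[OF y0(3)]] y0(1,2) by (simp add: chart_momentum_def)
  qed
  then have "dot y1 t0 - dot y2 t0 = 0" by (rule C.G_nondegenerate[OF y0(3)])
  then show ?thesis by simp
qed

lemma pregeodesic_smooth:
  assumes pieces: "piecewise (\<lambda>u v. smooth_map_on A {u..v} \<gamma>) a b"
    and preg: "pregeodesic A (randers c) a b \<gamma>" and speed: "squared_speed A g a b \<gamma> (2 * c)" and c: "c > 0"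
    and ab: "a < b"
  shows "smooth_map_on A {a..b} \<gamma>"
proof (rule smooth_map_onI)
  fix t0 assume t0: "t0 \<in> {a..b}"
  have her: "smooth_map_on A {p'..q'} \<gamma>" if "smooth_map_on A {p..q} \<gamma>" "p \<le> p'" "p' < q'" "q' \<le> q" for p q p' q'
    using that(1) by (rule smooth_map_on_subset) (use that in auto)
  obtain \<phi> where \<phi>: "\<phi> \<in> charts_at A (\<gamma> t0)" by (rule chart_exists)
  have left: "\<exists>l W y. a \<le> l \<and> l < t0 \<and> t0 \<in> W \<and> local_expression \<phi> {l..t0} \<gamma> W y" if at0: "a < t0"
  proof -
    obtain l where l: "a \<le> l" "l < t0" "smooth_map_on A {l..t0} \<gamma>"
      by (rule piecewise_left_piece[OF pieces her at0]) (use t0 in auto)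
    moreover obtain W y where "t0 \<in> W" "local_expression \<phi> {l..t0} \<gamma> W y"
      by (rule smooth_map_on_local_expression[OF l(3) _ \<phi>]) (use l in auto)
    ultimately show ?thesis by blast
  qed
  have right: "\<exists>r W y. t0 < r \<and> r \<le> b \<and> t0 \<in> W \<and> local_expression \<phi> {t0..r} \<gamma> W y" if t0b: "t0 < b"
  proof -
    obtain r where r: "t0 < r" "r \<le> b" "smooth_map_on A {t0..r} \<gamma>"
      by (rule piecewise_right_piece[OF pieces her _ t0b]) (use t0 in auto)
    moreover obtain W y where "t0 \<in> W" "local_expression \<phi> {t0..r} \<gamma> W y"
      by (rule smooth_map_on_local_expression[OF r(3) _ \<phi>]) (use r in auto)
    ultimately show ?thesis by blast
  qed
  consider "t0 = a" | "t0 = b" | "a < t0" "t0 < b" using t0 by fastforce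
  then show "\<exists>\<phi> W f. t0 \<in> W \<and> local_expression \<phi> {a..b} \<gamma> W f"
  proof cases
    case 1
    then have "t0 < b" using ab by simp
    from right[OF this] obtain r W y where r: "t0 < r" "r \<le> b" "t0 \<in> W" "local_expression \<phi> {t0..r} \<gamma> W y"
      by (elim exE conjE)
    have "local_expression \<phi> {a..b} \<gamma> (W \<inter> {..<r}) y"
      by (rule local_expression_subset[OF r(4) open_Int[OF local_expressionD(3)[OF r(4)] open_lessThan]]) (use 1 in auto)
    moreover have "t0 \<in> W \<inter> {..<r}" using r by simp
    ultimately show ?thesis by (intro exI conjI)
  next
    case 2
    then have "a < t0" using ab by simp
    from left[OF this] obtain l W y where l: "a \<le> l" "l < t0" "t0 \<in> W" "local_expression \<phi> {l..t0} \<gamma> W y"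
      by (elim exE conjE)
    have "local_expression \<phi> {a..b} \<gamma> (W \<inter> {l<..}) y"
      by (rule local_expression_subset[OF l(4) open_Int[OF local_expressionD(3)[OF l(4)] open_greaterThan]]) (use 2 in auto)
    moreover have "t0 \<in> W \<inter> {l<..}" using l by simp
    ultimately show ?thesis by (intro exI conjI)
  next
    case 3
    from left[OF 3(1)] obtain l W1 y1 where l: "a \<le> l" "l < t0" "t0 \<in> W1"
      and le1: "local_expression \<phi> {l..t0} \<gamma> W1 y1" by (elim exE conjE)
    from right[OF 3(2)] obtain r W2 y2 where r: "t0 < r" "r \<le> b" "t0 \<in> W2"
      and le2: "local_expression \<phi> {t0..r} \<gamma> W2 y2" by (elim exE conjE)
    interpret C: coordinate_lagrangian_vec "chart_image \<phi>" "coord2 A \<phi> g" "coord1 A \<phi> \<omega>"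
      by (rule coordinates[OF local_expressionD(1)[OF le1]])
    define T where "T = W1 \<inter> W2 \<inter> {l<..<r}"
    have T: "open T" "t0 \<in> T" "T \<subseteq> W1" "T \<subseteq> W2"
      using local_expressionD(3)[OF le1] local_expressionD(3)[OF le2] l r by (auto simp: T_def)
    have T1: "t \<in> {l..t0}" "t \<in> W1" if "t \<in> T" "t \<le> t0" for t using that by (auto simp: T_def)
    have T2: "t \<in> {t0..r}" "t \<in> W2" if "t \<in> T" "t0 \<le> t" for t using that by (auto simp: T_def)
    have lt: "l < t0" "t0 \<le> b" "a \<le> t0" using l r 3 by auto
    let ?y = "\<lambda>t. if t \<le> t0 then y1 t else y2 t"
    have "smooth_on T ?y"
    proof (rule C.glue_extremals)
      show "smooth_on T y1" "smooth_on T y2"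
        using smooth_on_subset[OF local_expressionD(2)[OF le1] T(1,3)] smooth_on_subset[OF local_expressionD(2)[OF le2] T(1,4)] .
      show "y1 t \<in> chart_image \<phi>" "y2 t \<in> chart_image \<phi>" if "t \<in> T" for t
        using local_expressionD(4)[OF le1] local_expressionD(4)[OF le2] that T(3,4) by auto
      show "y1 t0 = y2 t0"
        using local_expressionD(6)[OF le1 T1[OF T(2) order_refl]] local_expressionD(6)[OF le2 T2[OF T(2) order_refl]] by simp
      show "dot y1 t0 = dot y2 t0"
        by (rule pregeodesic_no_corner[OF pieces preg speed c le1 le2 l(1,2) r(1,2) l(3) r(3)])
      show "EL \<phi> (y1 t) (dot y1 t) (dot (dot y1) t) w = 0" if "t \<in> T" "t \<le> t0" for t w
        by (rule pregeodesic_euler_lagrange[OF pieces preg speed c le1 l(1,2) lt(2) T1[OF that]])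
      show "EL \<phi> (y2 t) (dot y2 t) (dot (dot y2) t) w = 0" if "t \<in> T" "t0 \<le> t" for t w
        by (rule pregeodesic_euler_lagrange[OF pieces preg speed c le2 lt(3) r(1,2) T2[OF that]])
    qed (rule T(2))
    moreover have "\<gamma> t \<in> fst \<phi> \<and> snd \<phi> (\<gamma> t) = ?y t" if "t \<in> T" for t
    proof (cases "t \<le> t0")
      case True
      then show ?thesis using local_expressionD(5,6)[OF le1 T1[OF that]] by auto
    next
      case False
      then show ?thesis using local_expressionD(5,6)[OF le2 T2[OF that]] by auto
    qed
    moreover have "?y ` T \<subseteq> chart_image \<phi>"
      using local_expressionD(4)[OF le1] local_expressionD(4)[OF le2] T(3,4) by auto
    ultimately have "local_expression \<phi> {a..b} \<gamma> T ?y"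
      unfolding local_expression_def using local_expressionD(1)[OF le1] by blast
    with T(2) show ?thesis by blast
  qed
qed

theorem pregeodesic_imp_magnetic_geodesic:
  assumes preg: "pregeodesic A (randers c) a b \<gamma>" and speed: "squared_speed A g a b \<gamma> (2 * c)" and c: "c > 0"
    and ab: "a < b"
  shows "magnetic_geodesic A g \<Omega> a b \<gamma>" "has_energy A g a b \<gamma> c"
proof -
  have pieces: "piecewise (\<lambda>u v. smooth_map_on A {u..v} \<gamma>) a b"
    using preg unfolding pregeodesic_def piecewise_smooth_def piecewise_iff_partition by blast
  have \<gamma>: "smooth_map_on A {a..b} \<gamma>" by (rule pregeodesic_smooth[OF pieces preg speed c ab])
  have "covariant_derivative A g a b \<gamma> (velocity A a b \<gamma>) t = lorentz_force A g \<Omega> (\<gamma> t) (velocity A a b \<gamma> t)"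
    if t: "t \<in> {a..b}" for t
  proof
    fix \<phi>
    show "covariant_derivative A g a b \<gamma> (velocity A a b \<gamma>) t \<phi> = lorentz_force A g \<Omega> (\<gamma> t) (velocity A a b \<gamma> t) \<phi>"
    proof (cases "\<phi> \<in> charts_at A (\<gamma> t)")
      case True
      obtain W y where W: "t \<in> W" and le: "local_expression \<phi> {a..b} \<gamma> W y"
        by (rule smooth_map_on_local_expression[OF \<gamma> t True])
      show ?thesis
        using geodesic_equation_iff[OF le t W ab]
          pregeodesic_euler_lagrange[OF pieces preg speed c le order_refl ab order_refl t W] by blast
    next
      case False
      obtain \<psi> W y where W: "t \<in> W" and le: "local_expression \<psi> {a..b} \<gamma> W y" and \<psi>: "\<psi> \<in> charts_at A (\<gamma> t)"
        by (rule smooth_map_on_local_expression_ex[OF \<gamma> t])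
      have "velocity A a b \<gamma> t \<in> tangent_space A (\<gamma> t)"
        unfolding local_expression_velocity(1)[OF le t W ab] by (rule tvec_of_in[OF \<psi>])
      then have "lorentz_force A g \<Omega> (\<gamma> t) (velocity A a b \<gamma> t) \<in> tangent_space A (\<gamma> t)"
        by (rule lorentz_force_properties(1))
      then have "lorentz_force A g \<Omega> (\<gamma> t) (velocity A a b \<gamma> t) \<phi> = 0"
        using False unfolding tangent_space_def by blast
      then show ?thesis using False by (simp add: covariant_derivative_def)
    qed
  qed
  with \<gamma> show "magnetic_geodesic A g \<Omega> a b \<gamma>" by (simp add: magnetic_geodesic_def)
  show "has_energy A g a b \<gamma> c"
    unfolding has_energy_def
  proof
    fix t assume t: "t \<in> {a..b}"
    obtain \<psi> W y where W: "t \<in> W" and le: "local_expression \<psi> {a..b} \<gamma> W y"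
      by (rule smooth_map_on_local_expression_ex[OF \<gamma> t])
    from speed local_expression_velocity(2)[OF le t W ab] t
    show "g (\<gamma> t) (velocity A a b \<gamma> t) (velocity A a b \<gamma> t) / 2 = c"
      by (simp add: squared_speed_def)
  qed
qed

end

theorem proposition5p8:
  fixes A :: "('a::{t2_space, second_countable_topology}, 'n::finite) chart set"
    and g \<Omega> :: "('a, 'n) bilinear_field"
    and \<omega> :: "('a, 'n) covector_field"
    and \<gamma> :: "real \<Rightarrow> 'a"
    and a b c :: real
  assumes "smooth_manifold A"
    and "magnetic_structure A g \<Omega>"
    and "one_form A \<omega>"
    and "has_exterior_derivative A \<omega> (\<lambda>p u v. - \<Omega> p u v)"
    and "c > 0"
    and "a < b"
  shows "magnetic_geodesic A g \<Omega> a b \<gamma> \<and> has_energy A g a b \<gamma> c \<longleftrightarrow>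
         pregeodesic A (pre_randers g (\<lambda>p v. 1 / sqrt (2 * c) * \<omega> p v)) a b \<gamma> \<and>
         squared_speed A g a b \<gamma> (2 * c)"
proof -
  interpret magnetic_manifold A g \<Omega> \<omega>
    using assms by unfold_locales
  have "squared_speed A g a b \<gamma> (2 * c)" if "has_energy A g a b \<gamma> c"
    using that by (auto simp: squared_speed_def has_energy_def)
  then show ?thesis
    using magnetic_geodesic_imp_pregeodesic[of a b \<gamma> c] pregeodesic_imp_magnetic_geodesic[of c a b \<gamma>] assms(5,6)
    unfolding randers_def by blast
qed

end
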